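(* Let $\mathcal U$, $\mathcal U'$ be Hopf algebroids over $k$, let $C$ be a cocommutative $k$-coalgebra and let $(\Psi,\psi):C\longrightarrow V(\mathcal U,\mathcal U')$ be a measuring of Hopf algebroids. For each $x\in C$, the family of maps $$\overline\Psi^n(x):C^n(\mathcal U)\longrightarrow C^n(\mathcal U'),\qquad u^1\otimes\dots\otimes u^n\mapsto x_{(1)}(u^1)\otimes\dots\otimes x_{(n)}(u^n)\qquad(n\ge 0)$$ gives a morphism of cocyclic modules $C^\bullet(\mathcal U)\to C^\bullet(\mathcal U')$. In particular, for each $x\in C$ there are induced morphisms on Hochschild and cyclic cohomologies $$\overline\Psi^\bullet_{hoc}(x):HH^\bullet(\mathcal U)\longrightarrow HH^\bullet(\mathcal U'),\qquad \overline\Psi^\bullet_{cy}(x):HC^\bullet(\mathcal U)\longrightarrow HC^\bullet(\mathcal U').$$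
   Context: $k$ is a field; $Vect_k(V,W)$ denotes the space of $k$-linear maps. Sweedler notation is used with summation suppressed. Left bialgebroid $(U,A_L,s_L,t_L,\Delta_L,\epsilon_L)$ over $k$ (write $A=A_L$): unital $k$-algebras $U,A$; $k$-algebra morphisms $s_L:A\to U$, $t_L:A^{op}\to U$ with commuting images; $U$ is an $(A,A)$-bimodule via $a\cdot u\cdot b=s_L(a)t_L(b)u$ and $U\otimes_{A_L}U$ is formed with this structure (so $t_L(a)u\otimes v=u\otimes s_L(a)v$); $(U,\Delta_L:U\to U\otimes_{A_L}U,\epsilon_L:U\to A_L)$ is a coalgebra in $(A,A)$-bimodules such that $\Delta_L$ takes values in $U\times_{A_L}U:=\{\sum u_i\otimes u_i' : \sum u_it_L(a)\otimes u'_i=\sum u_i\otimes u_i's_L(a)\ \forall a\in A\}$ (an algebra under factorwise multiplication), $\Delta_L:U\to U\times_{A_L}U$ is a unital algebra morphism, and $\epsilon_L(us_L(\epsilon_L(u')))=\epsilon_L(uu')=\epsilon_L(ut_L(\epsilon_L(u')))$. Hopf algebroid $\mathcal U=(U,A_L,s_L,t_L,\Delta_L,\epsilon_L,S)$: a left bialgebroid with an involutive ($S^2=\mathrm{id}$) anti-automorphism $S$ of the $k$-algebra $U$ with $S\circ t_L=s_L$ and, in $U\otimes_{A_L}U$ for all $u\in U$, $S(u_{(1)})_{(1)}u_{(2)}\otimes S(u_{(1)})_{(2)}=1_U\otimes S(u)$ and $S(u_{(2)})_{(1)}\otimes S(u_{(2)})_{(2)}u_{(1)}=S(u)\otimes 1_U$.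 Measuring of algebras: for $k$-algebras $R,R'$ and a $k$-coalgebra $C$ with counit $\epsilon_C$, a linear map $\psi:C\to Vect_k(R,R')$ with $\psi(x)(ab)=\psi(x_{(1)})(a)\psi(x_{(2)})(b)$ and $\psi(x)(1_R)=\epsilon_C(x)1_{R'}$. One writes $x(a)$ for $\psi(x)(a)$. Measuring of Hopf algebroids from $\mathcal U$ to $\mathcal U'$ by a cocommutative $k$-coalgebra $C$: a pair of algebra measurings $\Psi:C\to Vect_k(U,U')$, $\psi:C\to Vect_k(A_L,A'_L)$ such that for all $x\in C$: $\Psi(x)s_L=s_L'\psi(x)$, $\Psi(x)t_L=t'_L\psi(x)$, $\Psi(x)S=S'\Psi(x)$, $\psi(x)\epsilon_L=\epsilon_L'\Psi(x)$, and $\Delta'_L(\Psi(x)(u))=\Psi(x_{(1)})(u_{(1)})\otimes\Psi(x_{(2)})(u_{(2)})$ in $U'\otimes_{A'_L}U'$ for all $u\in U$. The map $(\Psi,\psi)$ takes values in $V(\mathcal U,\mathcal U'):=\{(F,f)\in Vect_k(U,U')\times Vect_k(A_L,A_L'): Fs_L=s_L'f,\ Ft_L=t_L'f,\ FS=S'F,\ f\epsilon_L=\epsilon_L'F\}$. Cocyclic module $C^\bullet(\mathcal U)$: $C^n(\mathcal U)=U\otimes_{A_L}\cdots\otimes_{A_L}U$ ($n$ factors, bimodule structure $a\cdot u\cdot b=s_L(a)t_L(b)u$), $C^0(\mathcal U)=A_L$. Cofaces for $n\ge1$: $\delta_0(u^1\otimes\dots\otimes u^n)=1\otimes u^1\otimes\dots\otimes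 u^n$; $\delta_i(u^1\otimes\dots\otimes u^n)=u^1\otimes\dots\otimes\Delta_Lu^i\otimes\dots\otimes u^n$ for $1\le i\le n$; $\delta_{n+1}(u^1\otimes\dots\otimes u^n)=u^1\otimes\dots\otimes u^n\otimes1$; for $n=0$, $\delta_0=t_L$, $\delta_1=s_L$. Codegeneracies: $\sigma_i(u^1\otimes\dots\otimes u^n)=u^1\otimes\dots\otimes\epsilon_L(u^{i+1})\cdot u^{i+2}\otimes\dots\otimes u^n$, $0\le i\le n-1$ (for $i=n-1\geq 1$ the element $\epsilon_L(u^n)$ acts on $u^{n-1}$ from the right; for $n=1$, $\sigma_0=\epsilon_L$). Cocyclic operator: $\tau_n(u^1\otimes\dots\otimes u^n)=S(u^1)_{(1)}u^2\otimes\dots\otimes S(u^1)_{(n-1)}u^n\otimes S(u^1)_{(n)}$, $\tau_0=\mathrm{id}$. $HH^\bullet(\mathcal U)$ and $HC^\bullet(\mathcal U)$ are the Hochschild and cyclic cohomologies of this cocyclic module. In degree $0$, $\overline\Psi^0(x)=\psi(x):A_L\to A_L'$. *)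

theory Defs
  imports Complex_Main "HOL-Algebra.Module" "HOL-Algebra.AbelCoset" "HOL-Library.Poly_Mapping"
begin

section \<open>Vector spaces with explicit carriers\<close>

text \<open>
  The algebras and coalgebras are types with an explicit scalar multiplication. Tensor powers and
  cohomology are quotients, hence records of type \<^typ>\<open>('k, 'm) module\<close>; their fields
  \<open>mult\<close> and \<open>one\<close> are never used.
\<close>

definition vector_module :: "('k \<Rightarrow> 'v \<Rightarrow> 'v) \<Rightarrow> ('k, 'v::ab_group_add) module" where
  "vector_module sc = \<lparr>carrier = UNIV, mult = undefined, one = undefined,
     zero = 0, add = (+), smult = sc\<rparr>"

definition image_module :: "('m \<Rightarrow> 'n) \<Rightarrow> ('n \<Rightarrow> 'm) \<Rightarrow> ('k, 'm) module \<Rightarrow> ('k, 'n) module" where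
  "image_module e r M = \<lparr>carrier = e ` carrier M, mult = undefined, one = undefined,
     zero = e \<zero>\<^bsub>M\<^esub>, add = (\<lambda>x y. e (r x \<oplus>\<^bsub>M\<^esub> r y)), smult = (\<lambda>c x. e (c \<odot>\<^bsub>M\<^esub> r x))\<rparr>"

definition quotient_module :: "('k, 'm) module \<Rightarrow> 'm set \<Rightarrow> ('k, 'm set) module" where
  "quotient_module M N = \<lparr>carrier = a_rcosets\<^bsub>M\<^esub> N, mult = undefined, one = undefined,
     zero = N, add = (\<lambda>X Y. X <+>\<^bsub>M\<^esub> Y), smult = (\<lambda>c X. \<Union>x\<in>X. N +>\<^bsub>M\<^esub> (c \<odot>\<^bsub>M\<^esub> x))\<rparr>"

definition linear_on :: "('k, 'm) module \<Rightarrow> ('k, 'n) module \<Rightarrow> ('m \<Rightarrow> 'n) \<Rightarrow> bool" where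
  "linear_on M N f \<longleftrightarrow> f \<in> carrier M \<rightarrow> carrier N \<and>
     (\<forall>x\<in>carrier M. \<forall>y\<in>carrier M. f (x \<oplus>\<^bsub>M\<^esub> y) = f x \<oplus>\<^bsub>N\<^esub> f y) \<and>
     (\<forall>c. \<forall>x\<in>carrier M. f (c \<odot>\<^bsub>M\<^esub> x) = c \<odot>\<^bsub>N\<^esub> f x)"


section \<open>Tensor powers over a noncommutative base\<close>

definition free_scale :: "'k::field \<Rightarrow> ('g \<Rightarrow>\<^sub>0 'k) \<Rightarrow> ('g \<Rightarrow>\<^sub>0 'k)" where
  "free_scale c p = Poly_Mapping.map ((*) c) p"

definition free_module :: "'g set \<Rightarrow> ('k::field, 'g \<Rightarrow>\<^sub>0 'k) module" where
  "free_module G = \<lparr>carrier = {p. Poly_Mapping.keys p \<subseteq> G}, mult = undefined, one = undefined,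
     zero = 0, add = (+), smult = free_scale\<rparr>"

abbreviation word :: "'v list \<Rightarrow> ('v list \<Rightarrow>\<^sub>0 'k::field)" where
  "word us \<equiv> Poly_Mapping.single us 1"

text \<open>
  \<open>lact b v\<close> is \<open>b \<cdot> v\<close> and \<open>ract b v\<close> is \<open>v \<cdot> b\<close>, for \<open>b\<close> in the base ring.
\<close>

record ('k, 'b, 'v) bimodule =
  bscale :: "'k \<Rightarrow> 'v \<Rightarrow> 'v"
  lact :: "'b \<Rightarrow> 'v \<Rightarrow> 'v"
  ract :: "'b \<Rightarrow> 'v \<Rightarrow> 'v"

definition tensor_relators ::
  "('k::field, 'b, 'v::ab_group_add) bimodule \<Rightarrow> nat \<Rightarrow> ('v list \<Rightarrow>\<^sub>0 'k) set" where
  "tensor_relators B n =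
     {word (xs @ [x + y] @ ys) - word (xs @ [x] @ ys) - word (xs @ [y] @ ys) | xs x y ys.
        length xs + length ys + 1 = n} \<union>
     {word (xs @ [bscale B c x] @ ys) - free_scale c (word (xs @ [x] @ ys)) | xs c x ys.
        length xs + length ys + 1 = n} \<union>
     {word (xs @ [ract B b x, y] @ ys) - word (xs @ [x, lact B b y] @ ys) | xs b x y ys.
        length xs + length ys + 2 = n}"

definition tensor_null ::
  "('k::field, 'b, 'v::ab_group_add) bimodule \<Rightarrow> nat \<Rightarrow> ('v list \<Rightarrow>\<^sub>0 'k) set" where
  "tensor_null B n = module.span free_scale (tensor_relators B n)"

text \<open>
  The \<open>n\<close>-fold tensor product over the base ring; it is only used for \<open>n \<ge> 1\<close>. For \<open>n = 1\<close> it is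
  the underlying space itself, \<open>u\<close> being identified with \<open>pure_tensor B [u]\<close>.
\<close>

definition tensor_power ::
  "('k::field, 'b, 'v::ab_group_add) bimodule \<Rightarrow> nat \<Rightarrow> ('k, ('v list \<Rightarrow>\<^sub>0 'k) set) module" where
  "tensor_power B n = quotient_module (free_module {us. length us = n}) (tensor_null B n)"

definition pure_tensor ::
  "('k::field, 'b, 'v::ab_group_add) bimodule \<Rightarrow> 'v list \<Rightarrow> ('v list \<Rightarrow>\<^sub>0 'k) set" where
  "pure_tensor B us =
     tensor_null B (length us) +>\<^bsub>free_module {vs. length vs = length us}\<^esub> word us"

text \<open>
  Sweedler notation: \<open>sweedler M f X\<close> is \<open>\<Sum> f [v\<^sub>1, \<dots>, v\<^sub>n]\<close> in \<open>M\<close>, where the tensor \<open>X\<close> is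
  written as \<open>\<Sum> v\<^sub>1 \<otimes> \<dots> \<otimes> v\<^sub>n\<close>. The formula depends on the chosen representative of \<open>X\<close> unless
  \<open>f\<close> is multilinear and balanced over the base ring; in that case it is the linear map on the
  tensor power induced by \<open>f\<close>. When \<open>f\<close> involves a second Sweedler sum, the order of nesting
  below is the one for which the inner sum is independent of the representative for each fixed
  value of the outer variables.
\<close>

definition sweedler :: "('k::field, 'm) module \<Rightarrow> ('g \<Rightarrow> 'm) \<Rightarrow> ('g \<Rightarrow>\<^sub>0 'k) set \<Rightarrow> 'm" where
  "sweedler M f X =
     (let p = (SOME p. p \<in> X) in \<Oplus>\<^bsub>M\<^esub>us\<in>Poly_Mapping.keys p. (Poly_Mapping.lookup p us \<odot>\<^bsub>M\<^esub> f us))"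

text \<open>\<open>v\<^sub>0 \<otimes> \<dots> \<otimes> D v\<^sub>i \<otimes> \<dots> \<otimes> v\<^sub>n\<^sub>-\<^sub>1\<close> (positions counted from 0)\<close>

definition comult_at ::
  "('k::field, 'b, 'v::ab_group_add) bimodule \<Rightarrow> ('v \<Rightarrow> ('v list \<Rightarrow>\<^sub>0 'k) set) \<Rightarrow>
     nat \<Rightarrow> 'v list \<Rightarrow> ('v list \<Rightarrow>\<^sub>0 'k) set" where
  "comult_at B D i us = sweedler (tensor_power B (Suc (length us)))
     (\<lambda>vs. pure_tensor B (take i us @ vs @ drop (Suc i) us)) (D (us ! i))"

text \<open>\<open>iter_comult B D n v\<close> is \<open>v\<^sub>(\<^sub>1\<^sub>) \<otimes> \<dots> \<otimes> v\<^sub>(\<^sub>n\<^sub>+\<^sub>1\<^sub>)\<close>, a tensor with \<open>n + 1\<close> factors.\<close>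

primrec iter_comult ::
  "('k::field, 'b, 'v::ab_group_add) bimodule \<Rightarrow> ('v \<Rightarrow> ('v list \<Rightarrow>\<^sub>0 'k) set) \<Rightarrow>
     nat \<Rightarrow> 'v \<Rightarrow> ('v list \<Rightarrow>\<^sub>0 'k) set" where
  "iter_comult B D 0 v = pure_tensor B [v]"
| "iter_comult B D (Suc n) v =
     sweedler (tensor_power B (n + 2)) (comult_at B D 0) (iter_comult B D n v)"

definition coassociative ::
  "('k::field, 'b, 'v::ab_group_add) bimodule \<Rightarrow> ('v \<Rightarrow> ('v list \<Rightarrow>\<^sub>0 'k) set) \<Rightarrow> bool" where
  "coassociative B D \<longleftrightarrow> (\<forall>v. sweedler (tensor_power B 3) (comult_at B D 0) (D v) =
                             sweedler (tensor_power B 3) (comult_at B D 1) (D v))"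


section \<open>Algebras and coalgebras over a field\<close>

text \<open>The zero algebra is not excluded, hence the sort \<open>{ring, monoid_mult}\<close>.\<close>

locale k_algebra = vector_space scale
  for scale :: "'k::field \<Rightarrow> 'r::{ring, monoid_mult} \<Rightarrow> 'r" +
  assumes scale_mult_left: "scale c x * y = scale c (x * y)"
    and scale_mult_right: "x * scale c y = scale c (x * y)"

record (overloaded) ('k, 'c) coalgebra_data =
  cscale :: "'k \<Rightarrow> 'c \<Rightarrow> 'c"
  ccomult :: "'c \<Rightarrow> ('c list \<Rightarrow>\<^sub>0 'k) set"
  ccounit :: "'c \<Rightarrow> 'k"

text \<open>A space regarded as a bimodule over the ground field.\<close>

definition cbimodule :: "('k, 'c) coalgebra_data \<Rightarrow> ('k, 'k, 'c) bimodule" where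
  "cbimodule C = \<lparr>bscale = cscale C, lact = cscale C, ract = cscale C\<rparr>"

locale coalgebra =
  fixes C :: "('k::field, 'c::ab_group_add) coalgebra_data"
  assumes vector_space: "vector_space (cscale C)"
    and comult_linear:
      "linear_on (vector_module (cscale C)) (tensor_power (cbimodule C) 2) (ccomult C)"
    and counit_linear: "Vector_Spaces.linear (cscale C) (*) (ccounit C)"
    and coassoc: "coassociative (cbimodule C) (ccomult C)"
    and counit_left: "sweedler (vector_module (cscale C))
          (\<lambda>xs. cscale C (ccounit C (xs ! 0)) (xs ! 1)) (ccomult C x) = x"
    and counit_right: "sweedler (vector_module (cscale C))
          (\<lambda>xs. cscale C (ccounit C (xs ! 1)) (xs ! 0)) (ccomult C x) = x"

locale cocommutative_coalgebra = coalgebra +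
  assumes cocommutative:
    "sweedler (tensor_power (cbimodule C) 2)
       (\<lambda>xs. pure_tensor (cbimodule C) [xs ! 1, xs ! 0]) (ccomult C x) = ccomult C x"


section \<open>Hopf algebroids\<close>

record (overloaded) ('k, 'u, 'a) bialgebroid_data =
  uscale :: "'k \<Rightarrow> 'u \<Rightarrow> 'u"
  ascale :: "'k \<Rightarrow> 'a \<Rightarrow> 'a"
  src :: "'a \<Rightarrow> 'u"
  tgt :: "'a \<Rightarrow> 'u"
  comult :: "'u \<Rightarrow> ('u list \<Rightarrow>\<^sub>0 'k) set"
  counit :: "'u \<Rightarrow> 'a"

record (overloaded) ('k, 'u, 'a) hopf_data = "('k, 'u, 'a) bialgebroid_data" +
  antipode :: "'u \<Rightarrow> 'u"

definition ubimodule ::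
  "('k, 'u::{ring, monoid_mult}, 'a, 'z) bialgebroid_data_scheme \<Rightarrow> ('k, 'a, 'u) bimodule" where
  "ubimodule H =
     \<lparr>bscale = uscale H, lact = (\<lambda>a u. src H a * u), ract = (\<lambda>a u. tgt H a * u)\<rparr>"

abbreviation utensor ::
  "('k::field, 'u::{ring, monoid_mult}, 'a, 'z) bialgebroid_data_scheme \<Rightarrow> nat \<Rightarrow>
     ('k, ('u list \<Rightarrow>\<^sub>0 'k) set) module" where
  "utensor H n \<equiv> tensor_power (ubimodule H) n"

abbreviation upure ::
  "('k::field, 'u::{ring, monoid_mult}, 'a, 'z) bialgebroid_data_scheme \<Rightarrow> 'u list \<Rightarrow>
     ('u list \<Rightarrow>\<^sub>0 'k) set" where
  "upure H us \<equiv> pure_tensor (ubimodule H) us"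

locale left_bialgebroid =
  fixes H :: "('k::field, 'u::{ring, monoid_mult}, 'a::{ring, monoid_mult}, 'z)
                bialgebroid_data_scheme"
  assumes algebra_U: "k_algebra (uscale H)"
    and algebra_A: "k_algebra (ascale H)"
    and src_linear: "Vector_Spaces.linear (ascale H) (uscale H) (src H)"
    and src_mult: "src H (a * b) = src H a * src H b"
    and src_one: "src H 1 = 1"
    and tgt_linear: "Vector_Spaces.linear (ascale H) (uscale H) (tgt H)"
    and tgt_mult: "tgt H (a * b) = tgt H b * tgt H a"
    and tgt_one: "tgt H 1 = 1"
    and src_tgt_commute: "src H a * tgt H b = tgt H b * src H a"
    \<comment> \<open>\<open>comult\<close> and \<open>counit\<close> are morphisms of bimodules over the base algebra\<close>
    and comult_linear: "linear_on (vector_module (uscale H)) (utensor H 2) (comult H)"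
    and comult_bimodule: "comult H (src H a * tgt H b * u) =
          sweedler (utensor H 2) (\<lambda>us. upure H [src H a * us ! 0, tgt H b * us ! 1]) (comult H u)"
    and counit_linear: "Vector_Spaces.linear (uscale H) (ascale H) (counit H)"
    and counit_bimodule: "counit H (src H a * tgt H b * u) = a * counit H u * b"
    \<comment> \<open>coalgebra axioms\<close>
    and coassoc: "coassociative (ubimodule H) (comult H)"
    and counit_left: "sweedler (vector_module (uscale H))
          (\<lambda>us. src H (counit H (us ! 0)) * us ! 1) (comult H u) = u"
    and counit_right: "sweedler (vector_module (uscale H))
          (\<lambda>us. tgt H (counit H (us ! 1)) * us ! 0) (comult H u) = u"
    \<comment> \<open>\<open>comult\<close> takes values in the Takeuchi product and is a unital algebra morphism\<close>
    and takeuchi: "sweedler (utensor H 2) (\<lambda>us. upure H [us ! 0 * tgt H a, us ! 1]) (comult H u) =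
                   sweedler (utensor H 2) (\<lambda>us. upure H [us ! 0, us ! 1 * src H a]) (comult H u)"
    and comult_mult: "comult H (u * v) = sweedler (utensor H 2)
          (\<lambda>vs. sweedler (utensor H 2)
             (\<lambda>us. upure H [us ! 0 * vs ! 0, us ! 1 * vs ! 1]) (comult H u)) (comult H v)"
    and comult_one: "comult H 1 = upure H [1, 1]"
    and counit_src: "counit H (u * src H (counit H v)) = counit H (u * v)"
    and counit_tgt: "counit H (u * tgt H (counit H v)) = counit H (u * v)"

locale hopf_algebroid = left_bialgebroid H
  for H :: "('k::field, 'u::{ring, monoid_mult}, 'a::{ring, monoid_mult}) hopf_data" +
  assumes antipode_linear: "Vector_Spaces.linear (uscale H) (uscale H) (antipode H)"
    and antipode_mult: "antipode H (u * v) = antipode H v * antipode H u"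
    and antipode_one: "antipode H 1 = 1"
    and antipode_involutive: "antipode H (antipode H u) = u"
    and antipode_tgt: "antipode H (tgt H a) = src H a"
    and antipode_left: "sweedler (utensor H 2)
          (\<lambda>us. sweedler (utensor H 2) (\<lambda>vs. upure H [vs ! 0 * us ! 1, vs ! 1])
             (comult H (antipode H (us ! 0)))) (comult H u) = upure H [1, antipode H u]"
    and antipode_right: "sweedler (utensor H 2)
          (\<lambda>us. sweedler (utensor H 2) (\<lambda>vs. upure H [vs ! 0, vs ! 1 * us ! 0])
             (comult H (antipode H (us ! 1)))) (comult H u) = upure H [antipode H u, 1]"


section \<open>Measurings\<close>

definition algebra_measuring ::
  "('k::field, 'c::ab_group_add) coalgebra_data \<Rightarrow>
   ('k \<Rightarrow> 'r::{ring, monoid_mult} \<Rightarrow> 'r) \<Rightarrow> ('k \<Rightarrow> 's::{ring, monoid_mult} \<Rightarrow> 's) \<Rightarrow>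
   ('c \<Rightarrow> 'r \<Rightarrow> 's) \<Rightarrow> bool" where
  "algebra_measuring C sR sS \<psi> \<longleftrightarrow>
     (\<forall>x. Vector_Spaces.linear sR sS (\<psi> x)) \<and>
     (\<forall>a. Vector_Spaces.linear (cscale C) sS (\<lambda>x. \<psi> x a)) \<and>
     (\<forall>x a b. \<psi> x (a * b) =
        sweedler (vector_module sS) (\<lambda>xs. \<psi> (xs ! 0) a * \<psi> (xs ! 1) b) (ccomult C x)) \<and>
     (\<forall>x. \<psi> x 1 = sS (ccounit C x) 1)"

definition hopf_measuring ::
  "('k::field, 'c::ab_group_add) coalgebra_data \<Rightarrow>
   ('k, 'u::{ring, monoid_mult}, 'a::{ring, monoid_mult}) hopf_data \<Rightarrow>
   ('k, 'v::{ring, monoid_mult}, 'b::{ring, monoid_mult}) hopf_data \<Rightarrow>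
   ('c \<Rightarrow> 'u \<Rightarrow> 'v) \<Rightarrow> ('c \<Rightarrow> 'a \<Rightarrow> 'b) \<Rightarrow> bool" where
  "hopf_measuring C H H' \<Psi> \<psi> \<longleftrightarrow>
     algebra_measuring C (uscale H) (uscale H') \<Psi> \<and>
     algebra_measuring C (ascale H) (ascale H') \<psi> \<and>
     (\<forall>x a. \<Psi> x (src H a) = src H' (\<psi> x a)) \<and>
     (\<forall>x a. \<Psi> x (tgt H a) = tgt H' (\<psi> x a)) \<and>
     (\<forall>x u. \<Psi> x (antipode H u) = antipode H' (\<Psi> x u)) \<and>
     (\<forall>x u. \<psi> x (counit H u) = counit H' (\<Psi> x u)) \<and>
     (\<forall>x u. comult H' (\<Psi> x u) = sweedler (utensor H' 2)
        (\<lambda>us. sweedler (utensor H' 2)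
           (\<lambda>xs. upure H' [\<Psi> (xs ! 0) (us ! 0), \<Psi> (xs ! 1) (us ! 1)]) (ccomult C x))
        (comult H u))"


section \<open>Cocyclic modules and their cohomology\<close>

text \<open>
  For an object \<open>X\<close> with \<open>X\<^sup>n = obj X n\<close>, the operators \<open>coface X n i : X\<^sup>n \<rightarrow> X\<^sup>n\<^sup>+\<^sup>1\<close> are used for
  \<open>i \<le> n + 1\<close>, \<open>codegeneracy X n i : X\<^sup>n \<rightarrow> X\<^sup>n\<^sup>-\<^sup>1\<close> for \<open>i < n\<close>, and \<open>cyclic X n : X\<^sup>n \<rightarrow> X\<^sup>n\<close>.
  A morphism is a degreewise linear family commuting with all of these operators; the cocyclic
  identities concern the objects and are not part of its definition.
\<close>

record ('k, 'm) cocyclic =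
  obj :: "nat \<Rightarrow> ('k, 'm) module"
  coface :: "nat \<Rightarrow> nat \<Rightarrow> 'm \<Rightarrow> 'm"
  codegeneracy :: "nat \<Rightarrow> nat \<Rightarrow> 'm \<Rightarrow> 'm"
  cyclic :: "nat \<Rightarrow> 'm \<Rightarrow> 'm"

definition cocyclic_morphism ::
  "('k, 'm) cocyclic \<Rightarrow> ('k, 'n) cocyclic \<Rightarrow> (nat \<Rightarrow> 'm \<Rightarrow> 'n) \<Rightarrow> bool" where
  "cocyclic_morphism X Y f \<longleftrightarrow>
     (\<forall>n. linear_on (obj X n) (obj Y n) (f n)) \<and>
     (\<forall>n. \<forall>i\<le>Suc n. \<forall>z\<in>carrier (obj X n).
        f (Suc n) (coface X n i z) = coface Y n i (f n z)) \<and>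
     (\<forall>n. \<forall>i<n. \<forall>z\<in>carrier (obj X n).
        f (n - 1) (codegeneracy X n i z) = codegeneracy Y n i (f n z)) \<and>
     (\<forall>n. \<forall>z\<in>carrier (obj X n). f n (cyclic X n z) = cyclic Y n (f n z))"

definition cocycles ::
  "(nat \<Rightarrow> ('k, 'm) module) \<Rightarrow> (nat \<Rightarrow> 'm \<Rightarrow> 'm) \<Rightarrow> nat \<Rightarrow> 'm set" where
  "cocycles M d n = {z \<in> carrier (M n). d n z = \<zero>\<^bsub>M (Suc n)\<^esub>}"

definition coboundaries ::
  "(nat \<Rightarrow> ('k, 'm) module) \<Rightarrow> (nat \<Rightarrow> 'm \<Rightarrow> 'm) \<Rightarrow> nat \<Rightarrow> 'm set" where
  "coboundaries M d n = (if n = 0 then {\<zero>\<^bsub>M 0\<^esub>} else d (n - 1) ` carrier (M (n - 1)))"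

definition cohomology ::
  "(nat \<Rightarrow> ('k, 'm) module) \<Rightarrow> (nat \<Rightarrow> 'm \<Rightarrow> 'm) \<Rightarrow> nat \<Rightarrow> ('k, 'm set) module" where
  "cohomology M d n = quotient_module (M n\<lparr>carrier := cocycles M d n\<rparr>) (coboundaries M d n)"

definition cohomology_class ::
  "(nat \<Rightarrow> ('k, 'm) module) \<Rightarrow> (nat \<Rightarrow> 'm \<Rightarrow> 'm) \<Rightarrow> nat \<Rightarrow> 'm \<Rightarrow> 'm set" where
  "cohomology_class M d n z = coboundaries M d n +>\<^bsub>M n\<^esub> z"

definition alternating_sum :: "('k::field, 'm) cocyclic \<Rightarrow> nat \<Rightarrow> nat \<Rightarrow> 'm \<Rightarrow> 'm" where
  "alternating_sum X n k z =
     (\<Oplus>\<^bsub>obj X (Suc n)\<^esub>i\<in>{..k}. ((-1) ^ i \<odot>\<^bsub>obj X (Suc n)\<^esub> coface X n i z))"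

definition hochschild_b :: "('k::field, 'm) cocyclic \<Rightarrow> nat \<Rightarrow> 'm \<Rightarrow> 'm" where
  "hochschild_b X n = alternating_sum X n (Suc n)"

definition hochschild_b' :: "('k::field, 'm) cocyclic \<Rightarrow> nat \<Rightarrow> 'm \<Rightarrow> 'm" where
  "hochschild_b' X n = alternating_sum X n n"

definition signed_cyclic :: "('k::field, 'm) cocyclic \<Rightarrow> nat \<Rightarrow> 'm \<Rightarrow> 'm" where
  "signed_cyclic X n z = (-1) ^ n \<odot>\<^bsub>obj X n\<^esub> cyclic X n z"

definition cyclic_norm :: "('k::field, 'm) cocyclic \<Rightarrow> nat \<Rightarrow> 'm \<Rightarrow> 'm" where
  "cyclic_norm X n z = (\<Oplus>\<^bsub>obj X n\<^esub>j\<in>{..n}. ((signed_cyclic X n ^^ j) z))"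

text \<open>
  Cyclic cohomology over a field of arbitrary characteristic: the total complex of the first
  quadrant bicomplex whose column \<open>p\<close> is \<open>(X\<^sup>\<bullet>, b)\<close> for even \<open>p\<close> and \<open>(X\<^sup>\<bullet>, -b')\<close> for odd \<open>p\<close>, with
  horizontal maps \<open>1 - \<lambda>\<close> out of the even and \<open>N\<close> out of the odd columns. The component \<open>f p\<close> of a
  total cochain \<open>f\<close> of degree \<open>n\<close> lies in column \<open>p\<close>, that is, in \<open>X\<^sup>n\<^sup>-\<^sup>p\<close>.
\<close>

definition total_module :: "('k::field, 'm) cocyclic \<Rightarrow> nat \<Rightarrow> ('k, nat \<Rightarrow> 'm) module" where
  "total_module X n = \<lparr>carrier = (\<Pi>\<^sub>E p\<in>{..n}. carrier (obj X (n - p))),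
     mult = undefined, one = undefined,
     zero = (\<lambda>p\<in>{..n}. \<zero>\<^bsub>obj X (n - p)\<^esub>),
     add = (\<lambda>f g. \<lambda>p\<in>{..n}. f p \<oplus>\<^bsub>obj X (n - p)\<^esub> g p),
     smult = (\<lambda>c f. \<lambda>p\<in>{..n}. c \<odot>\<^bsub>obj X (n - p)\<^esub> f p)\<rparr>"

definition total_vertical ::
  "('k::field, 'm) cocyclic \<Rightarrow> nat \<Rightarrow> (nat \<Rightarrow> 'm) \<Rightarrow> nat \<Rightarrow> 'm" where
  "total_vertical X n f p =
     (if p = Suc n then \<zero>\<^bsub>obj X 0\<^esub>
      else if even p then hochschild_b X (n - p) (f p)
      else \<ominus>\<^bsub>obj X (Suc n - p)\<^esub> hochschild_b' X (n - p) (f p))"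

definition total_horizontal ::
  "('k::field, 'm) cocyclic \<Rightarrow> nat \<Rightarrow> (nat \<Rightarrow> 'm) \<Rightarrow> nat \<Rightarrow> 'm" where
  "total_horizontal X n f p =
     (if p = 0 then \<zero>\<^bsub>obj X (Suc n)\<^esub>
      else if odd p
      then f (p - 1) \<ominus>\<^bsub>obj X (Suc n - p)\<^esub> signed_cyclic X (Suc n - p) (f (p - 1))
      else cyclic_norm X (Suc n - p) (f (p - 1)))"

definition total_differential ::
  "('k::field, 'm) cocyclic \<Rightarrow> nat \<Rightarrow> (nat \<Rightarrow> 'm) \<Rightarrow> (nat \<Rightarrow> 'm)" where
  "total_differential X n f = (\<lambda>p\<in>{..Suc n}.
     total_vertical X n f p \<oplus>\<^bsub>obj X (Suc n - p)\<^esub> total_horizontal X n f p)"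

abbreviation HH :: "('k::field, 'm) cocyclic \<Rightarrow> nat \<Rightarrow> ('k, 'm set) module" where
  "HH X \<equiv> cohomology (obj X) (hochschild_b X)"

abbreviation HC :: "('k::field, 'm) cocyclic \<Rightarrow> nat \<Rightarrow> ('k, (nat \<Rightarrow> 'm) set) module" where
  "HC X \<equiv> cohomology (total_module X) (total_differential X)"

definition total_map :: "(nat \<Rightarrow> 'm \<Rightarrow> 'n) \<Rightarrow> nat \<Rightarrow> (nat \<Rightarrow> 'm) \<Rightarrow> (nat \<Rightarrow> 'n)" where
  "total_map F n f = (\<lambda>p\<in>{..n}. F (n - p) (f p))"


section \<open>The cocyclic module of a Hopf algebroid\<close>

text \<open>
  Degree 0 is the base algebra, tagged by \<^const>\<open>Inl\<close>; degree \<open>n \<ge> 1\<close> is the \<open>n\<close>-fold tensor power,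
  tagged by \<^const>\<open>Inr\<close>.
\<close>

type_synonym ('k, 'u, 'a) cochain = "'a + ('u list \<Rightarrow>\<^sub>0 'k) set"

definition hopf_obj ::
  "('k::field, 'u::{ring, monoid_mult}, 'a::{ring, monoid_mult}) hopf_data \<Rightarrow> nat \<Rightarrow>
     ('k, ('k, 'u, 'a) cochain) module" where
  "hopf_obj H n = (if n = 0 then image_module Inl projl (vector_module (ascale H))
                   else image_module Inr projr (utensor H n))"

definition hopf_coface ::
  "('k::field, 'u::{ring, monoid_mult}, 'a::{ring, monoid_mult}) hopf_data \<Rightarrow> nat \<Rightarrow> nat \<Rightarrow>
     ('k, 'u, 'a) cochain \<Rightarrow> ('k, 'u, 'a) cochain" where
  "hopf_coface H n i z = (case z of
     Inl a \<Rightarrow> Inr (upure H [if i = 0 then tgt H a else src H a])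
   | Inr X \<Rightarrow> Inr (sweedler (utensor H (Suc n))
       (\<lambda>us. if i = 0 then upure H (1 # us)
             else if i = Suc n then upure H (us @ [1])
             else comult_at (ubimodule H) (comult H) (i - 1) us) X))"

definition hopf_codegeneracy ::
  "('k::field, 'u::{ring, monoid_mult}, 'a::{ring, monoid_mult}) hopf_data \<Rightarrow> nat \<Rightarrow> nat \<Rightarrow>
     ('k, 'u, 'a) cochain \<Rightarrow> ('k, 'u, 'a) cochain" where
  "hopf_codegeneracy H n i z = (case z of
     Inl a \<Rightarrow> undefined
   | Inr X \<Rightarrow>
       if n = 1 then Inl (sweedler (vector_module (ascale H)) (\<lambda>us. counit H (us ! 0)) X)
       else Inr (sweedler (utensor H (n - 1))
         (\<lambda>us. if i < n - 1
               then upure H (take i us @ [src H (counit H (us ! i)) * us ! (i + 1)] @ drop (i + 2) us)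
               else upure H (take (n - 2) us @ [tgt H (counit H (us ! (n - 1))) * us ! (n - 2)])) X))"

definition hopf_cyclic ::
  "('k::field, 'u::{ring, monoid_mult}, 'a::{ring, monoid_mult}) hopf_data \<Rightarrow> nat \<Rightarrow>
     ('k, 'u, 'a) cochain \<Rightarrow> ('k, 'u, 'a) cochain" where
  "hopf_cyclic H n z = (case z of
     Inl a \<Rightarrow> Inl a
   | Inr X \<Rightarrow> Inr (sweedler (utensor H n)
       (\<lambda>us. sweedler (utensor H n) (\<lambda>vs. upure H (map2 (*) vs (tl us @ [1])))
          (iter_comult (ubimodule H) (comult H) (n - 1) (antipode H (hd us)))) X))"

definition hopf_cocyclic ::
  "('k::field, 'u::{ring, monoid_mult}, 'a::{ring, monoid_mult}) hopf_data \<Rightarrow>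
     ('k, ('k, 'u, 'a) cochain) cocyclic" where
  "hopf_cocyclic H = \<lparr>obj = hopf_obj H, coface = hopf_coface H,
     codegeneracy = hopf_codegeneracy H, cyclic = hopf_cyclic H\<rparr>"

text \<open>\<open>x\<^sub>(\<^sub>1\<^sub>)(u\<^sup>1) \<otimes> \<dots> \<otimes> x\<^sub>(\<^sub>n\<^sub>)(u\<^sup>n)\<close> for a list \<open>us\<close> of length \<open>n \<ge> 1\<close>\<close>

definition measured_tensor ::
  "('k::field, 'c::ab_group_add) coalgebra_data \<Rightarrow>
   ('k, 'v::{ring, monoid_mult}, 'b::{ring, monoid_mult}) hopf_data \<Rightarrow>
   ('c \<Rightarrow> 'u \<Rightarrow> 'v) \<Rightarrow> 'c \<Rightarrow> 'u list \<Rightarrow> ('v list \<Rightarrow>\<^sub>0 'k) set" where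
  "measured_tensor C H' \<Psi> x us =
     sweedler (utensor H' (length us)) (\<lambda>xs. upure H' (map2 \<Psi> xs us))
       (iter_comult (cbimodule C) (ccomult C) (length us - 1) x)"

definition measuring_map ::
  "('k::field, 'c::ab_group_add) coalgebra_data \<Rightarrow>
   ('k, 'v::{ring, monoid_mult}, 'b::{ring, monoid_mult}) hopf_data \<Rightarrow>
   ('c \<Rightarrow> 'u \<Rightarrow> 'v) \<Rightarrow> ('c \<Rightarrow> 'a \<Rightarrow> 'b) \<Rightarrow> 'c \<Rightarrow> nat \<Rightarrow>
   ('k, 'u, 'a) cochain \<Rightarrow> ('k, 'v, 'b) cochain" where
  "measuring_map C H' \<Psi> \<psi> x n z = (case z of
     Inl a \<Rightarrow> Inl (\<psi> x a)
   | Inr X \<Rightarrow> Inr (sweedler (utensor H' n) (measured_tensor C H' \<Psi> x) X))"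

end

(* A k-linear functional on an n-fold tensor power over a noncommutative base is a function of lists
   that is multilinear and balanced over the base ring, and over a field such functionals separate
   points. Every identity between Sweedler sums is therefore tested on k-valued balanced functions,
   where nested sums are sums of scalars and may be interchanged freely. Against a balanced G,
   x_(1)(u_1) (x) ... (x) x_(n)(u_n) satisfies a recursion that splits one comultiplication off x, so
   compatibility with each cocyclic operator is an induction on the list of the u_i, using coassociativity
   and cocommutativity of C and the measuring identities in a single position. That the operators and
   the map descend to the tensor powers follows from the Takeuchi condition and from cocommutativity.
   A linear family commuting with all operators commutes with b, b', lambda and N, hence with the
   Hochschild and total differentials. *)

theory Submission
  imports Defs
begin

section \<open>Vector spaces with explicit carriers and their quotients\<close>

text \<open>Each operator has a transpose on functions of lists (\<open>expand\<close>,
  \<open>contract\<close>, \<open>contract_last\<close>, \<open>rotate\<close>). That the transpose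
  preserves balance is what makes the operator well defined. The main obstacle is that tensors over
  the base algebra cannot be multiplied factor by factor, while the cyclic operator does just that:
  for a fixed list of left factors, the product is only multilinear in the right ones. Products are
  therefore kept on lists and tested on multilinear functions; balance is regained after summing
  over an iterated comultiplication. Sums run over one fixed representative, the same in
  \<open>sweedler\<close> and \<open>ev\<close>, so reordering them is a matter of finite sums, and
  balance is called upon when a representative changes. Cocommutativity enters three times: to move
  a base element across a tensor sign, to separate the action of x on two lists multiplied factor by
  factor, and in the last codegeneracy, where a later factor multiplies an earlier one from the
  left.\<close>

locale kspace = abelian_group M for M :: "('k::field, 'm) module" (structure) +
  assumes smult_closed: "x \<in> carrier M \<Longrightarrow> c \<odot> x \<in> carrier M"
    and smult_r_distr: "x \<in> carrier M \<Longrightarrow> y \<in> carrier M \<Longrightarrow> c \<odot> (x \<oplus> y) = c \<odot> x \<oplus> c \<odot> y"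
    and smult_l_distr: "x \<in> carrier M \<Longrightarrow> (c + d) \<odot> x = c \<odot> x \<oplus> d \<odot> x"
    and smult_assoc1: "x \<in> carrier M \<Longrightarrow> (c * d) \<odot> x = c \<odot> (d \<odot> x)"
    and smult_one: "x \<in> carrier M \<Longrightarrow> 1 \<odot> x = x"
begin

lemma smult_zero_left: "x \<in> carrier M \<Longrightarrow> 0 \<odot> x = \<zero>"
proof -
  assume x: "x \<in> carrier M"
  have "0 \<odot> x \<oplus> 0 \<odot> x = 0 \<odot> x" using smult_l_distr[OF x, of 0 0] by simp
  then show ?thesis using x smult_closed by (metis add.r_cancel_one')
qed

lemma smult_minus_one: "x \<in> carrier M \<Longrightarrow> (-1) \<odot> x = \<ominus> x"
proof -
  assume x: "x \<in> carrier M"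
  have "(-1) \<odot> x \<oplus> x = \<zero>"
    using smult_l_distr[OF x, of "-1" 1] x by (simp add: smult_one smult_zero_left)
  then show ?thesis using x smult_closed by (metis minus_equality)
qed

end

definition subspace_of :: "('k::field, 'm) module \<Rightarrow> 'm set \<Rightarrow> bool" where
  "subspace_of M N \<longleftrightarrow> N \<subseteq> carrier M \<and> \<zero>\<^bsub>M\<^esub> \<in> N \<and> (\<forall>x\<in>N. \<forall>y\<in>N. x \<oplus>\<^bsub>M\<^esub> y \<in> N) \<and>
     (\<forall>c. \<forall>x\<in>N. c \<odot>\<^bsub>M\<^esub> x \<in> N)"

lemma a_rcoset_iff: "z \<in> N +>\<^bsub>M\<^esub> x \<longleftrightarrow> (\<exists>n\<in>N. z = n \<oplus>\<^bsub>M\<^esub> x)"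
  by (auto simp: a_r_coset_def')

lemma set_add_iff: "z \<in> X <+>\<^bsub>M\<^esub> Y \<longleftrightarrow> (\<exists>x\<in>X. \<exists>y\<in>Y. z = x \<oplus>\<^bsub>M\<^esub> y)"
  by (auto simp: set_add_def')

context kspace
begin

context
  fixes N assumes N: "subspace_of M N"
begin

lemma subspace_carrier: "n \<in> N \<Longrightarrow> n \<in> carrier M"
  using N by (auto simp: subspace_of_def)

lemma subspace_closed: "\<zero> \<in> N" "m \<in> N \<Longrightarrow> n \<in> N \<Longrightarrow> m \<oplus> n \<in> N" "n \<in> N \<Longrightarrow> c \<odot> n \<in> N"
  "n \<in> N \<Longrightarrow> \<ominus> n \<in> N" "m \<in> N \<Longrightarrow> n \<in> N \<Longrightarrow> m \<ominus> n \<in> N"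
proof -
  show *: "\<zero> \<in> N" "m \<in> N \<Longrightarrow> n \<in> N \<Longrightarrow> m \<oplus> n \<in> N" "n \<in> N \<Longrightarrow> c \<odot> n \<in> N" for m n c
    using N by (auto simp: subspace_of_def)
  show **: "\<ominus> n \<in> N" if "n \<in> N" for n
    using *(3)[OF that, of "-1"] smult_minus_one[OF subspace_carrier[OF that]] by simp
  show "m \<in> N \<Longrightarrow> n \<in> N \<Longrightarrow> m \<ominus> n \<in> N"
    using *(2) ** by (simp add: a_minus_def)
qed

lemma coset_self: "x \<in> carrier M \<Longrightarrow> x \<in> N +> x"
  unfolding a_rcoset_iff using subspace_closed(1) by (metis l_zero)

lemma coset_eq_iff:
  assumes x: "x \<in> carrier M" and y: "y \<in> carrier M"
  shows "N +> x = N +> y \<longleftrightarrow> x \<ominus> y \<in> N"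
proof
  assume "N +> x = N +> y"
  then obtain n where n: "n \<in> N" "x = n \<oplus> y" using coset_self[OF x] by (auto simp: a_rcoset_iff)
  then have "x \<ominus> y = n" using y subspace_carrier
    by (simp add: a_minus_def a_assoc r_neg)
  then show "x \<ominus> y \<in> N" using n by simp
next
  have sub: "N +> x \<subseteq> N +> y" if x: "x \<in> carrier M" and y: "y \<in> carrier M" and d: "x \<ominus> y \<in> N" for x y
  proof
    fix z assume "z \<in> N +> x"
    then obtain n where n: "n \<in> N" "z = n \<oplus> x" by (auto simp: a_rcoset_iff)
    have "z = (n \<oplus> (x \<ominus> y)) \<oplus> y" using n x y subspace_carrier
      by (simp add: a_minus_def a_assoc l_neg)
    then show "z \<in> N +> y" unfolding a_rcoset_iff using subspace_closed(2) n d by blast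
  qed
  assume d: "x \<ominus> y \<in> N"
  have "\<ominus> (x \<ominus> y) = y \<ominus> x" using x y by (simp add: a_minus_def minus_add a_comm)
  then have "y \<ominus> x \<in> N" using subspace_closed(4) d by metis
  then show "N +> x = N +> y" using sub x y d by blast
qed

lemma coset_mem_eq: "x \<in> carrier M \<Longrightarrow> y \<in> N +> x \<Longrightarrow> y \<in> carrier M \<and> N +> y = N +> x"
proof -
  assume x: "x \<in> carrier M" and "y \<in> N +> x"
  then obtain n where n: "n \<in> N" "y = n \<oplus> x" by (auto simp: a_rcoset_iff)
  then have y: "y \<in> carrier M" using x subspace_carrier by simp
  have "y \<ominus> x = n" using x n subspace_carrier by (simp add: a_minus_def a_assoc r_neg)
  then show ?thesis using coset_eq_iff[OF y x] n y by simp
qed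

lemma coset_zero: "N +> \<zero> = N"
  using subspace_carrier by (auto simp: a_rcoset_iff)

lemma coset_add:
  assumes x: "x \<in> carrier M" and y: "y \<in> carrier M"
  shows "(N +> x) <+>\<^bsub>M\<^esub> (N +> y) = N +> (x \<oplus> y)"
proof (intro equalityI subsetI)
  fix z assume "z \<in> (N +> x) <+>\<^bsub>M\<^esub> (N +> y)"
  then obtain m n where mn: "m \<in> N" "n \<in> N" "z = (m \<oplus> x) \<oplus> (n \<oplus> y)"
    by (auto simp: set_add_iff a_rcoset_iff)
  have "z = (m \<oplus> n) \<oplus> (x \<oplus> y)" using mn x y subspace_carrier by (simp add: a_ac)
  then show "z \<in> N +> (x \<oplus> y)" using mn subspace_closed(2) by (auto simp: a_rcoset_iff)
next
  fix z assume "z \<in> N +> (x \<oplus> y)"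
  then obtain n where n: "n \<in> N" "z = n \<oplus> (x \<oplus> y)" by (auto simp: a_rcoset_iff)
  then have "z = (n \<oplus> x) \<oplus> (\<zero> \<oplus> y)" using x y subspace_carrier by (simp add: a_ac)
  then show "z \<in> (N +> x) <+>\<^bsub>M\<^esub> (N +> y)"
    unfolding set_add_iff Bex_def a_rcoset_iff using n(1) subspace_closed(1) by blast
qed

text \<open>\<open>quotient_module\<close> scales a coset by the union of the cosets of all scaled
  representatives; scalar multiples of elements of N stay in N, so these cosets coincide.\<close>

lemma coset_smult:
  assumes x: "x \<in> carrier M"
  shows "(\<Union>z\<in>N +> x. N +> (c \<odot> z)) = N +> (c \<odot> x)"
proof -
  have "N +> (c \<odot> z) = N +> (c \<odot> x)" if z: "z \<in> N +> x" for z
  proof -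
    obtain n where n: "n \<in> N" "z = n \<oplus> x" using z by (auto simp: a_rcoset_iff)
    then have "c \<odot> z = c \<odot> n \<oplus> c \<odot> x" using x subspace_carrier by (simp add: smult_r_distr)
    then have "c \<odot> z \<in> N +> (c \<odot> x)" using n subspace_closed(3) by (auto simp: a_rcoset_iff)
    then show ?thesis using coset_mem_eq smult_closed x by blast
  qed
  then show ?thesis using coset_self[OF x] by blast
qed

lemma quotient_carrier: "carrier (quotient_module M N) = (\<lambda>x. N +> x) ` carrier M"
  by (auto simp: quotient_module_def A_RCOSETS_def')

lemma quotient_ops:
  "x \<in> carrier M \<Longrightarrow> y \<in> carrier M \<Longrightarrow> (N +> x) \<oplus>\<^bsub>quotient_module M N\<^esub> (N +> y) = N +> (x \<oplus> y)"
  "x \<in> carrier M \<Longrightarrow> c \<odot>\<^bsub>quotient_module M N\<^esub> (N +> x) = N +> (c \<odot> x)"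
  "\<zero>\<^bsub>quotient_module M N\<^esub> = N +> \<zero>"
  by (simp_all add: quotient_module_def coset_add coset_smult coset_zero)

lemma kspace_quotient: "kspace (quotient_module M N)"
proof (intro kspace.intro abelian_groupI kspace_axioms.intro)
  fix X assume "X \<in> carrier (quotient_module M N)"
  then obtain x where x: "x \<in> carrier M" "X = N +> x" by (auto simp: quotient_carrier)
  then show "\<exists>Y\<in>carrier (quotient_module M N). Y \<oplus>\<^bsub>quotient_module M N\<^esub> X = \<zero>\<^bsub>quotient_module M N\<^esub>"
    by (intro bexI[of _ "N +> (\<ominus> x)"]) (auto simp: quotient_carrier quotient_ops l_neg)
qed (auto simp: quotient_carrier quotient_ops smult_closed smult_r_distr smult_l_distr smult_assoc1
      smult_one a_ac)

end

end

section \<open>Linear maps between vector spaces with carriers\<close>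

lemma linear_onD:
  assumes "linear_on M N f"
  shows "x \<in> carrier M \<Longrightarrow> f x \<in> carrier N"
    "x \<in> carrier M \<Longrightarrow> y \<in> carrier M \<Longrightarrow> f (x \<oplus>\<^bsub>M\<^esub> y) = f x \<oplus>\<^bsub>N\<^esub> f y"
    "x \<in> carrier M \<Longrightarrow> f (c \<odot>\<^bsub>M\<^esub> x) = c \<odot>\<^bsub>N\<^esub> f x"
  using assms by (auto simp: linear_on_def)

lemma linear_on_zero:
  assumes "kspace M" "kspace N" "linear_on M N f"
  shows "f \<zero>\<^bsub>M\<^esub> = \<zero>\<^bsub>N\<^esub>"
proof -
  interpret M: kspace M by fact
  interpret N: kspace N by fact
  have "f (0 \<odot>\<^bsub>M\<^esub> \<zero>\<^bsub>M\<^esub>) = 0 \<odot>\<^bsub>N\<^esub> f \<zero>\<^bsub>M\<^esub>" using linear_onD[OF assms(3)] by simp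
  then show ?thesis using linear_onD[OF assms(3)] by (simp add: M.smult_zero_left N.smult_zero_left)
qed

lemma linear_on_minus:
  assumes "kspace M" "kspace N" "linear_on M N f" "x \<in> carrier M" "y \<in> carrier M"
  shows "f (x \<ominus>\<^bsub>M\<^esub> y) = f x \<ominus>\<^bsub>N\<^esub> f y" "f (\<ominus>\<^bsub>M\<^esub> y) = \<ominus>\<^bsub>N\<^esub> f y"
proof -
  interpret M: kspace M by fact
  interpret N: kspace N by fact
  have "f (\<ominus>\<^bsub>M\<^esub> y) = \<ominus>\<^bsub>N\<^esub> f y"
    using linear_onD[OF assms(3)] assms(4,5) by (simp flip: M.smult_minus_one N.smult_minus_one)
  then show "f (x \<ominus>\<^bsub>M\<^esub> y) = f x \<ominus>\<^bsub>N\<^esub> f y" "f (\<ominus>\<^bsub>M\<^esub> y) = \<ominus>\<^bsub>N\<^esub> f y"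
    using linear_onD[OF assms(3)] assms(4,5) by (simp_all add: a_minus_def)
qed

lemma linear_on_finsum:
  assumes "kspace M" "kspace N" "linear_on M N f" "finite A" "g \<in> A \<rightarrow> carrier M"
  shows "f (\<Oplus>\<^bsub>M\<^esub>i\<in>A. g i) = (\<Oplus>\<^bsub>N\<^esub>i\<in>A. f (g i))"
proof -
  interpret M: kspace M by fact
  interpret N: kspace N by fact
  from assms(4,5) show ?thesis
  proof (induction A)
    case empty
    then show ?case using linear_on_zero[OF assms(1-3)] by simp
  next
    case (insert a A)
    then show ?case using linear_onD[OF assms(3)]
      by (simp add: M.finsum_insert N.finsum_insert Pi_def)
  qed
qed

lemma linear_on_compose:
  "linear_on M N f \<Longrightarrow> linear_on N P g \<Longrightarrow> linear_on M P (\<lambda>x. g (f x))"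
  by (auto simp: linear_on_def Pi_def)

lemma linear_on_const_zero:
  assumes "kspace N" shows "linear_on M N (\<lambda>_. \<zero>\<^bsub>N\<^esub>)"
proof -
  interpret N: kspace N by fact
  have "c \<odot>\<^bsub>N\<^esub> \<zero>\<^bsub>N\<^esub> = \<zero>\<^bsub>N\<^esub>" for c
    using N.smult_assoc1[of "\<zero>\<^bsub>N\<^esub>" c 0] by (simp add: N.smult_zero_left)
  then show ?thesis by (simp add: linear_on_def)
qed

lemma linear_on_add:
  assumes "kspace N" "linear_on M N f" "linear_on M N g"
  shows "linear_on M N (\<lambda>x. f x \<oplus>\<^bsub>N\<^esub> g x)"
proof -
  interpret N: kspace N by fact
  show ?thesis using assms(2,3) by (auto simp: linear_on_def Pi_def N.a_ac N.smult_r_distr)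
qed

lemma linear_on_smult:
  assumes "kspace N" "linear_on M N f"
  shows "linear_on M N (\<lambda>x. c \<odot>\<^bsub>N\<^esub> f x)"
proof -
  interpret N: kspace N by fact
  have "c \<odot>\<^bsub>N\<^esub> (d \<odot>\<^bsub>N\<^esub> y) = d \<odot>\<^bsub>N\<^esub> (c \<odot>\<^bsub>N\<^esub> y)" if "y \<in> carrier N" for d y
    using that by (metis N.smult_assoc1 mult.commute)
  then show ?thesis using assms(2)
    by (auto simp: linear_on_def Pi_def N.smult_r_distr N.smult_closed)
qed

text \<open>\<open>linear_on\<close> constrains values on the carrier only. This serves where a sum
  or a negative simplifies only for arguments in the carrier.\<close>

lemma linear_on_cong:
  assumes "kspace M" "linear_on M N g" "\<And>x. x \<in> carrier M \<Longrightarrow> f x = g x"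
  shows "linear_on M N f"
proof -
  interpret M: kspace M by fact
  show ?thesis using assms(2,3) by (auto simp: linear_on_def Pi_def M.smult_closed)
qed

lemma linear_on_uminus:
  assumes "kspace M" "kspace N" "linear_on M N f"
  shows "linear_on M N (\<lambda>x. \<ominus>\<^bsub>N\<^esub> f x)"
  using linear_on_smult[OF assms(2,3), of "-1"]
  by (rule linear_on_cong[OF assms(1)])
    (simp add: kspace.smult_minus_one[OF assms(2)] linear_onD[OF assms(3)])

lemma linear_on_sum:
  assumes "kspace M" "kspace N" "finite A" "\<And>i. i \<in> A \<Longrightarrow> linear_on M N (f i)"
  shows "linear_on M N (\<lambda>x. \<Oplus>\<^bsub>N\<^esub>i\<in>A. f i x)"
proof -
  interpret N: kspace N by fact
  from assms(3,4) show ?thesis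
  proof (induction A)
    case empty
    then show ?case using linear_on_const_zero[OF assms(2)] by simp
  next
    case (insert a A)
    have "linear_on M N (\<lambda>x. f a x \<oplus>\<^bsub>N\<^esub> (\<Oplus>\<^bsub>N\<^esub>i\<in>A. f i x))"
      using insert by (intro linear_on_add assms(2)) auto
    moreover have "(\<Oplus>\<^bsub>N\<^esub>i\<in>insert a A. f i x) = f a x \<oplus>\<^bsub>N\<^esub> (\<Oplus>\<^bsub>N\<^esub>i\<in>A. f i x)"
      if x: "x \<in> carrier M" for x
    proof -
      have "f i x \<in> carrier N" if "i \<in> insert a A" for i
        using linear_onD(1)[OF insert.prems[OF that] x] .
      then show ?thesis using N.finsum_insert[OF insert.hyps(1,2), of "\<lambda>i. f i x"] by (simp add: Pi_def)
    qed
    ultimately show ?case by (rule linear_on_cong[OF assms(1)])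
  qed
qed

lemma kspace_vector_module:
  assumes "vector_space s" shows "kspace (vector_module s)"
proof -
  interpret vector_space s by fact
  have "\<exists>y. y + x = 0" for x :: 'b by (metis add.left_inverse)
  then show ?thesis
    by (intro kspace.intro abelian_groupI kspace_axioms.intro)
      (simp_all add: vector_module_def algebra_simps scale_right_distrib scale_left_distrib)
qed

lemma finsum_vector_module:
  assumes "vector_space s" "finite A"
  shows "(\<Oplus>\<^bsub>vector_module s\<^esub>i\<in>A. f i) = (\<Sum>i\<in>A. f i)"
proof -
  interpret kspace "vector_module s" by (rule kspace_vector_module) fact
  show ?thesis using assms(2)
  proof (induction A)
    case empty
    then show ?case using finsum_empty by (simp add: vector_module_def)
  next
    case (insert a A)
    have "f \<in> A \<rightarrow> carrier (vector_module s)" by (simp add: vector_module_def)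
    then show ?case using insert finsum_insert[of A a f] by (simp add: vector_module_def)
  qed
qed

text \<open>The left inverse \<open>r\<close> makes \<open>e\<close> injective, so the structure is
  transported along it; \<open>Inl\<close> and \<open>Inr\<close> are the cases of interest.\<close>

lemma kspace_image_module:
  assumes "kspace M" and [simp]: "\<And>x. r (e x) = x"
  shows "kspace (image_module e r M)"
proof -
  interpret kspace M by fact
  have "\<exists>y\<in>carrier M. e (y \<oplus>\<^bsub>M\<^esub> x) = e \<zero>\<^bsub>M\<^esub>" if "x \<in> carrier M" for x
    using that by (intro bexI[of _ "\<ominus>\<^bsub>M\<^esub> x"]) (auto simp: l_neg)
  then show ?thesis
    by (intro kspace.intro abelian_groupI kspace_axioms.intro)
      (auto simp: image_module_def smult_closed smult_r_distr smult_l_distr smult_assoc1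
        smult_one a_ac)
qed

lemma linear_on_image_module:
  assumes [simp]: "\<And>x. r (e x) = x" "\<And>x. r' (e' x) = x" and "linear_on M N f"
    and g: "\<And>x. x \<in> carrier M \<Longrightarrow> g (e x) = e' (f x)" and "kspace M"
  shows "linear_on (image_module e r M) (image_module e' r' N) g"
proof -
  interpret kspace M by fact
  show ?thesis using linear_onD[OF assms(3)]
    by (auto simp: linear_on_def image_module_def g smult_closed)
qed

section \<open>Maps induced on cohomology\<close>

text \<open>Two representatives of a coset differ by an element of N, which \<open>f\<close> sends
  into N'. As every class comes from some z in Z, the formula on classes determines the induced
  map.\<close>

lemma quotient_module_map:
  assumes "kspace M" "kspace M'" and f: "linear_on M M' f"
    and Z: "subspace_of M Z" "subspace_of M' Z'" "f ` Z \<subseteq> Z'"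
    and N: "subspace_of M N" "subspace_of M' N'" "f ` N \<subseteq> N'"
  shows "\<exists>h. linear_on (quotient_module (M\<lparr>carrier := Z\<rparr>) N) (quotient_module (M'\<lparr>carrier := Z'\<rparr>) N') h \<and>
    (\<forall>z\<in>Z. h (N +>\<^bsub>M\<^esub> z) = N' +>\<^bsub>M'\<^esub> f z)"
proof -
  interpret M: kspace M by fact
  interpret M': kspace M' by fact
  have Zc: "z \<in> carrier M" if "z \<in> Z" for z using Z(1) that by (auto simp: subspace_of_def)
  have Zc': "z \<in> carrier M'" if "z \<in> Z'" for z using Z(2) that by (auto simp: subspace_of_def)
  have fZ: "f z \<in> Z'" if "z \<in> Z" for z using Z(3) that by blast
  have fN: "f z \<in> N'" if "z \<in> N" for z using N(3) that by blast
  \<comment> \<open>Shrinking the carrier to Z leaves the addition alone, and cosets and set sums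
    depend on the addition only, so all computations can be done in \<open>M\<close> and
    \<open>M'\<close>.\<close>
  have coset: "X +>\<^bsub>M\<lparr>carrier := Z\<rparr>\<^esub> z = X +>\<^bsub>M\<^esub> z" "V +>\<^bsub>M'\<lparr>carrier := Z'\<rparr>\<^esub> w = V +>\<^bsub>M'\<^esub> w"
    "X <+>\<^bsub>M\<lparr>carrier := Z\<rparr>\<^esub> Y = X <+>\<^bsub>M\<^esub> Y" "V <+>\<^bsub>M'\<lparr>carrier := Z'\<rparr>\<^esub> W = V <+>\<^bsub>M'\<^esub> W" for X Y V W z w
    by (simp_all add: a_r_coset_def' set_add_def')
  have Q: "carrier (quotient_module (M\<lparr>carrier := Z\<rparr>) N) = (\<lambda>z. N +>\<^bsub>M\<^esub> z) ` Z"
    "carrier (quotient_module (M'\<lparr>carrier := Z'\<rparr>) N') = (\<lambda>z. N' +>\<^bsub>M'\<^esub> z) ` Z'"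
    by (auto simp: quotient_module_def A_RCOSETS_def' coset)
  define h where "h X = N' +>\<^bsub>M'\<^esub> f (SOME z. z \<in> Z \<and> X = N +>\<^bsub>M\<^esub> z)" for X
  have h: "h (N +>\<^bsub>M\<^esub> z) = N' +>\<^bsub>M'\<^esub> f z" if z: "z \<in> Z" for z
  proof -
    define y where "y = (SOME y. y \<in> Z \<and> N +>\<^bsub>M\<^esub> z = N +>\<^bsub>M\<^esub> y)"
    have y: "y \<in> Z \<and> N +>\<^bsub>M\<^esub> z = N +>\<^bsub>M\<^esub> y"
      unfolding y_def by (rule someI[of _ z]) (use z in simp)
    have c: "z \<in> carrier M" "y \<in> carrier M" using y z Zc by auto
    have "z \<ominus>\<^bsub>M\<^esub> y \<in> N" using M.coset_eq_iff[OF N(1) c] y by blast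
    then have "f z \<ominus>\<^bsub>M'\<^esub> f y \<in> N'"
      using fN linear_on_minus(1)[OF assms(1,2) f c] by metis
    then have "N' +>\<^bsub>M'\<^esub> f z = N' +>\<^bsub>M'\<^esub> f y"
      using M'.coset_eq_iff[OF N(2)] linear_onD(1)[OF f] c by blast
    then show ?thesis by (simp add: h_def y_def)
  qed
  have "linear_on (quotient_module (M\<lparr>carrier := Z\<rparr>) N) (quotient_module (M'\<lparr>carrier := Z'\<rparr>) N') h"
    unfolding linear_on_def
  proof (intro conjI ballI allI funcsetI)
    fix X assume "X \<in> carrier (quotient_module (M\<lparr>carrier := Z\<rparr>) N)"
    then obtain x where x: "x \<in> Z" "X = N +>\<^bsub>M\<^esub> x" by (auto simp: Q)
    then show "h X \<in> carrier (quotient_module (M'\<lparr>carrier := Z'\<rparr>) N')" by (auto simp: Q h fZ)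
    fix c
    have "c \<odot>\<^bsub>M\<^esub> x \<in> Z" using Z(1) x by (auto simp: subspace_of_def)
    then show "h (c \<odot>\<^bsub>quotient_module (M\<lparr>carrier := Z\<rparr>) N\<^esub> X) =
        c \<odot>\<^bsub>quotient_module (M'\<lparr>carrier := Z'\<rparr>) N'\<^esub> h X"
      using x by (simp add: quotient_module_def coset M.coset_smult[OF N(1)] M'.coset_smult[OF N(2)]
          Zc Zc' fZ h linear_onD[OF f])
  next
    fix X Y assume "X \<in> carrier (quotient_module (M\<lparr>carrier := Z\<rparr>) N)"
      "Y \<in> carrier (quotient_module (M\<lparr>carrier := Z\<rparr>) N)"
    then obtain x y where x: "x \<in> Z" "X = N +>\<^bsub>M\<^esub> x" and y: "y \<in> Z" "Y = N +>\<^bsub>M\<^esub> y" by (auto simp: Q)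
    have "x \<oplus>\<^bsub>M\<^esub> y \<in> Z" using Z(1) x y by (auto simp: subspace_of_def)
    then show "h (X \<oplus>\<^bsub>quotient_module (M\<lparr>carrier := Z\<rparr>) N\<^esub> Y) =
        h X \<oplus>\<^bsub>quotient_module (M'\<lparr>carrier := Z'\<rparr>) N'\<^esub> h Y"
      using x y by (simp add: quotient_module_def coset M.coset_add[OF N(1)] M'.coset_add[OF N(2)]
          Zc Zc' fZ h linear_onD[OF f])
  qed
  then show ?thesis using h by blast
qed

lemma subspace_kernel:
  assumes "kspace M" "kspace N" and d: "linear_on M N d"
  shows "subspace_of M {z \<in> carrier M. d z = \<zero>\<^bsub>N\<^esub>}"
proof -
  interpret M: kspace M by fact
  interpret N: kspace N by fact
  have "c \<odot>\<^bsub>N\<^esub> \<zero>\<^bsub>N\<^esub> = \<zero>\<^bsub>N\<^esub>" for c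
    using linear_onD(3)[OF linear_on_const_zero[OF assms(2)], of "\<zero>\<^bsub>N\<^esub>" N c] by simp
  then show ?thesis
    by (auto simp: subspace_of_def linear_on_zero[OF assms] linear_onD[OF d] M.smult_closed)
qed

lemma subspace_image:
  assumes "kspace M" "kspace N" and d: "linear_on M N d"
  shows "subspace_of N (d ` carrier M)"
proof -
  interpret M: kspace M by fact
  interpret N: kspace N by fact
  show ?thesis
    unfolding subspace_of_def
  proof (intro conjI allI ballI)
    show "\<zero>\<^bsub>N\<^esub> \<in> d ` carrier M" using linear_on_zero[OF assms] by (metis M.zero_closed imageI)
    show "x \<oplus>\<^bsub>N\<^esub> y \<in> d ` carrier M" if "x \<in> d ` carrier M" "y \<in> d ` carrier M" for x y
      using that linear_onD(2)[OF d, symmetric] by auto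
    show "c \<odot>\<^bsub>N\<^esub> x \<in> d ` carrier M" if "x \<in> d ` carrier M" for c x
      using that linear_onD(3)[OF d, symmetric] M.smult_closed by auto
  qed (use linear_onD(1)[OF d] in auto)
qed

lemma subspace_zero:
  assumes "kspace M" shows "subspace_of M {\<zero>\<^bsub>M\<^esub>}"
proof -
  interpret kspace M by fact
  have "(\<lambda>_. \<zero>\<^bsub>M\<^esub>) ` carrier M = {\<zero>\<^bsub>M\<^esub>}" using zero_closed by auto
  then show ?thesis using subspace_image[OF assms assms linear_on_const_zero[OF assms]] by simp
qed

text \<open>Commutation with the differentials carries cocycles to cocycles and coboundaries to
  coboundaries. Hochschild and cyclic cohomology are the two instances.\<close>

theorem cohomology_map:
  assumes M: "\<And>n. kspace (M n)" and M': "\<And>n. kspace (M' n)"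
    and d: "\<And>n. linear_on (M n) (M (Suc n)) (d n)" and d': "\<And>n. linear_on (M' n) (M' (Suc n)) (d' n)"
    and F: "\<And>n. linear_on (M n) (M' n) (F n)"
    and comm: "\<And>n z. z \<in> carrier (M n) \<Longrightarrow> F (Suc n) (d n z) = d' n (F n z)"
  shows "\<exists>h. linear_on (cohomology M d n) (cohomology M' d' n) h \<and>
    (\<forall>z\<in>cocycles M d n. F n z \<in> cocycles M' d' n \<and>
       h (cohomology_class M d n z) = cohomology_class M' d' n (F n z))"
proof -
  have Z: "F n z \<in> cocycles M' d' n" if "z \<in> cocycles M d n" for z
    using that comm[of z n] linear_on_zero[OF M M' F, of "Suc n"] linear_onD(1)[OF F]
    by (auto simp: cocycles_def)
  have B: "subspace_of (M n) (coboundaries M d n)" "subspace_of (M' n) (coboundaries M' d' n)"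
    using subspace_zero[OF M] subspace_image[OF M M d, of "n - 1"]
      subspace_zero[OF M'] subspace_image[OF M' M' d', of "n - 1"]
    by (auto simp: coboundaries_def)
  have FB: "F n ` coboundaries M d n \<subseteq> coboundaries M' d' n"
  \<comment> \<open>In degree 0 \<open>coboundaries\<close> is the zero space by definition, so only
    the value of \<open>F 0\<close> at zero is at stake.\<close>
  proof (cases n)
    case 0
    then show ?thesis using linear_on_zero[OF M M' F] by (simp add: coboundaries_def)
  next
    case (Suc m)
    then show ?thesis using comm[of _ m] linear_onD(1)[OF F, of _ m] by (auto simp: coboundaries_def)
  qed
  have FZ: "F n ` cocycles M d n \<subseteq> cocycles M' d' n" using Z by auto
  have "subspace_of (M n) (cocycles M d n)" "subspace_of (M' n) (cocycles M' d' n)"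
    using subspace_kernel[OF M M d, of n] subspace_kernel[OF M' M' d', of n] by (simp_all add: cocycles_def)
  from quotient_module_map[OF M M' F this FZ B FB] obtain h where
    "linear_on (cohomology M d n) (cohomology M' d' n) h"
    "\<forall>z\<in>cocycles M d n. h (cohomology_class M d n z) = cohomology_class M' d' n (F n z)"
    unfolding cohomology_def cohomology_class_def by (elim exE conjE)
  then show ?thesis using Z by (intro exI[of _ h]) simp
qed

section \<open>The Hochschild complex and the total complex of a cocyclic module\<close>

locale cocyclic_space =
  fixes X :: "('k::field, 'm) cocyclic"
  assumes kspace_obj: "kspace (obj X n)"
    and coface_linear: "i \<le> Suc n \<Longrightarrow> linear_on (obj X n) (obj X (Suc n)) (coface X n i)"
    and cyclic_linear: "linear_on (obj X n) (obj X n) (cyclic X n)"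
begin

lemma alternating_sum_linear:
  "k \<le> Suc n \<Longrightarrow> linear_on (obj X n) (obj X (Suc n)) (alternating_sum X n k)"
  unfolding alternating_sum_def
  by (intro linear_on_sum linear_on_smult kspace_obj coface_linear) auto

lemma signed_cyclic_linear: "linear_on (obj X n) (obj X n) (signed_cyclic X n)"
  unfolding signed_cyclic_def by (intro linear_on_smult kspace_obj cyclic_linear)

lemma signed_cyclic_funpow_linear: "linear_on (obj X n) (obj X n) (signed_cyclic X n ^^ j)"
proof (induction j)
  case 0
  then show ?case by (auto simp: linear_on_def)
next
  case (Suc j)
  then show ?case using linear_on_compose[OF Suc signed_cyclic_linear] by (simp add: comp_def)
qed

lemma cyclic_norm_linear: "linear_on (obj X n) (obj X n) (cyclic_norm X n)"
  unfolding cyclic_norm_def by (intro linear_on_sum kspace_obj signed_cyclic_funpow_linear) auto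

lemma hochschild_b_linear: "linear_on (obj X n) (obj X (Suc n)) (hochschild_b X n)"
  "linear_on (obj X n) (obj X (Suc n)) (hochschild_b' X n)"
  unfolding hochschild_b_def hochschild_b'_def by (simp_all add: alternating_sum_linear)

text \<open>A finite product of the spaces in columns 0 to n. Total cochains are extensional
  functions, so negatives are cut off to \<open>{..n}\<close> and equations are compared between
  restrictions.\<close>

lemma kspace_total: "kspace (total_module X n)"
proof -
  interpret O: kspace "obj X m" for m by (rule kspace_obj)
  show ?thesis
  proof (intro kspace.intro abelian_groupI kspace_axioms.intro)
    fix f assume f: "f \<in> carrier (total_module X n)"
    then show "\<exists>g\<in>carrier (total_module X n). g \<oplus>\<^bsub>total_module X n\<^esub> f = \<zero>\<^bsub>total_module X n\<^esub>"
      by (intro bexI[of _ "\<lambda>p\<in>{..n}. \<ominus>\<^bsub>obj X (n - p)\<^esub> f p"])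
        (auto simp: total_module_def PiE_def Pi_def O.l_neg intro!: restrict_ext)
  qed (auto simp: total_module_def PiE_iff O.smult_closed O.smult_r_distr O.smult_l_distr
      O.smult_assoc1 O.smult_one O.a_ac intro!: restrict_ext extensionalityI[of _ "{..n}"])
qed

lemma total_component_linear:
  "p \<le> n \<Longrightarrow> linear_on (total_module X n) (obj X (n - p)) (\<lambda>f. f p)"
  by (auto simp: linear_on_def total_module_def PiE_def Pi_def)

lemma total_vertical_linear:
  assumes "p \<le> Suc n"
  shows "linear_on (total_module X n) (obj X (Suc n - p)) (\<lambda>f. total_vertical X n f p)"
\<comment> \<open>In total degree n + 1 the column n + 1 sits in row 0, where no vertical map from
  total degree n arrives; \<open>total_vertical\<close> is zero there.\<close>
proof (cases "p = Suc n")
  case True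
  then show ?thesis using linear_on_const_zero[OF kspace_obj] by (simp add: total_vertical_def)
next
  case False
  then have p: "p \<le> n" "Suc n - p = Suc (n - p)" using assms by auto
  have "linear_on (total_module X n) (obj X (Suc n - p)) (\<lambda>f. hochschild_b X (n - p) (f p))"
    "linear_on (total_module X n) (obj X (Suc n - p)) (\<lambda>f. \<ominus>\<^bsub>obj X (Suc n - p)\<^esub> hochschild_b' X (n - p) (f p))"
    unfolding p(2) by (intro linear_on_uminus kspace_total kspace_obj
        linear_on_compose[OF total_component_linear[OF p(1)]] hochschild_b_linear)+
  then show ?thesis using False by (cases "even p") (simp_all add: total_vertical_def)
qed

lemma total_horizontal_linear:
  assumes "p \<le> Suc n"
  shows "linear_on (total_module X n) (obj X (Suc n - p)) (\<lambda>f. total_horizontal X n f p)"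
proof (cases "p = 0")
  case True
  then show ?thesis using linear_on_const_zero[OF kspace_obj] by (simp add: total_horizontal_def)
next
  case False
  \<comment> \<open>The horizontal map leads from column p - 1 to column p within one row, and the
    row number is n - (p - 1) in total degree n and n + 1 - p in total degree n + 1.\<close>
  then have p: "p - 1 \<le> n" "n - (p - 1) = Suc n - p" using assms by auto
  note c = total_component_linear[OF p(1), unfolded p(2)]
  have "linear_on (total_module X n) (obj X (Suc n - p)) (\<lambda>f. cyclic_norm X (Suc n - p) (f (p - 1)))"
    "linear_on (total_module X n) (obj X (Suc n - p))
      (\<lambda>f. f (p - 1) \<ominus>\<^bsub>obj X (Suc n - p)\<^esub> signed_cyclic X (Suc n - p) (f (p - 1)))"
    unfolding a_minus_def
    by (intro linear_on_add linear_on_uminus kspace_total kspace_obj c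
        linear_on_compose[OF c] cyclic_norm_linear signed_cyclic_linear)+
  then show ?thesis using False by (cases "odd p") (simp_all add: total_horizontal_def)
qed

lemma linear_on_totalI:
  assumes "\<And>p. p \<le> n \<Longrightarrow> linear_on M (obj X (n - p)) (\<lambda>f. g f p)"
  shows "linear_on M (total_module X n) (\<lambda>f. \<lambda>p\<in>{..n}. g f p)"
  using linear_onD[OF assms] by (auto simp: linear_on_def total_module_def intro!: restrict_ext)

lemma total_differential_linear:
  "linear_on (total_module X n) (total_module X (Suc n)) (total_differential X n)"
  unfolding total_differential_def
  by (intro linear_on_totalI linear_on_add kspace_obj total_vertical_linear total_horizontal_linear)

end

locale cocyclic_map = X: cocyclic_space X + Y: cocyclic_space Y
  for X :: "('k::field, 'm) cocyclic" and Y :: "('k, 'n) cocyclic" +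
  fixes F :: "nat \<Rightarrow> 'm \<Rightarrow> 'n"
  assumes morphism: "cocyclic_morphism X Y F"
begin

lemma F_linear: "linear_on (obj X n) (obj Y n) (F n)"
  using morphism by (simp add: cocyclic_morphism_def)

lemma F_coface: "i \<le> Suc n \<Longrightarrow> z \<in> carrier (obj X n) \<Longrightarrow> F (Suc n) (coface X n i z) = coface Y n i (F n z)"
  using morphism by (simp add: cocyclic_morphism_def)

lemma F_cyclic: "z \<in> carrier (obj X n) \<Longrightarrow> F n (cyclic X n z) = cyclic Y n (F n z)"
  using morphism by (simp add: cocyclic_morphism_def)

lemma F_alternating_sum:
  assumes k: "k \<le> Suc n" and z: "z \<in> carrier (obj X n)"
  shows "F (Suc n) (alternating_sum X n k z) = alternating_sum Y n k (F n z)"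
proof -
  interpret O: kspace "obj X (Suc n)" by (rule X.kspace_obj)
  interpret O': kspace "obj Y (Suc n)" by (rule Y.kspace_obj)
  have cl: "coface X n i z \<in> carrier (obj X (Suc n))" if "i \<le> k" for i
    using linear_onD(1)[OF X.coface_linear z] that k by simp
  have cl': "coface Y n i (F n z) \<in> carrier (obj Y (Suc n))" if "i \<le> k" for i
    using linear_onD(1)[OF Y.coface_linear linear_onD(1)[OF F_linear z]] that k by simp
  show ?thesis
    unfolding alternating_sum_def using k
    by (subst linear_on_finsum[OF X.kspace_obj Y.kspace_obj F_linear])
      (auto intro!: O'.finsum_cong' O.smult_closed O'.smult_closed cl cl'
        simp: linear_onD[OF F_linear] cl F_coface z)
qed

lemma F_signed_cyclic:
  assumes "z \<in> carrier (obj X n)" shows "F n (signed_cyclic X n z) = signed_cyclic Y n (F n z)"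
  using assms linear_onD(1)[OF X.cyclic_linear assms]
  by (simp add: signed_cyclic_def linear_onD[OF F_linear] F_cyclic)

lemma F_signed_cyclic_funpow:
  "z \<in> carrier (obj X n) \<Longrightarrow> F n ((signed_cyclic X n ^^ j) z) = (signed_cyclic Y n ^^ j) (F n z)"
  by (induction j) (simp_all add: F_signed_cyclic linear_onD(1)[OF X.signed_cyclic_funpow_linear])

lemma F_cyclic_norm:
  assumes z: "z \<in> carrier (obj X n)" shows "F n (cyclic_norm X n z) = cyclic_norm Y n (F n z)"
proof -
  interpret O': kspace "obj Y n" by (rule Y.kspace_obj)
  show ?thesis
    unfolding cyclic_norm_def
    by (subst linear_on_finsum[OF X.kspace_obj Y.kspace_obj F_linear])
      (auto simp: F_signed_cyclic_funpow z linear_onD(1)[OF X.signed_cyclic_funpow_linear])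
qed

lemma total_map_linear: "linear_on (total_module X n) (total_module Y n) (total_map F n)"
  unfolding total_map_def
  by (intro Y.linear_on_totalI linear_on_compose[OF X.total_component_linear F_linear])

lemma total_map_differential:
  assumes f: "f \<in> carrier (total_module X n)"
  shows "total_map F (Suc n) (total_differential X n f) = total_differential Y n (total_map F n f)"
proof -
  have "F (Suc n - p) (total_differential X n f p) = total_differential Y n (total_map F n f) p"
    if p: "p \<le> Suc n" for p
  proof -
    have c: "f q \<in> carrier (obj X (n - q))" if "q \<le> n" for q
      using f that by (auto simp: total_module_def)
    have v: "F (Suc n - p) (total_vertical X n f p) = total_vertical Y n (total_map F n f) p"
    proof (cases "p = Suc n")
      case True
      then show ?thesis
        using linear_on_zero[OF X.kspace_obj Y.kspace_obj F_linear] by (simp add: total_vertical_def)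
    next
      case False
      then have q: "p \<le> n" "Suc n - p = Suc (n - p)" using p by auto
      have b: "hochschild_b' X (n - p) (f p) \<in> carrier (obj X (Suc (n - p)))"
        using linear_onD(1)[OF X.hochschild_b_linear(2) c[OF q(1)]] .
      show ?thesis using False q c[OF q(1)] b unfolding q(2)
        by (auto simp: total_vertical_def total_map_def hochschild_b_def hochschild_b'_def
            F_alternating_sum q(2) linear_on_minus(2)[OF X.kspace_obj Y.kspace_obj F_linear])
    qed
    have h: "F (Suc n - p) (total_horizontal X n f p) = total_horizontal Y n (total_map F n f) p"
    proof (cases "p = 0")
      case True
      then show ?thesis
        using linear_on_zero[OF X.kspace_obj Y.kspace_obj F_linear] by (simp add: total_horizontal_def)
    next
      case False
      then have q: "p - 1 \<le> n" "n - (p - 1) = Suc n - p" using p by auto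
      have c': "f (p - 1) \<in> carrier (obj X (Suc n - p))" using c[OF q(1)] q(2) by simp
      have s: "signed_cyclic X (Suc n - p) (f (p - 1)) \<in> carrier (obj X (Suc n - p))"
        using linear_onD(1)[OF X.signed_cyclic_linear c'] .
      have t: "total_map F n f (p - 1) = F (Suc n - p) (f (p - 1))"
        using q by (simp add: total_map_def)
      show ?thesis using False c' s t
        by (simp add: total_horizontal_def F_cyclic_norm F_signed_cyclic
            linear_on_minus(1)[OF X.kspace_obj Y.kspace_obj F_linear])
    qed
    show ?thesis
      using p v h linear_onD(2)[OF F_linear linear_onD(1)[OF X.total_vertical_linear[OF p] f]
          linear_onD(1)[OF X.total_horizontal_linear[OF p] f]]
      by (simp add: total_differential_def)
  qed
  then show ?thesis
    by (auto simp: total_map_def[of F "Suc n"] total_differential_def[of Y] intro!: restrict_ext)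
qed

lemma HH_map:
  "\<exists>h. linear_on (HH X n) (HH Y n) h \<and>
     (\<forall>z\<in>cocycles (obj X) (hochschild_b X) n.
        F n z \<in> cocycles (obj Y) (hochschild_b Y) n \<and>
        h (cohomology_class (obj X) (hochschild_b X) n z) =
          cohomology_class (obj Y) (hochschild_b Y) n (F n z))"
  by (intro cohomology_map X.kspace_obj Y.kspace_obj X.hochschild_b_linear Y.hochschild_b_linear F_linear)
    (simp add: hochschild_b_def F_alternating_sum)

lemma HC_map:
  "\<exists>h. linear_on (HC X n) (HC Y n) h \<and>
     (\<forall>z\<in>cocycles (total_module X) (total_differential X) n.
        total_map F n z \<in> cocycles (total_module Y) (total_differential Y) n \<and>
        h (cohomology_class (total_module X) (total_differential X) n z) =
          cohomology_class (total_module Y) (total_differential Y) n (total_map F n z))"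
  by (intro cohomology_map X.kspace_total Y.kspace_total X.total_differential_linear
      Y.total_differential_linear total_map_linear total_map_differential)

end

section \<open>Tensor powers and their functionals\<close>

lemma vector_space_times: "vector_space ((*) :: 'k::field \<Rightarrow> 'k \<Rightarrow> 'k)"
  by unfold_locales (auto simp: algebra_simps)

lemma lookup_free_scale: "Poly_Mapping.lookup (free_scale c p) g = c * Poly_Mapping.lookup p g"
  unfolding free_scale_def by (simp add: Poly_Mapping.map.rep_eq when_def)

lemma vector_space_free_scale: "vector_space free_scale"
  by unfold_locales
    (auto intro!: poly_mapping_eqI simp: lookup_free_scale lookup_add algebra_simps)

interpretation free: vector_space free_scale
  by (rule vector_space_free_scale)

lemma keys_free_scale: "Poly_Mapping.keys (free_scale c p) \<subseteq> Poly_Mapping.keys p"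
  by (auto simp: in_keys_iff lookup_free_scale)

lemma kspace_free_module: "kspace (free_module G :: ('k::field, 'g \<Rightarrow>\<^sub>0 'k) module)"
  (is "kspace ?M")
proof (intro kspace.intro abelian_groupI kspace_axioms.intro)
  fix p :: "'g \<Rightarrow>\<^sub>0 'k" assume "p \<in> carrier ?M"
  then show "\<exists>q\<in>carrier ?M. q \<oplus>\<^bsub>?M\<^esub> p = \<zero>\<^bsub>?M\<^esub>"
    by (intro bexI[of _ "- p"]) (auto simp: free_module_def)
next
  fix p q :: "'g \<Rightarrow>\<^sub>0 'k" assume "p \<in> carrier ?M" "q \<in> carrier ?M"
  then show "p \<oplus>\<^bsub>?M\<^esub> q \<in> carrier ?M"
    using Poly_Mapping.keys_add[of p q] by (auto simp: free_module_def)
next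
  fix p :: "'g \<Rightarrow>\<^sub>0 'k" and c assume "p \<in> carrier ?M"
  then show "c \<odot>\<^bsub>?M\<^esub> p \<in> carrier ?M"
    using keys_free_scale[of c p] by (auto simp: free_module_def)
qed (auto simp: free_module_def algebra_simps free.scale_right_distrib free.scale_left_distrib)

lemma free_module_minus:
  assumes "p \<in> carrier (free_module G)" "q \<in> carrier (free_module G)"
  shows "p \<ominus>\<^bsub>free_module G\<^esub> q = p - q"
proof -
  interpret kspace "free_module G" by (rule kspace_free_module)
  have "- q \<in> carrier (free_module G)" using assms by (auto simp: free_module_def)
  then have "\<ominus>\<^bsub>free_module G\<^esub> q = - q"
    using assms by (intro minus_equality) (auto simp: free_module_def)
  then show ?thesis by (simp add: a_minus_def free_module_def)
qed

section \<open>Functions on words as functionals on the free space\<close>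

definition pairing :: "('g \<Rightarrow> 'k::field) \<Rightarrow> ('g \<Rightarrow>\<^sub>0 'k) \<Rightarrow> 'k" where
  "pairing G p = (\<Sum>g\<in>Poly_Mapping.keys p. Poly_Mapping.lookup p g * G g)"

lemma pairing_superset:
  "finite A \<Longrightarrow> Poly_Mapping.keys p \<subseteq> A \<Longrightarrow> pairing G p = (\<Sum>g\<in>A. Poly_Mapping.lookup p g * G g)"
  unfolding pairing_def by (rule sum.mono_neutral_left) (auto simp: in_keys_iff)

lemma pairing_add: "pairing G (p + q) = pairing G p + pairing G q"
proof -
  let ?A = "Poly_Mapping.keys p \<union> Poly_Mapping.keys q"
  have *: "finite ?A" "Poly_Mapping.keys p \<subseteq> ?A" "Poly_Mapping.keys q \<subseteq> ?A"
    "Poly_Mapping.keys (p + q) \<subseteq> ?A" using Poly_Mapping.keys_add[of p q] by auto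
  show ?thesis
    unfolding pairing_superset[OF *(1,2)] pairing_superset[OF *(1,3)] pairing_superset[OF *(1,4)]
    by (simp add: lookup_add sum.distrib algebra_simps)
qed

lemma pairing_scale: "pairing G (free_scale c p) = c * pairing G p"
  unfolding pairing_superset[OF finite_keys keys_free_scale]
  by (simp add: pairing_def lookup_free_scale sum_distrib_left mult.assoc)

lemma pairing_diff: "pairing G (p - q) = pairing G p - pairing G q"
  using pairing_add[of G "p - q" q] by simp

lemma pairing_single: "pairing G (Poly_Mapping.single g 1) = G g"
  by (simp add: pairing_def)

lemma linear_eq_pairing:
  assumes "Vector_Spaces.linear free_scale (*) \<phi>"
  shows "\<phi> p = pairing (\<lambda>g. \<phi> (Poly_Mapping.single g 1)) p"
proof -
  interpret l: Vector_Spaces.linear free_scale "(*)" \<phi> by fact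
  have p: "p = (\<Sum>g\<in>Poly_Mapping.keys p. free_scale (Poly_Mapping.lookup p g) (Poly_Mapping.single g 1))"
    by (intro poly_mapping_eqI)
      (auto simp: lookup_sum lookup_free_scale lookup_single when_def in_keys_iff if_distrib
        sum.delta cong: if_cong)
  show ?thesis by (subst p) (simp add: l.sum l.scale pairing_def)
qed

section \<open>Balanced functions and the relators of a tensor power\<close>

definition multilinear :: "('k::field \<Rightarrow> 'v \<Rightarrow> 'v) \<Rightarrow> nat \<Rightarrow> ('v::ab_group_add list \<Rightarrow> 'k) \<Rightarrow> bool" where
  "multilinear sc n G \<longleftrightarrow> (\<forall>xs ys. length xs + length ys + 1 = n \<longrightarrow>
     Vector_Spaces.linear sc (*) (\<lambda>x. G (xs @ x # ys)))"

definition balanced :: "('k::field, 'b, 'v::ab_group_add) bimodule \<Rightarrow> nat \<Rightarrow> ('v list \<Rightarrow> 'k) \<Rightarrow> bool" where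
  "balanced B n G \<longleftrightarrow> multilinear (bscale B) n G \<and>
     (\<forall>xs b x y ys. length xs + length ys + 2 = n \<longrightarrow>
        G (xs @ ract B b x # y # ys) = G (xs @ x # lact B b y # ys))"

lemma multilinearD: "multilinear sc n G \<Longrightarrow> length xs + length ys + 1 = n \<Longrightarrow>
    Vector_Spaces.linear sc (*) (\<lambda>x. G (xs @ x # ys))"
  by (auto simp: multilinear_def)

lemma balanced_multilinear: "balanced B n G \<Longrightarrow> multilinear (bscale B) n G"
  by (simp add: balanced_def)

lemma balancedD: "balanced B n G \<Longrightarrow> length xs + length ys + 2 = n \<Longrightarrow>
    G (xs @ ract B b x # y # ys) = G (xs @ x # lact B b y # ys)"
  by (auto simp: balanced_def)

text \<open>The span is formed in the free space on all words, but each relator of degree n involves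
  words of length n only, so the span stays in the free space on those.\<close>

lemma tensor_null_subspace:
  fixes B :: "('k::field, 'b, 'v::ab_group_add) bimodule"
  shows "subspace_of (free_module {us. length us = n}) (tensor_null B n)"
proof -
  let ?M = "free_module {us. length us = n} :: ('k, 'v list \<Rightarrow>\<^sub>0 'k) module"
  interpret kspace ?M by (rule kspace_free_module)
  have word: "word us \<in> carrier ?M" if "length us = n" for us
    using that by (simp add: free_module_def)
  have diff: "p - q \<in> carrier ?M" if "p \<in> carrier ?M" "q \<in> carrier ?M" for p q
    using free_module_minus[OF that] minus_closed[OF that] by simp
  have scale: "free_scale c p \<in> carrier ?M" if "p \<in> carrier ?M" for p c
    using smult_closed[OF that, of c] by (simp add: free_module_def)
  have rel: "tensor_relators B n \<subseteq> carrier ?M"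
    unfolding tensor_relators_def
    by (intro Un_least subsetI; elim CollectE exE conjE; simp only:; intro diff scale word; simp)
  have "free.subspace (carrier ?M)"
    unfolding free.subspace_def using zero_closed a_closed smult_closed
    by (auto simp: free_module_def)
  then have "tensor_null B n \<subseteq> carrier ?M"
    unfolding tensor_null_def using rel free.span_minimal by blast
  then show ?thesis
    unfolding subspace_of_def tensor_null_def
    by (auto simp: free_module_def free.span_zero free.span_add free.span_scale)
qed

text \<open>Each of the three families of relators is annihilated by one property of
  \<open>G\<close>: additivity, homogeneity, or balance across a tensor sign. The annihilated
  elements form a subspace, hence contain the span.\<close>

lemma pairing_null:
  assumes G: "balanced B n G" and p: "p \<in> tensor_null B n"
  shows "pairing G p = 0"
proof -
  have "pairing G r = 0" if "r \<in> tensor_relators B n" for r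
    using that unfolding tensor_relators_def
  proof (elim UnE CollectE exE conjE)
    fix xs x y ys
    assume r: "r = word (xs @ [x + y] @ ys) - word (xs @ [x] @ ys) - word (xs @ [y] @ ys)"
      and l: "length xs + length ys + 1 = n"
    interpret l: Vector_Spaces.linear "bscale B" "(*)" "\<lambda>x. G (xs @ x # ys)"
      using multilinearD[OF balanced_multilinear[OF G] l] .
    show ?thesis by (simp add: r pairing_diff pairing_single l.add)
  next
    fix xs c x ys
    assume r: "r = word (xs @ [bscale B c x] @ ys) - free_scale c (word (xs @ [x] @ ys))"
      and l: "length xs + length ys + 1 = n"
    interpret l: Vector_Spaces.linear "bscale B" "(*)" "\<lambda>x. G (xs @ x # ys)"
      using multilinearD[OF balanced_multilinear[OF G] l] .
    show ?thesis by (simp add: r pairing_diff pairing_scale pairing_single l.scale)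
  next
    fix xs b x y ys
    assume r: "r = word (xs @ [ract B b x, y] @ ys) - word (xs @ [x, lact B b y] @ ys)"
      and l: "length xs + length ys + 2 = n"
    show ?thesis by (simp add: r pairing_diff pairing_single balancedD[OF G l])
  qed
  then have "tensor_relators B n \<subseteq> {p. pairing G p = 0}" by blast
  moreover have "free.subspace {p. pairing G p = 0}"
    unfolding free.subspace_def by (auto simp: pairing_add pairing_scale) (simp add: pairing_def)
  ultimately show ?thesis using p free.span_minimal unfolding tensor_null_def by blast
qed

text \<open>A basis E of the relator space stays independent when p is added, so some linear
  functional is 1 at p and 0 on E. Its values on words are balanced because it kills every
  relator.\<close>

lemma pairing_separates:
  fixes B :: "('k::field, 'b, 'v::ab_group_add) bimodule"
  assumes B: "vector_space (bscale B)" and p: "p \<notin> tensor_null B n"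
  shows "\<exists>G. balanced B n G \<and> pairing G p \<noteq> 0"
proof -
  obtain E where E: "E \<subseteq> tensor_relators B n" "free.independent E"
    "tensor_relators B n \<subseteq> free.span E"
    using free.maximal_independent_subset by blast
  have span: "free.span E = tensor_null B n"
    unfolding tensor_null_def using E(1,3) by (metis free.span_mono free.span_span subset_antisym)
  have ind: "free.independent (insert p E)"
    using free.independent_insertI[of p E] p E(2) span by auto
  interpret vp: vector_space_pair "free_scale :: 'k \<Rightarrow> ('v list \<Rightarrow>\<^sub>0 'k) \<Rightarrow> _" "(*) :: 'k \<Rightarrow> 'k \<Rightarrow> 'k"
    by (intro vector_space_pair.intro vector_space_free_scale vector_space_times)
  obtain \<phi> where \<phi>: "Vector_Spaces.linear free_scale (*) \<phi>"
    "\<And>x. x \<in> insert p E \<Longrightarrow> \<phi> x = (if x = p then 1 else 0)"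
    using vp.linear_independent_extend[OF ind, of "\<lambda>x. if x = p then 1 else 0"] by blast
  interpret l: Vector_Spaces.linear free_scale "(*)" \<phi> by (rule \<phi>(1))
  \<comment> \<open>The prescribed values distinguish p from all else, so they vanish on E once p is
    known to lie outside E.\<close>
  have "p \<notin> E" using p span free.span_base by blast
  then have "E \<subseteq> {x. \<phi> x = 0}" using \<phi>(2) by auto
  moreover have "free.subspace {x. \<phi> x = 0}"
    unfolding free.subspace_def by (auto simp: l.add l.scale)
  ultimately have null: "\<phi> r = 0" if "r \<in> tensor_null B n" for r
    using free.span_minimal span that by blast
  have rel: "\<phi> r = 0" if "r \<in> tensor_relators B n" for r
    using null free.span_base that unfolding tensor_null_def by blast
  let ?G = "\<lambda>us. \<phi> (word us)"
  have "balanced B n ?G"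
    unfolding balanced_def multilinear_def Vector_Spaces.linear_iff
  proof (intro conjI allI impI B vector_space_times)
    fix xs ys :: "'v list" and x y c assume l: "length xs + length ys + 1 = n"
    have "word (xs @ [x + y] @ ys) - word (xs @ [x] @ ys) - word (xs @ [y] @ ys) \<in> tensor_relators B n"
      unfolding tensor_relators_def using l by blast
    from rel[OF this] show "?G (xs @ (x + y) # ys) = ?G (xs @ x # ys) + ?G (xs @ y # ys)"
      by (simp add: l.diff l.add algebra_simps)
    have "word (xs @ [bscale B c x] @ ys) - free_scale c (word (xs @ [x] @ ys)) \<in> tensor_relators B n"
      unfolding tensor_relators_def using l by blast
    from rel[OF this] show "?G (xs @ bscale B c x # ys) = c * ?G (xs @ x # ys)"
      by (simp add: l.diff l.scale)
  next
    fix xs ys :: "'v list" and x y b assume l: "length xs + length ys + 2 = n"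
    have "word (xs @ [ract B b x, y] @ ys) - word (xs @ [x, lact B b y] @ ys) \<in> tensor_relators B n"
      unfolding tensor_relators_def using l by blast
    from rel[OF this] show "?G (xs @ ract B b x # y # ys) = ?G (xs @ x # lact B b y # ys)"
      by (simp add: l.diff)
  qed
  moreover have "pairing ?G p \<noteq> 0"
    using \<phi>(2)[of p] linear_eq_pairing[OF \<phi>(1), of p] by simp
  ultimately show ?thesis by blast
qed

section \<open>Evaluation of functions on tensors and on Sweedler sums\<close>

lemma kspace_tensor_power: "kspace (tensor_power B n)"
  unfolding tensor_power_def
  by (intro kspace.kspace_quotient kspace_free_module tensor_null_subspace)

lemma tensor_power_cases:
  assumes "X \<in> carrier (tensor_power B n)"
  obtains p where "Poly_Mapping.keys p \<subseteq> {us. length us = n}"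
    "X = tensor_null B n +>\<^bsub>free_module {us. length us = n}\<^esub> p"
proof -
  have "carrier (tensor_power B n) = (\<lambda>p. tensor_null B n +>\<^bsub>free_module {us. length us = n}\<^esub> p) `
      {p. Poly_Mapping.keys p \<subseteq> {us. length us = n}}"
    unfolding tensor_power_def kspace.quotient_carrier[OF kspace_free_module tensor_null_subspace]
    by (simp add: free_module_def)
  then show ?thesis using assms that by auto
qed

lemma pure_tensor_closed: "length us = n \<Longrightarrow> pure_tensor B us \<in> carrier (tensor_power B n)"
  unfolding tensor_power_def pure_tensor_def
    kspace.quotient_carrier[OF kspace_free_module tensor_null_subspace]
  by (auto simp: free_module_def)

text \<open>The representative is the one that \<open>sweedler\<close> chooses. For arbitrary
  \<open>G\<close> the value depends on that choice but is one fixed finite sum; for balanced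
  \<open>G\<close> it is the functional induced on the tensor power.\<close>

definition ev :: "('g \<Rightarrow> 'k::field) \<Rightarrow> ('g \<Rightarrow>\<^sub>0 'k) set \<Rightarrow> 'k" where
  "ev G X = pairing G (SOME p. p \<in> X)"

lemma rep_in_coset:
  fixes B :: "('k::field, 'b, 'v::ab_group_add) bimodule"
  assumes p: "Poly_Mapping.keys p \<subseteq> {us. length us = n}"
  defines "X \<equiv> tensor_null B n +>\<^bsub>free_module {us. length us = n}\<^esub> p"
  shows "Poly_Mapping.keys (SOME q. q \<in> X) \<subseteq> {us. length us = n}"
    "X = tensor_null B n +>\<^bsub>free_module {us. length us = n}\<^esub> (SOME q. q \<in> X)"
proof -
  interpret kspace "free_module {us. length us = n} :: ('k, 'v list \<Rightarrow>\<^sub>0 'k) module" by (rule kspace_free_module)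
  have pc: "p \<in> carrier (free_module {us. length us = n})" using p by (simp add: free_module_def)
  then have "p \<in> X" unfolding X_def using coset_self[OF tensor_null_subspace] by blast
  then have "(SOME q. q \<in> X) \<in> X" by (rule someI)
  then show "Poly_Mapping.keys (SOME q. q \<in> X) \<subseteq> {us. length us = n}"
    "X = tensor_null B n +>\<^bsub>free_module {us. length us = n}\<^esub> (SOME q. q \<in> X)"
    using coset_mem_eq[OF tensor_null_subspace pc] unfolding X_def by (auto simp: free_module_def)
qed

lemma rep_keys:
  assumes "X \<in> carrier (tensor_power B n)" "us \<in> Poly_Mapping.keys (SOME q. q \<in> X)"
  shows "length us = n"
  using assms rep_in_coset(1) by (auto elim!: tensor_power_cases)

lemma ev_coset:
  fixes B :: "('k::field, 'b, 'v::ab_group_add) bimodule"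
  assumes G: "balanced B n G" and p: "Poly_Mapping.keys p \<subseteq> {us. length us = n}"
  shows "ev G (tensor_null B n +>\<^bsub>free_module {us. length us = n}\<^esub> p) = pairing G p"
proof -
  interpret kspace "free_module {us. length us = n} :: ('k, 'v list \<Rightarrow>\<^sub>0 'k) module" by (rule kspace_free_module)
  let ?q = "SOME q. q \<in> tensor_null B n +>\<^bsub>free_module {us. length us = n}\<^esub> p"
  note q = rep_in_coset[OF p, of B]
  have c: "p \<in> carrier (free_module {us. length us = n})" "?q \<in> carrier (free_module {us. length us = n})"
    using p q(1) by (simp_all add: free_module_def)
  have "p \<ominus>\<^bsub>free_module {us. length us = n}\<^esub> ?q \<in> tensor_null B n"
    using coset_eq_iff[OF tensor_null_subspace c] q(2) by blast
  then have "pairing G (p - ?q) = 0"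
    using pairing_null[OF G] free_module_minus[OF c] by simp
  then show ?thesis by (simp add: ev_def pairing_diff)
qed

lemma ev_pure:
  assumes "balanced B n G" "length us = n"
  shows "ev G (pure_tensor B us) = G us"
  using ev_coset[OF assms(1), of "word us"] assms(2) by (simp add: pure_tensor_def pairing_single)

lemma ev_linear:
  fixes B :: "('k::field, 'b, 'v::ab_group_add) bimodule"
  assumes G: "balanced B n G"
  shows "linear_on (tensor_power B n) (vector_module (*)) (ev G)"
proof -
  let ?M = "free_module {us. length us = n} :: ('k, 'v list \<Rightarrow>\<^sub>0 'k) module"
  interpret kspace ?M by (rule kspace_free_module)
  note ops = quotient_ops[OF tensor_null_subspace[of n B], folded tensor_power_def]
  have k: "p \<in> carrier ?M \<longleftrightarrow> Poly_Mapping.keys p \<subseteq> {us. length us = n}" for p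
    by (simp add: free_module_def)
  have ev: "ev G (tensor_null B n +>\<^bsub>?M\<^esub> p) = pairing G p" if "p \<in> carrier ?M" for p
    using ev_coset[OF G] that k by blast
  show ?thesis
    unfolding linear_on_def
  proof (intro conjI ballI allI)
    fix X Y assume "X \<in> carrier (tensor_power B n)" "Y \<in> carrier (tensor_power B n)"
    then obtain p q where "p \<in> carrier ?M" "q \<in> carrier ?M"
      "X = tensor_null B n +>\<^bsub>?M\<^esub> p" "Y = tensor_null B n +>\<^bsub>?M\<^esub> q"
      unfolding k by (elim tensor_power_cases)
    then show "ev G (X \<oplus>\<^bsub>tensor_power B n\<^esub> Y) = ev G X \<oplus>\<^bsub>vector_module (*)\<^esub> ev G Y"
      using ev[OF a_closed[of p q]]
      by (simp add: ops ev) (simp add: vector_module_def free_module_def pairing_add)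
  next
    fix c X assume "X \<in> carrier (tensor_power B n)"
    then obtain p where "p \<in> carrier ?M" "X = tensor_null B n +>\<^bsub>?M\<^esub> p"
      unfolding k by (elim tensor_power_cases)
    then show "ev G (c \<odot>\<^bsub>tensor_power B n\<^esub> X) = c \<odot>\<^bsub>vector_module (*)\<^esub> ev G X"
      using ev[OF smult_closed[of p c]]
      by (simp add: ops ev) (simp add: vector_module_def free_module_def pairing_scale)
  qed (simp add: vector_module_def)
qed

lemma ev_tensor_add:
  "balanced B n G \<Longrightarrow> X \<in> carrier (tensor_power B n) \<Longrightarrow> Y \<in> carrier (tensor_power B n) \<Longrightarrow>
     ev G (X \<oplus>\<^bsub>tensor_power B n\<^esub> Y) = ev G X + ev G Y"
  using linear_onD(2)[OF ev_linear, of B n G X Y] by (simp add: vector_module_def)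

lemma ev_tensor_smult:
  "balanced B n G \<Longrightarrow> X \<in> carrier (tensor_power B n) \<Longrightarrow>
     ev G (c \<odot>\<^bsub>tensor_power B n\<^esub> X) = c * ev G X"
  using linear_onD(3)[OF ev_linear, of B n G X c] by (simp add: vector_module_def)

text \<open>The contrapositive of \<open>pairing_separates\<close>, applied to the difference of two
  representatives.\<close>

lemma tensor_eqI:
  fixes B :: "('k::field, 'b, 'v::ab_group_add) bimodule"
  assumes B: "vector_space (bscale B)"
    and X: "X \<in> carrier (tensor_power B n)" and Y: "Y \<in> carrier (tensor_power B n)"
    and eq: "\<And>G. balanced B n G \<Longrightarrow> ev G X = ev G Y"
  shows "X = Y"
proof -
  let ?M = "free_module {us. length us = n} :: ('k, 'v list \<Rightarrow>\<^sub>0 'k) module"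
  interpret kspace ?M by (rule kspace_free_module)
  obtain p where p: "Poly_Mapping.keys p \<subseteq> {us. length us = n}" "X = tensor_null B n +>\<^bsub>?M\<^esub> p"
    using X by (rule tensor_power_cases)
  obtain q where q: "Poly_Mapping.keys q \<subseteq> {us. length us = n}" "Y = tensor_null B n +>\<^bsub>?M\<^esub> q"
    using Y by (rule tensor_power_cases)
  have c: "p \<in> carrier ?M" "q \<in> carrier ?M" using p q by (auto simp: free_module_def)
  have "pairing G (p - q) = 0" if "balanced B n G" for G
    using eq[OF that] ev_coset[OF that] p q by (simp add: pairing_diff)
  then have "p - q \<in> tensor_null B n" using pairing_separates[OF B] by blast
  then show ?thesis
    using coset_eq_iff[OF tensor_null_subspace[of n B] c] free_module_minus[OF c] p(2) q(2) by simp
qed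

text \<open>The chosen representative of an element of the n-fold power contains words of length n
  only.\<close>

lemma ev_cong:
  assumes "X \<in> carrier (tensor_power B n)" "\<And>us. length us = n \<Longrightarrow> G us = G' us"
  shows "ev G X = ev G' X"
  unfolding ev_def pairing_def using rep_keys[OF assms(1)] assms(2) by (intro sum.cong) auto

lemma ev_add: "ev (\<lambda>us. G us + G' us) X = ev G X + ev G' X"
  by (simp add: ev_def pairing_def sum.distrib algebra_simps)

lemma ev_mult_left: "ev (\<lambda>us. c * G us) X = c * ev G X"
  by (simp add: ev_def pairing_def sum_distrib_left algebra_simps)

text \<open>Both sides are the same finite double sum over the two fixed representatives, so
  \<open>G\<close> can be any function of two words.\<close>

lemma ev_swap: "ev (\<lambda>us. ev (\<lambda>vs. G us vs) Y) X = ev (\<lambda>vs. ev (\<lambda>us. G us vs) X) Y"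
  unfolding ev_def pairing_def sum_distrib_left
  by (subst sum.swap) (simp add: algebra_simps)

lemma linear_ev:
  assumes X: "X \<in> carrier (tensor_power B n)" and sc: "vector_space sc"
    and G: "\<And>us. length us = n \<Longrightarrow> Vector_Spaces.linear sc (*) (\<lambda>x. G x us)"
  shows "Vector_Spaces.linear sc (*) (\<lambda>x. ev (G x) X)"
  unfolding Vector_Spaces.linear_iff
proof (intro conjI allI sc vector_space_times)
  fix x y
  have "ev (G (x + y)) X = ev (\<lambda>us. G x us + G y us) X"
    using G[unfolded Vector_Spaces.linear_iff] by (intro ev_cong[OF X]) auto
  then show "ev (G (x + y)) X = ev (G x) X + ev (G y) X" by (simp add: ev_add)
next
  fix c x
  have "ev (G (sc c x)) X = ev (\<lambda>us. c * G x us) X"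
    using G[unfolded Vector_Spaces.linear_iff] by (intro ev_cong[OF X]) auto
  then show "ev (G (sc c x)) X = c * ev (G x) X" by (simp add: ev_mult_left)
qed

lemma sweedler_closed:
  assumes "kspace M" "X \<in> carrier (tensor_power B n)" "\<And>us. length us = n \<Longrightarrow> f us \<in> carrier M"
  shows "sweedler M f X \<in> carrier M"
proof -
  interpret kspace M by fact
  show ?thesis unfolding sweedler_def Let_def
    using rep_keys[OF assms(2)] assms(3) by (intro finsum_closed) (auto intro: smult_closed)
qed

text \<open>\<open>sweedler\<close> and \<open>ev\<close> sum over the same representative, so a
  linear functional passes inside the sum for any family \<open>f\<close> with values in the
  space.\<close>

lemma linear_on_sweedler:
  assumes "kspace M" "linear_on M (vector_module (*)) \<phi>"
    and X: "X \<in> carrier (tensor_power B n)" and f: "\<And>us. length us = n \<Longrightarrow> f us \<in> carrier M"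
  shows "\<phi> (sweedler M f X) = ev (\<lambda>us. \<phi> (f us)) X"
proof -
  interpret kspace M by fact
  note ks = kspace_vector_module[OF vector_space_times]
  have "\<phi> (sweedler M f X) = (\<Oplus>\<^bsub>vector_module (*)\<^esub>us\<in>Poly_Mapping.keys (SOME p. p \<in> X).
      \<phi> (Poly_Mapping.lookup (SOME p. p \<in> X) us \<odot>\<^bsub>M\<^esub> f us))"
    unfolding sweedler_def Let_def using rep_keys[OF X] f
    by (intro linear_on_finsum assms ks) (auto intro: smult_closed)
  also have "\<dots> = (\<Sum>us\<in>Poly_Mapping.keys (SOME p. p \<in> X).
      \<phi> (Poly_Mapping.lookup (SOME p. p \<in> X) us \<odot>\<^bsub>M\<^esub> f us))"
    by (simp add: finsum_vector_module vector_space_times)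
  also have "\<dots> = ev (\<lambda>us. \<phi> (f us)) X"
    unfolding ev_def pairing_def using rep_keys[OF X] f linear_onD(3)[OF assms(2)]
    by (intro sum.cong) (auto simp: vector_module_def)
  finally show ?thesis .
qed

lemma ev_sweedler:
  assumes "balanced B' m G" "X \<in> carrier (tensor_power B n)"
    "\<And>us. length us = n \<Longrightarrow> f us \<in> carrier (tensor_power B' m)"
  shows "ev G (sweedler (tensor_power B' m) f X) = ev (\<lambda>us. ev G (f us)) X"
  by (rule linear_on_sweedler[OF kspace_tensor_power ev_linear assms(2)]) (use assms in auto)

lemma linear_sweedler:
  assumes "Vector_Spaces.linear sc (*) \<phi>" "X \<in> carrier (tensor_power B n)"
  shows "\<phi> (sweedler (vector_module sc) f X) = ev (\<lambda>us. \<phi> (f us)) X"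
  using assms(1)
  by (intro linear_on_sweedler[OF kspace_vector_module _ assms(2)])
    (auto simp: Vector_Spaces.linear_iff linear_on_def vector_module_def)

text \<open>The hypothesis \<open>bal\<close> says that \<open>f\<close> respects the relators, seen
  through test functions. Linearity of the Sweedler map then comes from linearity of
  \<open>ev\<close> at a balanced function.\<close>

lemma linear_on_sweedler_tensor:
  assumes B': "vector_space (bscale B')"
    and f: "\<And>us. length us = n \<Longrightarrow> f us \<in> carrier (tensor_power B' m)"
    and bal: "\<And>G. balanced B' m G \<Longrightarrow> balanced B n (\<lambda>us. ev G (f us))"
  shows "linear_on (tensor_power B n) (tensor_power B' m) (sweedler (tensor_power B' m) f)"
proof -
  interpret T: kspace "tensor_power B n" by (rule kspace_tensor_power)
  interpret T': kspace "tensor_power B' m" by (rule kspace_tensor_power)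
  have cl: "sweedler (tensor_power B' m) f X \<in> carrier (tensor_power B' m)"
    if "X \<in> carrier (tensor_power B n)" for X
    using sweedler_closed[OF kspace_tensor_power that] f by blast
  have evs: "ev G (sweedler (tensor_power B' m) f X) = ev (\<lambda>us. ev G (f us)) X"
    if "balanced B' m G" "X \<in> carrier (tensor_power B n)" for G X
    using ev_sweedler[OF that] f by blast
  show ?thesis
    unfolding linear_on_def
  proof (intro conjI ballI allI funcsetI)
    fix X Y assume "X \<in> carrier (tensor_power B n)" "Y \<in> carrier (tensor_power B n)"
    then show "sweedler (tensor_power B' m) f (X \<oplus>\<^bsub>tensor_power B n\<^esub> Y) =
        sweedler (tensor_power B' m) f X \<oplus>\<^bsub>tensor_power B' m\<^esub> sweedler (tensor_power B' m) f Y"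
      by (intro tensor_eqI[OF B', of _ m] cl T.a_closed T'.a_closed)
        (simp_all add: evs ev_tensor_add bal cl T.a_closed)
  next
    fix c X assume "X \<in> carrier (tensor_power B n)"
    then show "sweedler (tensor_power B' m) f (c \<odot>\<^bsub>tensor_power B n\<^esub> X) =
        c \<odot>\<^bsub>tensor_power B' m\<^esub> sweedler (tensor_power B' m) f X"
      by (intro tensor_eqI[OF B', of _ m] cl T.smult_closed T'.smult_closed)
        (simp_all add: evs ev_tensor_smult bal cl T.smult_closed)
  qed (use cl in auto)
qed

section \<open>Coalgebras in bimodules\<close>

lemma multilinear_Suc:
  fixes G :: "'v::ab_group_add list \<Rightarrow> 'k::field"
  shows "multilinear sc (Suc n) G \<longleftrightarrow>
     (\<forall>vs. length vs = n \<longrightarrow> Vector_Spaces.linear sc (*) (\<lambda>x. G (x # vs))) \<and>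
     (\<forall>x. multilinear sc n (\<lambda>vs. G (x # vs)))"
proof (intro iffI conjI allI impI)
  assume G: "multilinear sc (Suc n) G"
  show "Vector_Spaces.linear sc (*) (\<lambda>x. G (x # vs))" if "length vs = n" for vs
    using multilinearD[OF G, of "[]" vs] that by simp
  show "multilinear sc n (\<lambda>vs. G (x # vs))" for x
    unfolding multilinear_def using multilinearD[OF G, of "x # _"] by auto
next
  assume G: "(\<forall>vs. length vs = n \<longrightarrow> Vector_Spaces.linear sc (*) (\<lambda>x. G (x # vs))) \<and>
     (\<forall>x. multilinear sc n (\<lambda>vs. G (x # vs)))"
  show "multilinear sc (Suc n) G"
    unfolding multilinear_def
  proof (intro allI impI)
    fix xs ys :: "'v list" assume l: "length xs + length ys + 1 = Suc n"
    show "Vector_Spaces.linear sc (*) (\<lambda>x. G (xs @ x # ys))"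
    proof (cases xs)
      case Nil
      then show ?thesis using G l by simp
    next
      case (Cons x xs')
      then show ?thesis using conjunct2[OF G] l
        by (auto simp: multilinear_def)
    qed
  qed
qed

text \<open>Balance across the first tensor sign is separated from balance within the tail.
  Inductions over lists use balance in this form.\<close>

lemma balanced_Suc:
  "balanced B (Suc n) G \<longleftrightarrow>
     (\<forall>vs. length vs = n \<longrightarrow> Vector_Spaces.linear (bscale B) (*) (\<lambda>x. G (x # vs))) \<and>
     (\<forall>x. balanced B n (\<lambda>vs. G (x # vs))) \<and>
     (\<forall>b x y vs. Suc (length vs) = n \<longrightarrow> G (ract B b x # y # vs) = G (x # lact B b y # vs))"
  (is "?L \<longleftrightarrow> ?R")
proof
  assume G: ?L
  have "balanced B n (\<lambda>vs. G (x # vs))" for x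
    using G[unfolded balanced_def multilinear_Suc] balancedD[OF G, of "x # _"]
    by (auto simp: balanced_def)
  then show ?R
    using G[unfolded balanced_def multilinear_Suc] balancedD[OF G, of "[]"] by auto
next
  assume G: ?R
  then have "multilinear (bscale B) (Suc n) G"
    by (auto simp: multilinear_Suc balanced_def)
  moreover have "G (xs @ ract B b x # y # ys) = G (xs @ x # lact B b y # ys)"
    if "length xs + length ys + 2 = Suc n" for xs b x y ys
  proof (cases xs)
    case Nil
    then show ?thesis using G that by simp
  next
    case (Cons z xs')
    then have "balanced B n (\<lambda>vs. G (z # vs))" "length xs' + length ys + 2 = n" using G that by auto
    from balancedD[OF this] show ?thesis using Cons by simp
  qed
  ultimately show ?L by (simp add: balanced_def)
qed

lemma balanced_SucI:
  assumes "\<And>vs. length vs = n \<Longrightarrow> Vector_Spaces.linear (bscale B) (*) (\<lambda>x. G (x # vs))"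
    and "\<And>x. balanced B n (\<lambda>vs. G (x # vs))"
    and "\<And>b x y vs. Suc (length vs) = n \<Longrightarrow> G (ract B b x # y # vs) = G (x # lact B b y # vs)"
  shows "balanced B (Suc n) G"
  using assms by (simp add: balanced_Suc)

lemma balanced_head:
  assumes "balanced B (Suc n) G"
  shows "length vs = n \<Longrightarrow> Vector_Spaces.linear (bscale B) (*) (\<lambda>x. G (x # vs))"
    "balanced B n (\<lambda>vs. G (x # vs))"
    "Suc (length vs) = n \<Longrightarrow> G (ract B b x # y # vs) = G (x # lact B b y # vs)"
  using assms by (auto simp: balanced_Suc)

lemma balanced_0 [simp]: "balanced B 0 G"
  by (simp add: balanced_def multilinear_def)

lemma balanced_cong:
  assumes "balanced B n G" "\<And>us. length us = n \<Longrightarrow> G' us = G us"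
  shows "balanced B n G'"
proof -
  have "(\<lambda>x. G' (xs @ x # ys)) = (\<lambda>x. G (xs @ x # ys))" if "length xs + length ys + 1 = n" for xs ys
    using that assms(2) by auto
  then show ?thesis using assms by (auto simp: balanced_def multilinear_def)
qed

text \<open>The curried form of a balanced function of two factors, against which a single
  comultiplication is tested.\<close>

definition bibalanced :: "('k::field, 'b, 'v::ab_group_add) bimodule \<Rightarrow> ('v \<Rightarrow> 'v \<Rightarrow> 'k) \<Rightarrow> bool" where
  "bibalanced B g \<longleftrightarrow> (\<forall>y. Vector_Spaces.linear (bscale B) (*) (\<lambda>x. g x y)) \<and>
     (\<forall>x. Vector_Spaces.linear (bscale B) (*) (g x)) \<and>
     (\<forall>b x y. g (ract B b x) y = g x (lact B b y))"

lemma bibalancedI: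
  assumes "\<And>y. Vector_Spaces.linear (bscale B) (*) (\<lambda>x. g x y)"
    "\<And>x. Vector_Spaces.linear (bscale B) (*) (\<lambda>y. g x y)"
    "\<And>b x y. g (ract B b x) y = g x (lact B b y)"
  shows "bibalanced B g"
  using assms by (simp add: bibalanced_def)

lemma balanced_2: "balanced B 2 G \<longleftrightarrow> bibalanced B (\<lambda>x y. G [x, y])"
  by (auto simp: numeral_2_eq_2 balanced_Suc bibalanced_def length_Suc_conv)

lemma linear_compose_functional:
  "Vector_Spaces.linear s (*) f \<Longrightarrow> Vector_Spaces.linear s' s g \<Longrightarrow> Vector_Spaces.linear s' (*) (\<lambda>x. f (g x))"
  by (auto simp: Vector_Spaces.linear_iff)

text \<open>A common frame for U over its base algebra and for C over k, so that iterated
  comultiplications are treated once. Compatibility of \<open>D\<close> with the actions is stated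
  against balanced functions, the form in which both instances supply it.\<close>

locale coring =
  fixes B :: "('k::field, 'b, 'v::ab_group_add) bimodule"
    and D :: "'v \<Rightarrow> ('v list \<Rightarrow>\<^sub>0 'k) set"
  assumes vs: "vector_space (bscale B)"
    and lact_ract: "lact B b (ract B c v) = ract B c (lact B b v)"
    and lact_linear: "Vector_Spaces.linear (bscale B) (bscale B) (lact B b)"
    and D_linear: "linear_on (vector_module (bscale B)) (tensor_power B 2) D"
    and D_lact: "balanced B 2 G \<Longrightarrow>
      ev G (D (lact B b v)) = ev (\<lambda>vs. G [lact B b (vs ! 0), vs ! 1]) (D v)"
    and D_ract: "balanced B 2 G \<Longrightarrow>
      ev G (D (ract B b v)) = ev (\<lambda>vs. G [vs ! 0, ract B b (vs ! 1)]) (D v)"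
    and coassoc: "coassociative B D"
begin

lemma D_closed: "D v \<in> carrier (tensor_power B 2)"
  using linear_onD(1)[OF D_linear] by (simp add: vector_module_def)

definition sw :: "('v \<Rightarrow> 'v \<Rightarrow> 'k) \<Rightarrow> 'v \<Rightarrow> 'k" where
  "sw g v = ev (\<lambda>vs. g (vs ! 0) (vs ! 1)) (D v)"

lemma ev_D: "ev G (D v) = sw (\<lambda>p q. G [p, q]) v"
  unfolding sw_def by (rule ev_cong[OF D_closed]) (auto simp: numeral_2_eq_2 length_Suc_conv)

lemma bibalanced_balanced: "bibalanced B g \<Longrightarrow> balanced B 2 (\<lambda>vs. g (vs ! 0) (vs ! 1))"
  by (simp add: balanced_2)

lemma sw_linear: "bibalanced B g \<Longrightarrow> Vector_Spaces.linear (bscale B) (*) (\<lambda>v. sw g v)"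
  using linear_on_compose[OF D_linear ev_linear[OF bibalanced_balanced]] vs vector_space_times
  by (auto simp: linear_on_def vector_module_def sw_def Vector_Spaces.linear_iff)

lemma sw_lact: "bibalanced B g \<Longrightarrow> sw g (lact B b v) = sw (\<lambda>p q. g (lact B b p) q) v"
  using D_lact[OF bibalanced_balanced, of g b v] by (simp add: sw_def)

lemma sw_ract: "bibalanced B g \<Longrightarrow> sw g (ract B b v) = sw (\<lambda>p q. g p (ract B b q)) v"
  using D_ract[OF bibalanced_balanced, of g b v] by (simp add: sw_def)

text \<open>Only a parameter of \<open>g\<close> varies and the representative of \<open>D v\<close>
  stays fixed, in contrast to \<open>sw_linear\<close>, where v itself varies and \<open>g\<close>
  has to be balanced.\<close>

lemma linear_sw:
  assumes "\<And>p q. Vector_Spaces.linear sc (*) (\<lambda>x. g x p q)"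
  shows "Vector_Spaces.linear sc (*) (\<lambda>x. sw (g x) v)"
  unfolding sw_def using assms by (intro linear_ev[OF D_closed]) (auto simp: Vector_Spaces.linear_iff)

lemma sw_ev: "sw (\<lambda>p q. ev (\<lambda>us. G p q us) X) v = ev (\<lambda>us. sw (\<lambda>p q. G p q us) v) X"
  unfolding sw_def by (rule ev_swap)

text \<open>The transpose of \<open>comult_at\<close>, as \<open>ev_comult_at\<close> confirms:
  functions of n + 1 factors are pulled back to functions of n factors.\<close>

definition expand :: "nat \<Rightarrow> ('v list \<Rightarrow> 'k) \<Rightarrow> 'v list \<Rightarrow> 'k" where
  "expand i G us = sw (\<lambda>p q. G (take i us @ p # q # drop (Suc i) us)) (us ! i)"

lemma expand_0: "expand 0 G (u # us) = sw (\<lambda>p q. G (p # q # us)) u"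
  by (simp add: expand_def)

lemma expand_Suc: "expand (Suc i) G (u # us) = expand i (\<lambda>vs. G (u # vs)) us"
  by (simp add: expand_def)

lemma bibalanced_head:
  assumes "balanced B (Suc (Suc n)) G" "length vs = n"
  shows "bibalanced B (\<lambda>p q. G (p # q # vs))"
proof (rule bibalancedI)
  show "Vector_Spaces.linear (bscale B) (*) (\<lambda>x. G (x # y # vs))" for y
    using balanced_head(1)[OF assms(1), of "y # vs"] assms(2) by simp
  show "Vector_Spaces.linear (bscale B) (*) (\<lambda>y. G (x # y # vs))" for x
    using balanced_head(1)[OF balanced_head(2)[OF assms(1)]] assms(2) by simp
  show "G (ract B b x # y # vs) = G (x # lact B b y # vs)" for b x y
    using balanced_head(3)[OF assms(1)] assms(2) by simp
qed

lemma balanced_sw: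
  fixes B' :: "('k, 'c, 'w::ab_group_add) bimodule"
  assumes "\<And>p q. balanced B' n (G p q)"
  shows "balanced B' n (\<lambda>us. sw (\<lambda>p q. G p q us) v)"
  unfolding balanced_def multilinear_def
proof (intro conjI allI impI)
  fix xs ys :: "'w list" assume l: "length xs + length ys + 1 = n"
  show "Vector_Spaces.linear (bscale B') (*) (\<lambda>x. sw (\<lambda>p q. G p q (xs @ x # ys)) v)"
    by (intro linear_sw multilinearD[OF balanced_multilinear[OF assms] l])
next
  fix xs ys :: "'w list" and b x y assume l: "length xs + length ys + 2 = n"
  show "sw (\<lambda>p q. G p q (xs @ ract B' b x # y # ys)) v = sw (\<lambda>p q. G p q (xs @ x # lact B' b y # ys)) v"
    by (simp add: balancedD[OF assms l])
qed

text \<open>\<open>D\<close> is a bimodule map: a right action on v lands on the second Sweedler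
  factor, next to the right neighbour of v, and a left action on the first one, next to the left
  neighbour. There \<open>G\<close> itself is balanced.\<close>

lemma balanced_expand: "balanced B (Suc n) G \<Longrightarrow> i < n \<Longrightarrow> balanced B n (expand i G)"
proof (induction i arbitrary: n G)
  case 0
  then obtain m where n: "n = Suc m" by (cases n) auto
  note G = 0(1)[unfolded n]
  show ?case unfolding n
  proof (rule balanced_SucI)
    show "Vector_Spaces.linear (bscale B) (*) (\<lambda>x. expand 0 G (x # vs))" if "length vs = m" for vs
      unfolding expand_0 by (rule sw_linear[OF bibalanced_head[OF G that]])
    show "balanced B m (\<lambda>vs. expand 0 G (x # vs))" for x
      unfolding expand_0 by (intro balanced_sw balanced_head(2)) (rule G)
    show "expand 0 G (ract B b x # y # vs) = expand 0 G (x # lact B b y # vs)"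
      if l: "Suc (length vs) = m" for b x y vs
    proof -
      have l': "length (y # vs) = m" using l by simp
      have "G (p # ract B b q # y # vs) = G (p # q # lact B b y # vs)" for p q
        using balanced_head(3)[OF balanced_head(2)[OF G]] l by simp
      then show ?thesis unfolding expand_0 sw_ract[OF bibalanced_head[OF G l']] by simp
    qed
  qed
next
  case (Suc i)
  then obtain m where n: "n = Suc m" and i: "i < m" by (cases n) auto
  note G = Suc.prems(1)[unfolded n]
  show ?case unfolding n
  proof (rule balanced_SucI)
    show "Vector_Spaces.linear (bscale B) (*) (\<lambda>x. expand (Suc i) G (x # vs))" if "length vs = m" for vs
    proof -
      have "Vector_Spaces.linear (bscale B) (*) (\<lambda>x. G (x # take i vs @ p # q # drop (Suc i) vs))" for p q
        using that i by (intro balanced_head(1)[OF G]) simp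
      then show ?thesis unfolding expand_Suc unfolding expand_def by (rule linear_sw)
    qed
    show "balanced B m (\<lambda>vs. expand (Suc i) G (x # vs))" for x
      unfolding expand_Suc using Suc.IH[OF balanced_head(2)[OF G] i] by simp
    show "expand (Suc i) G (ract B b x # y # vs) = expand (Suc i) G (x # lact B b y # vs)"
      if l: "Suc (length vs) = m" for b x y vs
    \<comment> \<open>For i = 0 the factor y is the one being split, and \<open>sw_lact\<close> puts
      the action on its first half; for larger i both displayed factors stay whole.\<close>
    proof (cases i)
      case 0
      have "length vs = m - 1" "m = Suc (m - 1)" using l by auto
      then have "bibalanced B (\<lambda>p q. G (x # p # q # vs))"
        using bibalanced_head[of "m - 1" "\<lambda>ws. G (x # ws)" vs] balanced_head(2)[OF G] by simp
      moreover have "G (ract B b x # p # q # vs) = G (x # lact B b p # q # vs)" for p q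
        using balanced_head(3)[OF G] l by simp
      ultimately show ?thesis by (simp add: 0 expand_Suc expand_0 sw_lact)
    next
      case (Suc j)
      have "G (ract B b x # y # ws) = G (x # lact B b y # ws)" if "length ws = m" for ws
        using balanced_head(3)[OF G] that by simp
      then show ?thesis using i l by (simp add: Suc expand_Suc expand_def)
    qed
  qed
qed

lemma comult_at_closed:
  assumes "length us = n" "i < n" shows "comult_at B D i us \<in> carrier (tensor_power B (Suc n))"
  unfolding comult_at_def using assms
  by (auto intro!: sweedler_closed[OF kspace_tensor_power D_closed] pure_tensor_closed)

lemma ev_comult_at:
  assumes "balanced B (Suc n) G" "length us = n" "i < n"
  shows "ev G (comult_at B D i us) = expand i G us"
proof -
  have "ev G (comult_at B D i us) =
      ev (\<lambda>vs. ev G (pure_tensor B (take i us @ vs @ drop (Suc i) us))) (D (us ! i))"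
    unfolding comult_at_def assms(2) using assms
    by (intro ev_sweedler[OF assms(1) D_closed] pure_tensor_closed) auto
  also have "\<dots> = ev (\<lambda>vs. G (take i us @ vs @ drop (Suc i) us)) (D (us ! i))"
    using assms by (intro ev_cong[OF D_closed] ev_pure[OF assms(1)]) auto
  finally show ?thesis by (simp add: ev_D expand_def)
qed

text \<open>The hypotheses make \<open>g\<close> a balanced function of three factors, which may be
  evaluated on both sides of the coassociativity equation in the threefold tensor power.\<close>

lemma sw_coassoc:
  assumes "\<And>y z. Vector_Spaces.linear (bscale B) (*) (\<lambda>x. g x y z)"
    "\<And>x z. Vector_Spaces.linear (bscale B) (*) (\<lambda>y. g x y z)"
    "\<And>x y. Vector_Spaces.linear (bscale B) (*) (\<lambda>z. g x y z)"
    "\<And>b x y z. g (ract B b x) y z = g x (lact B b y) z"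
    "\<And>b x y z. g x (ract B b y) z = g x y (lact B b z)"
  shows "sw (\<lambda>p q. sw (\<lambda>r s. g r s q) p) v = sw (\<lambda>p q. sw (\<lambda>r s. g p r s) q) v"
proof -
  define G where "G vs = g (vs ! 0) (vs ! 1) (vs ! 2)" for vs
  have "balanced B (Suc (Suc (Suc 0))) G"
    using assms by (auto intro!: balanced_SucI simp: length_Suc_conv G_def)
  then have G: "balanced B 3 G" by (simp add: numeral_3_eq_3)
  have *: "ev G (sweedler (tensor_power B 3) (comult_at B D i) (D v)) = sw (\<lambda>p q. expand i G [p, q]) v"
    if "i < 2" for i
  proof -
    have "ev G (sweedler (tensor_power B 3) (comult_at B D i) (D v)) = ev (\<lambda>us. ev G (comult_at B D i us)) (D v)"
      using comult_at_closed[of _ 2 i] that by (intro ev_sweedler[OF G D_closed]) (simp add: numeral_3_eq_3)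
    also have "\<dots> = ev (expand i G) (D v)"
      using ev_comult_at[of 2 G _ i] G that by (intro ev_cong[OF D_closed]) (simp add: numeral_3_eq_3)
    finally show ?thesis by (simp add: ev_D)
  qed
  have "sw (\<lambda>p q. expand 0 G [p, q]) v = sw (\<lambda>p q. expand 1 G [p, q]) v"
    using coassoc *[of 0] *[of 1] unfolding coassociative_def by simp
  then show ?thesis by (simp add: expand_def G_def)
qed

section \<open>Iterated comultiplications tested on functions\<close>

lemma iter_closed: "iter_comult B D k v \<in> carrier (tensor_power B (Suc k))"
proof (induction k)
  case 0
  then show ?case by (simp add: pure_tensor_closed)
next
  case (Suc k)
  then show ?case
    by (auto intro!: sweedler_closed[OF kspace_tensor_power Suc] comult_at_closed)
qed

definition it :: "nat \<Rightarrow> ('v list \<Rightarrow> 'k) \<Rightarrow> 'v \<Rightarrow> 'k" where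
  "it k G v = ev G (iter_comult B D k v)"

lemma it_cong: "(\<And>us. length us = Suc k \<Longrightarrow> G us = G' us) \<Longrightarrow> it k G v = it k G' v"
  unfolding it_def by (rule ev_cong[OF iter_closed])

lemma it_0: "balanced B 1 G \<Longrightarrow> it 0 G v = G [v]"
  by (simp add: it_def ev_pure)

lemma it_Suc:
  assumes G: "balanced B (Suc (Suc k)) G" shows "it (Suc k) G v = it k (expand 0 G) v"
proof -
  have "it (Suc k) G v = ev (\<lambda>us. ev G (comult_at B D 0 us)) (iter_comult B D k v)"
    using G by (auto simp: it_def intro!: ev_sweedler[OF _ iter_closed] comult_at_closed)
  also have "\<dots> = it k (expand 0 G) v"
    unfolding it_def by (intro ev_cong[OF iter_closed] ev_comult_at[OF G]) auto
  finally show ?thesis .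
qed

lemma it_linear: "balanced B (Suc k) G \<Longrightarrow> Vector_Spaces.linear (bscale B) (*) (\<lambda>v. it k G v)"
proof (induction k arbitrary: G)
  case 0
  then show ?case using balanced_head(1)[of B 0 G "[]"] by (simp add: it_0)
next
  case (Suc k)
  then show ?case using Suc.IH[OF balanced_expand[OF Suc.prems]] by (simp add: it_Suc)
qed

lemma linear_it:
  assumes "vector_space sc" "\<And>us. length us = Suc k \<Longrightarrow> Vector_Spaces.linear sc (*) (\<lambda>x. G x us)"
  shows "Vector_Spaces.linear sc (*) (\<lambda>x. it k (G x) v)"
  unfolding it_def by (intro linear_ev[OF iter_closed] assms)

lemma balanced_lact_head:
  assumes "balanced B (Suc n) G"
  shows "balanced B (Suc n) (\<lambda>us. G (lact B b (hd us) # tl us))"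
  using balanced_head[OF assms]
  by (auto intro!: balanced_SucI linear_compose_functional[OF _ lact_linear] simp: lact_ract)

text \<open>The iteration always splits the first factor, and a left action on a factor lands on its
  first half, so the action stays in front throughout.\<close>

lemma it_lact: "balanced B (Suc k) G \<Longrightarrow>
    it k G (lact B b v) = it k (\<lambda>us. G (lact B b (hd us) # tl us)) v"
proof (induction k arbitrary: G)
  case 0
  then show ?case using balanced_lact_head[OF 0] by (simp add: it_0)
next
  case (Suc k)
  have "it (Suc k) G (lact B b v) = it k (\<lambda>us. expand 0 G (lact B b (hd us) # tl us)) v"
    by (simp add: it_Suc[OF Suc.prems] Suc.IH[OF balanced_expand[OF Suc.prems]])
  also have "\<dots> = it k (expand 0 (\<lambda>us. G (lact B b (hd us) # tl us))) v"
    by (intro it_cong)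
      (auto simp: expand_0 length_Suc_conv intro!: sw_lact bibalanced_head[OF Suc.prems])
  also have "\<dots> = it (Suc k) (\<lambda>us. G (lact B b (hd us) # tl us)) v"
    by (simp add: it_Suc balanced_lact_head[OF Suc.prems])
  finally show ?case .
qed

text \<open>For the balance between p and q, \<open>G\<close> moves b onto the first of the factors
  that come from q, and \<open>it_lact\<close> collects it into q.\<close>

lemma bibalanced_it:
  assumes "balanced B (Suc (Suc k)) G"
  shows "bibalanced B (\<lambda>p q. it k (\<lambda>us. G (p # us)) q)"
proof (rule bibalancedI)
  fix b x y
  have "it k (\<lambda>us. G (ract B b x # us)) y = it k (\<lambda>us. G (x # lact B b (hd us) # tl us)) y"
    using balanced_head(3)[OF assms] by (intro it_cong) (auto simp: length_Suc_conv)
  then show "it k (\<lambda>us. G (ract B b x # us)) y = it k (\<lambda>us. G (x # us)) (lact B b y)"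
    by (simp add: it_lact[OF balanced_head(2)[OF assms]])
  show "Vector_Spaces.linear (bscale B) (*) (\<lambda>y. it k (\<lambda>us. G (x # us)) y)"
    by (rule it_linear[OF balanced_head(2)[OF assms]])
qed (intro linear_it vs balanced_head(1)[OF assms])

text \<open>\<open>iter_comult\<close> splits the first factor again and again. Coassociativity
  regroups the factors after the first into an iterated comultiplication of the second half, which
  is what inductions from the front of a list require.\<close>

lemma it_Cons:
  "balanced B (Suc (Suc k)) G \<Longrightarrow> it (Suc k) G v = sw (\<lambda>p q. it k (\<lambda>us. G (p # us)) q) v"
proof (induction k arbitrary: G v)
  case 0
  have "balanced B 1 (expand 0 G)" using balanced_expand[OF 0] by simp
  moreover have "balanced B 1 (\<lambda>us. G (p # us))" for p using balanced_head(2)[OF 0] by simp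
  ultimately show ?case by (simp add: it_Suc[OF 0] it_0 expand_0)
next
  case (Suc k)
  note G = Suc.prems
  have G2: "balanced B (Suc k) (\<lambda>us. G (c # d # us))" for c d
    using balanced_head(2)[OF balanced_head(2)[OF G]] .
  have "it (Suc (Suc k)) G v = it (Suc k) (expand 0 G) v" by (rule it_Suc[OF G])
  also have "\<dots> = sw (\<lambda>p q. it k (\<lambda>us. sw (\<lambda>c d. G (c # d # us)) p) q) v"
    by (simp add: Suc.IH[OF balanced_expand[OF G]] expand_0)
  \<comment> \<open>The inner sum belongs to p and does not involve q, so it moves out of the
    iterated sum over q.\<close>
  also have "\<dots> = sw (\<lambda>p q. sw (\<lambda>c d. it k (\<lambda>us. G (c # d # us)) q) p) v"
    by (simp add: it_def sw_ev)
  also have "\<dots> = sw (\<lambda>p q. sw (\<lambda>c d. it k (\<lambda>us. G (p # c # us)) d) q) v"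
  proof (rule sw_coassoc)
    have b: "bibalanced B (\<lambda>y z. it k (\<lambda>us. G (x # y # us)) z)" for x
      using bibalanced_it[OF balanced_head(2)[OF G]] .
    show "Vector_Spaces.linear (bscale B) (*) (\<lambda>x. it k (\<lambda>us. G (x # y # us)) z)" for y z
      by (intro linear_it vs balanced_head(1)[OF G]) simp
    show "Vector_Spaces.linear (bscale B) (*) (\<lambda>y. it k (\<lambda>us. G (x # y # us)) z)" for x z
      using b by (simp add: bibalanced_def)
    show "Vector_Spaces.linear (bscale B) (*) (\<lambda>z. it k (\<lambda>us. G (x # y # us)) z)" for x y
      by (intro it_linear G2)
    show "it k (\<lambda>us. G (ract B b x # y # us)) z = it k (\<lambda>us. G (x # lact B b y # us)) z" for b x y z
      by (intro it_cong balanced_head(3)[OF G]) simp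
    show "it k (\<lambda>us. G (x # ract B c y # us)) z = it k (\<lambda>us. G (x # y # us)) (lact B c z)" for c x y z
      using b by (simp add: bibalanced_def)
  qed
  also have "\<dots> = sw (\<lambda>p q. it (Suc k) (\<lambda>us. G (p # us)) q) v"
    by (simp add: Suc.IH[OF balanced_head(2)[OF G]])
  finally show ?case .
qed

end

section \<open>Left bialgebroids and Hopf algebroids\<close>

lemma bimodule_ubimodule [simp]: "bscale (ubimodule H) = uscale H"
  "lact (ubimodule H) a u = src H a * u" "ract (ubimodule H) a u = tgt H a * u"
  by (simp_all add: ubimodule_def)

lemma (in k_algebra) linear_times:
  "Vector_Spaces.linear scale scale (\<lambda>x. a * x)" "Vector_Spaces.linear scale scale (\<lambda>x. x * a)"
  unfolding Vector_Spaces.linear_iff using vector_space_axioms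
  by (auto simp: scale_mult_left scale_mult_right algebra_simps)

text \<open>\<open>comult_bimodule\<close> handles both actions at once; setting one of the two base
  elements to 1 separates them.\<close>

sublocale left_bialgebroid \<subseteq> U: coring "ubimodule H" "comult H"
proof -
  interpret alg: k_algebra "uscale H" by (rule algebra_U)
  have cl: "comult H u \<in> carrier (utensor H 2)" for u
    using linear_onD(1)[OF comult_linear] by (simp add: vector_module_def)
  have *: "ev G (comult H (src H a * tgt H b * u)) =
      ev (\<lambda>vs. G [src H a * vs ! 0, tgt H b * vs ! 1]) (comult H u)"
    if "balanced (ubimodule H) 2 G" for G a b u
  proof -
    have "ev G (comult H (src H a * tgt H b * u)) =
        ev (\<lambda>vs. ev G (upure H [src H a * vs ! 0, tgt H b * vs ! 1])) (comult H u)"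
      unfolding comult_bimodule by (intro ev_sweedler[OF that cl] pure_tensor_closed) simp
    then show ?thesis by (simp add: ev_pure[OF that])
  qed
  show "coring (ubimodule H) (comult H)"
  proof (rule coring.intro)
    show "vector_space (bscale (ubimodule H))" by (simp add: alg.vector_space_axioms)
    show "lact (ubimodule H) b (ract (ubimodule H) c v) = ract (ubimodule H) c (lact (ubimodule H) b v)" for b c v
      by simp (metis src_tgt_commute mult.assoc)
    show "Vector_Spaces.linear (bscale (ubimodule H)) (bscale (ubimodule H)) (lact (ubimodule H) b)" for b
      using alg.linear_times(1)[of "src H b"] by (simp add: ubimodule_def)
    show "linear_on (vector_module (bscale (ubimodule H))) (utensor H 2) (comult H)"
      by (simp add: comult_linear)
    show "coassociative (ubimodule H) (comult H)" by (rule coassoc)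
    show "ev G (comult H (lact (ubimodule H) b v)) = ev (\<lambda>vs. G [lact (ubimodule H) b (vs ! 0), vs ! 1]) (comult H v)"
      if "balanced (ubimodule H) 2 G" for G b v
      using *[OF that, of b 1 v] by (simp add: tgt_one)
    show "ev G (comult H (ract (ubimodule H) b v)) = ev (\<lambda>vs. G [vs ! 0, ract (ubimodule H) b (vs ! 1)]) (comult H v)"
      if "balanced (ubimodule H) 2 G" for G b v
      using *[OF that, of 1 b v] by (simp add: src_one)
  qed
qed

context left_bialgebroid
begin

lemma linear_mult_left: "Vector_Spaces.linear (uscale H) (uscale H) (\<lambda>x. a * x)"
  by (rule k_algebra.linear_times(1)[OF algebra_U])

lemma linear_mult_right: "Vector_Spaces.linear (uscale H) (uscale H) (\<lambda>x. x * a)"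
  by (rule k_algebra.linear_times(2)[OF algebra_U])

text \<open>Both base actions are left multiplications, by source and target elements, hence commute
  with multiplying every factor from the right.\<close>

lemma balanced_mult_right:
  "balanced (ubimodule H) n G \<Longrightarrow> length ws = n \<Longrightarrow> balanced (ubimodule H) n (\<lambda>vs. G (map2 (*) vs ws))"
proof (induction n arbitrary: G ws)
  case 0
  then show ?case by simp
next
  case (Suc n)
  then obtain w ws' where ws: "ws = w # ws'" "length ws' = n" by (cases ws) auto
  show ?case
  proof (rule balanced_SucI)
    show "balanced (ubimodule H) n (\<lambda>vs. G (map2 (*) (x # vs) ws))" for x
      using Suc.IH[OF balanced_head(2)[OF Suc.prems(1)] ws(2)] by (simp add: ws(1))
    show "Vector_Spaces.linear (bscale (ubimodule H)) (*) (\<lambda>x. G (map2 (*) (x # vs) ws))"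
      if "length vs = n" for vs
      using linear_compose_functional[OF _ linear_mult_right, of "\<lambda>x. G (x # map2 (*) vs ws')"]
        balanced_head(1)[OF Suc.prems(1)] that by (simp add: ws)
    show "G (map2 (*) (ract (ubimodule H) b x # y # vs) ws) = G (map2 (*) (x # lact (ubimodule H) b y # vs) ws)"
      if l: "Suc (length vs) = n" for b x y vs
    proof -
      obtain w' ws'' where "ws' = w' # ws''" using ws l by (cases ws') auto
      then show ?thesis using balanced_head(3)[OF Suc.prems(1)] l ws by (simp add: mult.assoc)
    qed
  qed
qed

text \<open>Multiplication from the left does not commute with the base actions in general, so
  multilinearity is all that is claimed. Balance comes back in \<open>it_takeuchi\<close>, after
  summing over an iterated comultiplication.\<close>

lemma multilinear_mult_left:
  "multilinear (uscale H) n G \<Longrightarrow> length vs = n \<Longrightarrow> multilinear (uscale H) n (\<lambda>us. G (map2 (*) vs us))"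
proof (induction n arbitrary: G vs)
  case 0
  then show ?case by (simp add: multilinear_def)
next
  case (Suc n)
  then obtain v vs' where vs: "vs = v # vs'" "length vs' = n" by (cases vs) auto
  have G: "multilinear (uscale H) n (\<lambda>us. G (x # us))"
    "length us = n \<Longrightarrow> Vector_Spaces.linear (uscale H) (*) (\<lambda>x. G (x # us))" for x us
    using Suc.prems(1) by (auto simp: multilinear_Suc)
  show ?case unfolding multilinear_Suc
  proof (intro conjI allI impI)
    show "multilinear (uscale H) n (\<lambda>us. G (map2 (*) vs (x # us)))" for x
      using Suc.IH[OF G(1) vs(2)] by (simp add: vs)
    show "Vector_Spaces.linear (uscale H) (*) (\<lambda>x. G (map2 (*) vs (x # us)))" if "length us = n" for us
      using linear_compose_functional[OF _ linear_mult_left, of "\<lambda>x. G (x # map2 (*) vs' us)"]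
        G(2) that by (simp add: vs)
  qed
qed

lemma multilinear_mult_right:
  "multilinear (uscale H) n G \<Longrightarrow> length ws = n \<Longrightarrow> multilinear (uscale H) n (\<lambda>us. G (map2 (*) us ws))"
proof (induction n arbitrary: G ws)
  case 0
  then show ?case by (simp add: multilinear_def)
next
  case (Suc n)
  then obtain w ws' where ws: "ws = w # ws'" "length ws' = n" by (cases ws) auto
  have G: "multilinear (uscale H) n (\<lambda>us. G (x # us))"
    "length us = n \<Longrightarrow> Vector_Spaces.linear (uscale H) (*) (\<lambda>x. G (x # us))" for x us
    using Suc.prems(1) by (auto simp: multilinear_Suc)
  show ?case unfolding multilinear_Suc
  proof (intro conjI allI impI)
    show "multilinear (uscale H) n (\<lambda>us. G (map2 (*) (x # us) ws))" for x
      using Suc.IH[OF G(1) ws(2)] by (simp add: ws)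
    show "Vector_Spaces.linear (uscale H) (*) (\<lambda>x. G (map2 (*) (x # us) ws))" if "length us = n" for us
      using linear_compose_functional[OF _ linear_mult_right, of "\<lambda>x. G (x # map2 (*) us ws')"]
        G(2) that ws by (simp add: ws)
  qed
qed

lemma balanced_mult_right_head:
  assumes "balanced (ubimodule H) (Suc n) G"
  shows "balanced (ubimodule H) (Suc n) (\<lambda>vs. G (hd vs * w # tl vs))"
proof (rule balanced_cong[OF balanced_mult_right[OF assms, of "w # replicate n 1"]])
  fix vs :: "'u list" assume "length vs = Suc n"
  then obtain v vs' where vs: "vs = v # vs'" "length vs' = n" by (cases vs) auto
  have "map2 (*) vs' (replicate n 1) = vs'" using vs(2) by (induction vs' arbitrary: n) auto
  then show "G (hd vs * w # tl vs) = G (map2 (*) vs (w # replicate n 1))" by (simp add: vs)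
qed simp

section \<open>The Takeuchi condition and multiplicativity of the comultiplication\<close>

lemma sw_takeuchi:
  assumes g: "bibalanced (ubimodule H) g"
  shows "U.sw (\<lambda>p q. g (p * tgt H a) q) u = U.sw (\<lambda>p q. g p (q * src H a)) u"
proof -
  define G where "G = (\<lambda>vs. g (vs ! 0) (vs ! 1))"
  have G: "balanced (ubimodule H) 2 G" unfolding G_def by (rule U.bibalanced_balanced[OF g])
  have "ev G (sweedler (utensor H 2) (\<lambda>us. upure H [us ! 0 * tgt H a, us ! 1]) (comult H u)) =
      U.sw (\<lambda>p q. g (p * tgt H a) q) u"
    by (subst ev_sweedler[OF G U.D_closed], simp_all add: ev_pure[OF G] pure_tensor_closed)
      (simp add: U.sw_def G_def)
  moreover have "ev G (sweedler (utensor H 2) (\<lambda>us. upure H [us ! 0, us ! 1 * src H a]) (comult H u)) =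
      U.sw (\<lambda>p q. g p (q * src H a)) u"
    by (subst ev_sweedler[OF G U.D_closed], simp_all add: ev_pure[OF G] pure_tensor_closed)
      (simp add: U.sw_def G_def)
  ultimately show ?thesis using takeuchi by simp
qed

lemma sw_mult:
  assumes g: "bibalanced (ubimodule H) g"
  shows "U.sw g (u * v) = U.sw (\<lambda>p' q'. U.sw (\<lambda>p q. g (p * p') (q * q')) u) v"
proof -
  define G where "G = (\<lambda>vs. g (vs ! 0) (vs ! 1))"
  have G: "balanced (ubimodule H) 2 G" unfolding G_def by (rule U.bibalanced_balanced[OF g])
  have "U.sw g (u * v) = ev (\<lambda>vs. ev G (sweedler (utensor H 2)
             (\<lambda>us. upure H [us ! 0 * vs ! 0, us ! 1 * vs ! 1]) (comult H u))) (comult H v)"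
    unfolding U.sw_def G_def[symmetric] comult_mult
    by (intro ev_sweedler[OF G U.D_closed] sweedler_closed[OF kspace_tensor_power U.D_closed]
        pure_tensor_closed) simp
  also have "\<dots> = U.sw (\<lambda>p' q'. U.sw (\<lambda>p q. g (p * p') (q * q')) u) v"
    by (subst ev_sweedler[OF G U.D_closed], simp_all add: ev_pure[OF G] pure_tensor_closed)
      (simp add: U.sw_def G_def)
  finally show ?thesis .
qed

lemma sw_one: "bibalanced (ubimodule H) g \<Longrightarrow> U.sw g 1 = g 1 1"
  unfolding U.sw_def comult_one by (subst ev_pure[OF U.bibalanced_balanced]) simp_all

text \<open>Multiplicativity pairs the comultiplication of u with that of s(a); the latter is s(a)
  (x) 1, because s(a) is the left action of a on 1.\<close>

lemma sw_mult_src: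
  assumes g: "bibalanced (ubimodule H) g"
  shows "U.sw g (u * src H a) = U.sw (\<lambda>p q. g (p * src H a) q) u"
proof -
  have lin: "Vector_Spaces.linear (uscale H) (*) (\<lambda>x. g x y)" "Vector_Spaces.linear (uscale H) (*) (g x)" for x y
    using g by (auto simp: bibalanced_def)
  have gb: "g (tgt H b * x) y = g x (src H b * y)" for b x y
    using g by (simp add: bibalanced_def)
  define h where "h p' q' = U.sw (\<lambda>p q. g (p * p') (q * q')) u" for p' q'
  have h: "bibalanced (ubimodule H) h"
  proof (rule bibalancedI)
    show "Vector_Spaces.linear (bscale (ubimodule H)) (*) (\<lambda>x. h x y)" for y
      unfolding h_def using linear_compose_functional[OF lin(1) linear_mult_left]
      by (intro U.linear_sw) simp
    show "Vector_Spaces.linear (bscale (ubimodule H)) (*) (\<lambda>y. h x y)" for x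
      unfolding h_def using linear_compose_functional[OF lin(2) linear_mult_left]
      by (intro U.linear_sw) simp
    have "bibalanced (ubimodule H) (\<lambda>p q. g (p * x) (q * y))" for x y
      using linear_compose_functional[OF lin(1) linear_mult_right]
        linear_compose_functional[OF lin(2) linear_mult_right]
      by (intro bibalancedI) (simp_all add: mult.assoc gb)
    \<comment> \<open>The Takeuchi condition for u is what makes multiplication by its two halves
      balanced in the pair on the right.\<close>
    from sw_takeuchi[OF this]
    show "h (ract (ubimodule H) b x) y = h x (lact (ubimodule H) b y)" for b x y
      by (simp add: h_def mult.assoc)
  qed
  have h': "bibalanced (ubimodule H) (\<lambda>p q. h (src H a * p) q)"
  proof (rule bibalancedI)
    show "Vector_Spaces.linear (bscale (ubimodule H)) (*) (\<lambda>x. h (src H a * x) y)" for y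
      using h linear_compose_functional[OF _ linear_mult_left, of "\<lambda>x. h x y"]
      by (simp add: bibalanced_def)
    show "h (src H a * ract (ubimodule H) b x) y = h (src H a * x) (lact (ubimodule H) b y)" for b x y
    proof -
      have "src H a * (tgt H b * x) = tgt H b * (src H a * x)" by (metis src_tgt_commute mult.assoc)
      then show ?thesis using h by (simp add: bibalanced_def)
    qed
  qed (use h in \<open>simp add: bibalanced_def\<close>)
  have "U.sw g (u * src H a) = U.sw h (lact (ubimodule H) a 1)"
    by (simp add: sw_mult[OF g] h_def[abs_def])
  also have "\<dots> = h (src H a) 1" using sw_one[OF h'] by (subst U.sw_lact[OF h]) simp
  finally show ?thesis by (simp add: h_def)
qed

lemma it_mult_src:
  "balanced (ubimodule H) (Suc k) G \<Longrightarrow>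
     U.it k G (u * src H a) = U.it k (\<lambda>vs. G (hd vs * src H a # tl vs)) u"
proof (induction k arbitrary: G)
  case 0
  then show ?case using balanced_mult_right_head[OF 0] by (simp add: U.it_0)
next
  case (Suc k)
  have "U.it (Suc k) G (u * src H a) = U.it k (\<lambda>us. U.expand 0 G (hd us * src H a # tl us)) u"
    by (simp add: U.it_Suc[OF Suc.prems] Suc.IH[OF U.balanced_expand[OF Suc.prems]])
  also have "\<dots> = U.it k (U.expand 0 (\<lambda>us. G (hd us * src H a # tl us))) u"
    by (intro U.it_cong)
      (auto simp: U.expand_0 length_Suc_conv intro!: sw_mult_src U.bibalanced_head[OF Suc.prems])
  also have "\<dots> = U.it (Suc k) (\<lambda>us. G (hd us * src H a # tl us)) u"
    by (simp add: U.it_Suc balanced_mult_right_head[OF Suc.prems])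
  finally show ?case .
qed

text \<open>At the first tensor sign the Takeuchi condition gives s(a) to the right of the second
  half of w, and \<open>it_mult_src\<close> hands it to the first factor split off from that half.
  Later signs are reached by stripping factors with \<open>it_Cons\<close>.\<close>

lemma it_takeuchi:
  "balanced (ubimodule H) (Suc k) G \<Longrightarrow> length as + length bs + 2 = Suc k \<Longrightarrow>
     U.it k (\<lambda>vs. G (map2 (*) vs (as @ tgt H a * x # y # bs))) w =
     U.it k (\<lambda>vs. G (map2 (*) vs (as @ x # src H a * y # bs))) w"
proof (induction as arbitrary: k G w)
  case Nil
  obtain m where k: "k = Suc m" "length bs = m" using Nil(2) by (cases k) auto
  note G = Nil(1)[unfolded k]
  have b: "balanced (ubimodule H) (Suc (Suc m)) (\<lambda>vs. G (map2 (*) vs (c # d # bs)))" for c d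
    using balanced_mult_right[OF G, of "c # d # bs"] k by simp
  let ?h = "\<lambda>p q. U.it m (\<lambda>us. G (p * x # map2 (*) us (y # bs))) q"
  have h: "bibalanced (ubimodule H) ?h"
    using U.bibalanced_it[OF b] by simp
  have "U.it k (\<lambda>vs. G (map2 (*) vs (tgt H a * x # y # bs))) w = U.sw (\<lambda>p q. ?h (p * tgt H a) q) w"
    unfolding k by (subst U.it_Cons[OF b]) (simp add: mult.assoc)
  also have "\<dots> = U.sw (\<lambda>p q. ?h p (q * src H a)) w" by (rule sw_takeuchi[OF h])
  also have "\<dots> = U.sw (\<lambda>p q. U.it m (\<lambda>us. G (p * x # map2 (*) us (src H a * y # bs))) q) w"
  proof -
    have "?h p (q * src H a) = U.it m (\<lambda>us. G (p * x # map2 (*) us (src H a * y # bs))) q" for p q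
    proof -
      have "balanced (ubimodule H) (Suc m) (\<lambda>us. G (p * x # map2 (*) us (y # bs)))"
        using balanced_head(2)[OF b, of p] by simp
      from it_mult_src[OF this] show ?thesis
        by simp (intro U.it_cong, auto simp: length_Suc_conv mult.assoc)
    qed
    then show ?thesis by simp
  qed
  also have "\<dots> = U.it k (\<lambda>vs. G (map2 (*) vs (x # src H a * y # bs))) w"
    unfolding k by (subst U.it_Cons[OF b]) simp
  finally show ?case by simp
next
  case (Cons c as)
  obtain m where k: "k = Suc m" using Cons.prems(2) by (cases k) auto
  note G = Cons.prems(1)[unfolded k]
  have b: "balanced (ubimodule H) (Suc (Suc m)) (\<lambda>vs. G (map2 (*) vs ((c # as) @ d # e # bs)))" for d e
    using balanced_mult_right[OF G, of "(c # as) @ d # e # bs"] Cons.prems(2) k by simp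
  have "U.it m (\<lambda>vs. G (p * c # map2 (*) vs (as @ tgt H a * x # y # bs))) q =
     U.it m (\<lambda>vs. G (p * c # map2 (*) vs (as @ x # src H a * y # bs))) q" for p q
    using Cons.prems(2) k by (intro Cons.IH balanced_head(2)[OF G]) simp
  then show ?case unfolding k U.it_Cons[OF b]
    by (intro arg_cong[where f = "\<lambda>g. U.sw g w"] ext) simp
qed

lemma balanced_snoc_one:
  assumes "balanced (ubimodule H) (Suc n) G" shows "balanced (ubimodule H) n (\<lambda>us. G (us @ [1]))"
  unfolding balanced_def multilinear_def
  using multilinearD[OF balanced_multilinear[OF assms], of _ "_ @ [1]"]
    balancedD[OF assms, of _ "_ @ [1]"] by auto

section \<open>Codegeneracies on functions of lists\<close>

lemma src_counit: "counit H (src H a * u) = a * counit H u" "counit H (tgt H a * u) = counit H u * a"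
  using counit_bimodule[of a 1 u] counit_bimodule[of 1 a u] by (simp_all add: src_one tgt_one)

lemma linear_counit_src: "Vector_Spaces.linear (uscale H) (uscale H) (\<lambda>x. src H (counit H x) * y)"
  "Vector_Spaces.linear (uscale H) (uscale H) (\<lambda>x. tgt H (counit H x) * y)"
  using src_linear tgt_linear counit_linear linear_mult_right[of y] by (auto simp: Vector_Spaces.linear_iff)

text \<open>The transpose of the codegeneracies in which a counit acts on the neighbour to the
  right.\<close>

definition contract :: "nat \<Rightarrow> ('u list \<Rightarrow> 'k) \<Rightarrow> 'u list \<Rightarrow> 'k" where
  "contract i G us = G (take i us @ src H (counit H (us ! i)) * us ! Suc i # drop (Suc (Suc i)) us)"

lemma contract_0: "contract 0 G (x # y # us) = G (src H (counit H x) * y # us)"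
  by (simp add: contract_def)

lemma contract_Suc: "contract (Suc i) G (x # us) = contract i (\<lambda>us. G (x # us)) us"
  by (simp add: contract_def)

text \<open>Within the contracted pair, the counit of t(b)x is that of x times b, and
  multiplicativity of s passes b on to the second factor. Towards the left neighbour, left linearity
  of the counit brings s(b) to the front of the merged factor.\<close>

lemma balanced_contract:
  "balanced (ubimodule H) (Suc n) G \<Longrightarrow> i \<le> n \<Longrightarrow> balanced (ubimodule H) (Suc (Suc n)) (contract i G)"
proof (induction i arbitrary: n G)
  case 0
  note G = 0(1)
  show ?case
  proof (rule balanced_SucI)
    show "Vector_Spaces.linear (bscale (ubimodule H)) (*) (\<lambda>x. contract 0 G (x # vs))"
      if "length vs = Suc n" for vs
      using that balanced_head(1)[OF G]
      by (auto simp: contract_0 length_Suc_conv intro!: linear_compose_functional[OF _ linear_counit_src(1)])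
    show "balanced (ubimodule H) (Suc n) (\<lambda>vs. contract 0 G (x # vs))" for x
      using U.balanced_lact_head[OF G, of "counit H x"]
      by (rule balanced_cong) (auto simp: contract_0 length_Suc_conv)
    show "contract 0 G (ract (ubimodule H) b x # y # vs) = contract 0 G (x # lact (ubimodule H) b y # vs)" for b x y vs
      by (simp add: contract_0 src_counit src_mult mult.assoc)
  qed
next
  case (Suc i)
  then obtain m where n: "n = Suc m" "i \<le> m" by (cases n) auto
  note G = Suc.prems(1)[unfolded n]
  show ?case unfolding n
  proof (rule balanced_SucI)
    show "Vector_Spaces.linear (bscale (ubimodule H)) (*) (\<lambda>x. contract (Suc i) G (x # vs))"
      if "length vs = Suc (Suc m)" for vs
      using that n unfolding contract_Suc unfolding contract_def by (intro balanced_head(1)[OF G]) simp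
    show "balanced (ubimodule H) (Suc (Suc m)) (\<lambda>vs. contract (Suc i) G (x # vs))" for x
      unfolding contract_Suc using Suc.IH[OF balanced_head(2)[OF G] n(2)] .
    show "contract (Suc i) G (ract (ubimodule H) b x # y # vs) = contract (Suc i) G (x # lact (ubimodule H) b y # vs)"
      if l: "Suc (length vs) = Suc (Suc m)" for b x y vs
    proof (cases i)
      case 0
      obtain z vs' where vs: "vs = z # vs'" "length vs' = m" using l by (cases vs) auto
      then show ?thesis using balanced_head(3)[OF G, of vs' b x]
        by (simp add: 0 contract_Suc contract_0 src_counit src_mult mult.assoc)
    next
      case (Suc j)
      then show ?thesis using balanced_head(3)[OF G, of _ b x] l n
        by (simp add: contract_Suc) (simp add: contract_def)
    qed
  qed
qed

text \<open>The transpose of the last codegeneracy, from n + 2 factors to n + 1: the counit acts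
  through \<open>tgt\<close> on the neighbour to the left.\<close>

definition contract_last :: "nat \<Rightarrow> ('u list \<Rightarrow> 'k) \<Rightarrow> 'u list \<Rightarrow> 'k" where
  "contract_last n G us = G (take n us @ [tgt H (counit H (us ! Suc n)) * us ! n])"

lemma contract_last_0: "contract_last 0 G [x, y] = G [tgt H (counit H y) * x]"
  by (simp add: contract_last_def)

lemma contract_last_Suc: "contract_last (Suc n) G (x # us) = contract_last n (\<lambda>us. G (x # us)) us"
  by (simp add: contract_last_def)

text \<open>Within the last pair, the antimultiplicative t turns b times the counit of y into the
  order in which both act on x. Towards the left neighbour, source and target elements
  commute.\<close>

lemma balanced_contract_last:
  "balanced (ubimodule H) (Suc n) G \<Longrightarrow> balanced (ubimodule H) (Suc (Suc n)) (contract_last n G)"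
proof (induction n arbitrary: G)
  case 0
  have lin: "Vector_Spaces.linear (uscale H) (*) (\<lambda>x. G [x])" using balanced_head(1)[OF 0, of "[]"] by simp
  have "bibalanced (ubimodule H) (\<lambda>x y. G [tgt H (counit H y) * x])"
    using linear_compose_functional[OF lin linear_mult_left]
      linear_compose_functional[OF lin linear_counit_src(2)]
    by (intro bibalancedI) (simp_all add: src_counit tgt_mult mult.assoc)
  then show ?case using balanced_2[of "ubimodule H" "contract_last 0 G"]
    by (simp add: contract_last_0 numeral_2_eq_2)
next
  case (Suc m)
  note G = Suc.prems
  show ?case
  proof (rule balanced_SucI)
    show "Vector_Spaces.linear (bscale (ubimodule H)) (*) (\<lambda>x. contract_last (Suc m) G (x # vs))"
      if "length vs = Suc (Suc m)" for vs
      using that unfolding contract_last_Suc unfolding contract_last_def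
      by (intro balanced_head(1)[OF G]) simp
    show "balanced (ubimodule H) (Suc (Suc m)) (\<lambda>vs. contract_last (Suc m) G (x # vs))" for x
      unfolding contract_last_Suc using Suc.IH[OF balanced_head(2)[OF G]] .
    show "contract_last (Suc m) G (ract (ubimodule H) b x # y # vs) = contract_last (Suc m) G (x # lact (ubimodule H) b y # vs)"
      if l: "Suc (length vs) = Suc (Suc m)" for b x y vs
    proof (cases m)
      case 0
      obtain z where vs: "vs = [z]" using l 0 by (cases vs) auto
      have "tgt H (counit H z) * (src H b * y) = src H b * (tgt H (counit H z) * y)"
        by (metis src_tgt_commute mult.assoc)
      then show ?thesis using balanced_head(3)[OF G, of "[]" b x] 0
        by (simp add: vs contract_last_Suc contract_last_0)
    next
      case (Suc j)
      then show ?thesis using balanced_head(3)[OF G, of _ b x] l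
        by (simp add: contract_last_Suc) (simp add: contract_last_def)
    qed
  qed
qed

end

section \<open>The cyclic operator on functions of lists\<close>

context hopf_algebroid
begin

text \<open>The transpose of the cyclic operator in degree k + 1. The appended 1 lets the last
  factor, which stands alone in the formula, be multiplied like the others.\<close>

definition rotate :: "nat \<Rightarrow> ('u list \<Rightarrow> 'k) \<Rightarrow> 'u list \<Rightarrow> 'k" where
  "rotate k G us = U.it k (\<lambda>vs. G (map2 (*) vs (tl us @ [1]))) (antipode H (hd us))"

lemma antipode_tgt_mult: "antipode H (tgt H a * u) = antipode H u * src H a"
  by (simp add: antipode_mult antipode_tgt)

text \<open>At the first tensor sign, S(t(b)x) = S(x)s(b), and \<open>it_mult_src\<close> puts s(b)
  on the first factor, directly to the left of y. The later signs are instances of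
  \<open>it_takeuchi\<close>.\<close>

lemma balanced_rotate:
  assumes G: "balanced (ubimodule H) (Suc k) G" shows "balanced (ubimodule H) (Suc k) (rotate k G)"
proof (rule balanced_SucI)
  have b: "balanced (ubimodule H) (Suc k) (\<lambda>vs. G (map2 (*) vs (ws @ [1])))" if "length ws = k" for ws
    using balanced_mult_right[OF G] that by simp
  show "Vector_Spaces.linear (bscale (ubimodule H)) (*) (\<lambda>x. rotate k G (x # ws))" if "length ws = k" for ws
    using linear_compose_functional[OF U.it_linear[OF b[OF that], simplified] antipode_linear]
    by (simp add: rotate_def)
  show "balanced (ubimodule H) k (\<lambda>ws. rotate k G (x # ws))" for x
    unfolding balanced_def multilinear_def
  proof (intro conjI allI impI)
    fix xs ys :: "'u list" assume l: "length xs + length ys + 1 = k"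
    have "Vector_Spaces.linear (uscale H) (*) (\<lambda>y. G (map2 (*) vs (xs @ y # ys @ [1])))"
      if vs: "length vs = Suc k" for vs
    proof -
      have "multilinear (uscale H) (Suc k) (\<lambda>us. G (map2 (*) vs us))"
        using balanced_multilinear[OF G] vs by (intro multilinear_mult_left) simp_all
      from multilinearD[OF this, of xs "ys @ [1]"] l show ?thesis by simp
    qed
    then show "Vector_Spaces.linear (bscale (ubimodule H)) (*) (\<lambda>y. rotate k G (x # xs @ y # ys))"
      unfolding rotate_def using U.vs by (simp add: U.linear_it)
  next
    fix xs ys :: "'u list" and b y z assume "length xs + length ys + 2 = k"
    then show "rotate k G (x # xs @ ract (ubimodule H) b y # z # ys) =
        rotate k G (x # xs @ y # lact (ubimodule H) b z # ys)"
      using it_takeuchi[OF G, of xs "ys @ [1]"] by (simp add: rotate_def)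
  qed
  show "rotate k G (ract (ubimodule H) b x # y # ws) = rotate k G (x # lact (ubimodule H) b y # ws)"
    if "Suc (length ws) = k" for b x y ws
    using it_mult_src[OF b[of "y # ws"]] that
    by (simp add: rotate_def antipode_tgt_mult)
      (intro U.it_cong, auto simp: length_Suc_conv mult.assoc)
qed

end

section \<open>Measurings\<close>

lemma bimodule_cbimodule [simp]: "bscale (cbimodule C) = cscale C"
  "lact (cbimodule C) = cscale C" "ract (cbimodule C) = cscale C"
  by (simp_all add: cbimodule_def)

text \<open>Both actions are scalar multiplication, so balance is homogeneity in two adjacent
  places.\<close>

lemma balanced_cbimodule: "balanced (cbimodule C) n G \<longleftrightarrow> multilinear (cscale C) n G"
proof
  assume G: "multilinear (cscale C) n G"
  have "G (xs @ cscale C b x # y # ys) = G (xs @ x # cscale C b y # ys)"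
    if "length xs + length ys + 2 = n" for xs ys b x y
    using multilinearD[OF G, of xs "y # ys"] multilinearD[OF G, of "xs @ [x]" ys] that
    by (simp add: Vector_Spaces.linear_iff)
  then show "balanced (cbimodule C) n G" using G by (simp add: balanced_def)
qed (simp add: balanced_def)

text \<open>Homogeneity of the comultiplication produces a scalar in front, which a balanced
  function absorbs in either factor.\<close>

sublocale coalgebra \<subseteq> K: coring "cbimodule C" "ccomult C"
proof (rule coring.intro)
  show lin: "linear_on (vector_module (bscale (cbimodule C))) (tensor_power (cbimodule C) 2) (ccomult C)"
    by (simp add: comult_linear)
  have cl: "ccomult C x \<in> carrier (tensor_power (cbimodule C) 2)" for x
    using linear_onD(1)[OF lin] by (simp add: vector_module_def)
  have sc: "ev G (ccomult C (cscale C b v)) = ev (\<lambda>vs. b * G vs) (ccomult C v)"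
    if G: "balanced (cbimodule C) 2 G" for G b v
    using linear_onD(3)[OF lin, of v b] ev_tensor_smult[OF G cl]
    by (simp add: vector_module_def ev_mult_left)
  have G2: "b * G vs = G [cscale C b (vs ! 0), vs ! 1]" "b * G vs = G [vs ! 0, cscale C b (vs ! 1)]"
    if G: "balanced (cbimodule C) 2 G" and vs: "length vs = 2" for G b vs
  proof -
    obtain p q where "vs = [p, q]" using vs by (auto simp: length_Suc_conv numeral_2_eq_2)
    then show "b * G vs = G [cscale C b (vs ! 0), vs ! 1]" "b * G vs = G [vs ! 0, cscale C b (vs ! 1)]"
      using G by (simp_all add: balanced_2 bibalanced_def Vector_Spaces.linear_iff)
  qed
  show "ev G (ccomult C (lact (cbimodule C) b v)) = ev (\<lambda>vs. G [lact (cbimodule C) b (vs ! 0), vs ! 1]) (ccomult C v)"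
    if "balanced (cbimodule C) 2 G" for G b v
    unfolding bimodule_cbimodule sc[OF that] by (intro ev_cong[OF cl] G2 that)
  show "ev G (ccomult C (ract (cbimodule C) b v)) = ev (\<lambda>vs. G [vs ! 0, ract (cbimodule C) b (vs ! 1)]) (ccomult C v)"
    if "balanced (cbimodule C) 2 G" for G b v
    unfolding bimodule_cbimodule sc[OF that] by (intro ev_cong[OF cl] G2 that)
  interpret v: vector_space "cscale C" by (rule vector_space)
  show "vector_space (bscale (cbimodule C))" by (simp add: vector_space)
  show "lact (cbimodule C) b (ract (cbimodule C) c v) = ract (cbimodule C) c (lact (cbimodule C) b v)" for b c v
    by (simp add: mult.commute)
  show "Vector_Spaces.linear (bscale (cbimodule C)) (bscale (cbimodule C)) (lact (cbimodule C) b)" for b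
    using vector_space by (simp add: Vector_Spaces.linear_iff v.scale_right_distrib mult.commute)
  show "coassociative (cbimodule C) (ccomult C)" by (rule coassoc)
qed

context coalgebra
begin

lemma bilinear_bibalanced:
  assumes "\<And>y. Vector_Spaces.linear (cscale C) (*) (\<lambda>x. g x y)"
    "\<And>x. Vector_Spaces.linear (cscale C) (*) (\<lambda>y. g x y)"
  shows "bibalanced (cbimodule C) g"
  using assms by (intro bibalancedI) (simp_all add: Vector_Spaces.linear_iff)

lemma sw_bilinear:
  assumes "\<And>y. Vector_Spaces.linear (cscale C) (*) (\<lambda>x. g x y)"
    "\<And>x. Vector_Spaces.linear (cscale C) (*) (\<lambda>y. g x y)"
  shows "Vector_Spaces.linear (cscale C) (*) (\<lambda>x. K.sw g x)"
  using K.sw_linear[OF bilinear_bibalanced[OF assms]] by simp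

lemma sw_trilinear:
  assumes "\<And>y z. Vector_Spaces.linear (cscale C) (*) (\<lambda>x. g x y z)"
    "\<And>x z. Vector_Spaces.linear (cscale C) (*) (\<lambda>y. g x y z)"
    "\<And>x y. Vector_Spaces.linear (cscale C) (*) (\<lambda>z. g x y z)"
  shows "K.sw (\<lambda>p q. K.sw (\<lambda>r s. g r s q) p) x = K.sw (\<lambda>p q. K.sw (\<lambda>r s. g p r s) q) x"
  by (rule K.sw_coassoc) (use assms in \<open>simp_all add: Vector_Spaces.linear_iff\<close>)

lemma sw_counit_left:
  assumes "Vector_Spaces.linear (cscale C) (*) f"
  shows "K.sw (\<lambda>p q. ccounit C p * f q) x = f x"
  using linear_sweedler[OF assms K.D_closed, of "\<lambda>xs. cscale C (ccounit C (xs ! 0)) (xs ! 1)" x] assms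
  by (simp add: counit_left[simplified] K.sw_def Vector_Spaces.linear_iff)

lemma sw_counit_right:
  assumes "Vector_Spaces.linear (cscale C) (*) f"
  shows "K.sw (\<lambda>p q. ccounit C q * f p) x = f x"
  using linear_sweedler[OF assms K.D_closed, of "\<lambda>xs. cscale C (ccounit C (xs ! 1)) (xs ! 0)" x] assms
  by (simp add: counit_right[simplified] K.sw_def Vector_Spaces.linear_iff)

end

context cocommutative_coalgebra
begin

lemma sw_commute:
  assumes "\<And>y. Vector_Spaces.linear (cscale C) (*) (\<lambda>x. g x y)"
    "\<And>x. Vector_Spaces.linear (cscale C) (*) (\<lambda>y. g x y)"
  shows "K.sw g x = K.sw (\<lambda>p q. g q p) x"
proof -
  define G where "G = (\<lambda>vs. g (vs ! 0) (vs ! 1))"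
  have G: "balanced (cbimodule C) 2 G"
    unfolding G_def by (rule K.bibalanced_balanced[OF bilinear_bibalanced[OF assms]])
  have "K.sw g x = ev G (ccomult C x)" by (simp add: K.sw_def G_def)
  also have "\<dots> = ev G (sweedler (tensor_power (cbimodule C) 2)
       (\<lambda>xs. pure_tensor (cbimodule C) [xs ! 1, xs ! 0]) (ccomult C x))"
    by (simp only: cocommutative)
  also have "\<dots> = K.sw (\<lambda>p q. g q p) x"
    by (subst ev_sweedler[OF G K.D_closed], simp_all add: ev_pure[OF G] pure_tensor_closed)
      (simp add: K.sw_def G_def)
  finally show ?thesis .
qed

text \<open>In a fourfold comultiplication the middle factors may be exchanged: two uses of
  coassociativity present them as the halves of one element, where cocommutativity applies.\<close>

lemma sw_interchange:
  assumes l: "\<And>q r s. Vector_Spaces.linear (cscale C) (*) (\<lambda>p. g p q r s)"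
    "\<And>p r s. Vector_Spaces.linear (cscale C) (*) (\<lambda>q. g p q r s)"
    "\<And>p q s. Vector_Spaces.linear (cscale C) (*) (\<lambda>r. g p q r s)"
    "\<And>p q r. Vector_Spaces.linear (cscale C) (*) (\<lambda>s. g p q r s)"
  shows "K.sw (\<lambda>a b. K.sw (\<lambda>c d. K.sw (\<lambda>e f. g c d e f) b) a) x =
    K.sw (\<lambda>a b. K.sw (\<lambda>c d. K.sw (\<lambda>e f. g c e d f) b) a) x"
proof -
  have *: "K.sw (\<lambda>a b. K.sw (\<lambda>c d. K.sw (\<lambda>e f. h c d e f) b) a) x =
      K.sw (\<lambda>c r. K.sw (\<lambda>t f. K.sw (\<lambda>d e. h c d e f) t) r) x"
    if l: "\<And>q r s. Vector_Spaces.linear (cscale C) (*) (\<lambda>p. h p q r s)"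
    "\<And>p r s. Vector_Spaces.linear (cscale C) (*) (\<lambda>q. h p q r s)"
    "\<And>p q s. Vector_Spaces.linear (cscale C) (*) (\<lambda>r. h p q r s)"
    "\<And>p q r. Vector_Spaces.linear (cscale C) (*) (\<lambda>s. h p q r s)" for h
  proof -
    have "K.sw (\<lambda>a b. K.sw (\<lambda>c d. K.sw (\<lambda>e f. h c d e f) b) a) x =
        K.sw (\<lambda>c r. K.sw (\<lambda>d b. K.sw (\<lambda>e f. h c d e f) b) r) x"
      by (rule sw_trilinear) (intro K.linear_sw sw_bilinear l)+
    also have "\<dots> = K.sw (\<lambda>c r. K.sw (\<lambda>t f. K.sw (\<lambda>d e. h c d e f) t) r) x"
      by (intro arg_cong[where f = "\<lambda>g. K.sw g x"] ext sw_trilinear[symmetric] l)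
    finally show ?thesis .
  qed
  have "K.sw (\<lambda>d e. g c d e f) t = K.sw (\<lambda>d e. g c e d f) t" for c f t
    by (rule sw_commute) (rule l)+
  \<comment> \<open>The regrouping is applied to \<open>g\<close> and to \<open>g\<close> with its
    middle arguments exchanged, hence the permuted linearity hypotheses.\<close>
  then show ?thesis unfolding *[of g, OF l] *[of "\<lambda>c d e f. g c e d f", OF l(1,3,2,4)] by simp
qed

end

section \<open>A measuring acting on functions of lists\<close>

locale hopf_algebroid_measuring =
  H: hopf_algebroid H + H': hopf_algebroid H' + C: cocommutative_coalgebra C
  for H :: "('k::field, 'u::{ring, monoid_mult}, 'a::{ring, monoid_mult}) hopf_data"
    and H' :: "('k, 'v::{ring, monoid_mult}, 'b::{ring, monoid_mult}) hopf_data"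
    and C :: "('k, 'c::ab_group_add) coalgebra_data" +
  fixes \<Psi> :: "'c \<Rightarrow> 'u \<Rightarrow> 'v" and \<psi> :: "'c \<Rightarrow> 'a \<Rightarrow> 'b"
  assumes measuring: "hopf_measuring C H H' \<Psi> \<psi>"
begin

lemma Psi_linear: "Vector_Spaces.linear (uscale H) (uscale H') (\<Psi> x)"
  "Vector_Spaces.linear (cscale C) (uscale H') (\<lambda>x. \<Psi> x u)"
  "Vector_Spaces.linear (ascale H) (ascale H') (\<psi> x)"
  "Vector_Spaces.linear (cscale C) (ascale H') (\<lambda>x. \<psi> x a)"
  using measuring by (auto simp: hopf_measuring_def algebra_measuring_def)

lemma Psi_structure: "\<Psi> x 1 = uscale H' (ccounit C x) 1" "\<Psi> x (src H a) = src H' (\<psi> x a)"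
  "\<Psi> x (tgt H a) = tgt H' (\<psi> x a)" "\<Psi> x (antipode H u) = antipode H' (\<Psi> x u)"
  "\<psi> x (counit H u) = counit H' (\<Psi> x u)"
  using measuring by (auto simp: hopf_measuring_def algebra_measuring_def)

lemma Psi_mult:
  assumes "Vector_Spaces.linear (uscale H') (*) f"
  shows "f (\<Psi> x (u * v)) = C.K.sw (\<lambda>p q. f (\<Psi> p u * \<Psi> q v)) x"
proof -
  have "\<Psi> x (u * v) = sweedler (vector_module (uscale H')) (\<lambda>xs. \<Psi> (xs ! 0) u * \<Psi> (xs ! 1) v) (ccomult C x)"
    using measuring by (simp add: hopf_measuring_def algebra_measuring_def)
  then show ?thesis by (simp add: linear_sweedler[OF assms C.K.D_closed] C.K.sw_def)
qed

lemma Psi_comult: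
  assumes g: "bibalanced (ubimodule H') g"
  shows "H'.U.sw g (\<Psi> x u) = H.U.sw (\<lambda>p q. C.K.sw (\<lambda>a b. g (\<Psi> a p) (\<Psi> b q)) x) u"
proof -
  define G where "G = (\<lambda>vs. g (vs ! 0) (vs ! 1))"
  have G: "balanced (ubimodule H') 2 G" unfolding G_def by (rule H'.U.bibalanced_balanced[OF g])
  have "comult H' (\<Psi> x u) = sweedler (utensor H' 2)
        (\<lambda>us. sweedler (utensor H' 2)
           (\<lambda>xs. upure H' [\<Psi> (xs ! 0) (us ! 0), \<Psi> (xs ! 1) (us ! 1)]) (ccomult C x))
        (comult H u)"
    using measuring by (simp add: hopf_measuring_def)
  moreover have "H'.U.sw g (\<Psi> x u) = ev G (comult H' (\<Psi> x u))"
    by (simp add: H'.U.sw_def G_def)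
  ultimately have "H'.U.sw g (\<Psi> x u) = ev (\<lambda>us. ev G (sweedler (utensor H' 2)
           (\<lambda>xs. upure H' [\<Psi> (xs ! 0) (us ! 0), \<Psi> (xs ! 1) (us ! 1)]) (ccomult C x))) (comult H u)"
    by simp
      (intro ev_sweedler[OF G H.U.D_closed] sweedler_closed[OF kspace_tensor_power C.K.D_closed]
        pure_tensor_closed, simp)
  also have "\<dots> = H.U.sw (\<lambda>p q. C.K.sw (\<lambda>a b. g (\<Psi> a p) (\<Psi> b q)) x) u"
    by (subst ev_sweedler[OF G C.K.D_closed], simp_all add: ev_pure[OF G] pure_tensor_closed)
      (simp add: C.K.sw_def H.U.sw_def G_def)
  finally show ?thesis .
qed

text \<open>\<open>mt G x [u\<^sub>1, \<dots>, u\<^sub>n]\<close> is \<open>G [x\<^sub>(\<^sub>1\<^sub>)(u\<^sub>1), \<dots>, x\<^sub>(\<^sub>n\<^sub>)(u\<^sub>n)]\<close>, summed; including the counit at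
  \<open>n = 0\<close> makes it amenable to induction on the list.\<close>

primrec mt :: "('v list \<Rightarrow> 'k) \<Rightarrow> 'c \<Rightarrow> 'u list \<Rightarrow> 'k" where
  "mt G x [] = ccounit C x * G []"
| "mt G x (u # us) = C.K.sw (\<lambda>a b. mt (\<lambda>vs. G (\<Psi> a u # vs)) b us) x"

lemma mt_cong:
  "(\<And>vs. length vs = length us \<Longrightarrow> G vs = G' vs) \<Longrightarrow> mt G x us = mt G' x us"
proof (induction us arbitrary: G G' x)
  case (Cons u us)
  then have "mt (\<lambda>vs. G (\<Psi> a u # vs)) b us = mt (\<lambda>vs. G' (\<Psi> a u # vs)) b us" for a b
    by (intro Cons.IH) simp
  then show ?case by simp
qed simp

lemma linear_mt:
  assumes "vector_space sc" "\<And>vs. length vs = length us \<Longrightarrow> Vector_Spaces.linear sc (*) (\<lambda>y. G y vs)"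
  shows "Vector_Spaces.linear sc (*) (\<lambda>y. mt (G y) x us)"
  using assms(2)
proof (induction us arbitrary: G x)
  case Nil
  from Nil[of "[]"] show ?case by (auto simp: Vector_Spaces.linear_iff algebra_simps)
next
  case (Cons u us)
  have "Vector_Spaces.linear sc (*) (\<lambda>y. mt (\<lambda>vs. G y (\<Psi> a u # vs)) b us)" for a b
    using Cons.prems by (intro Cons.IH) simp
  then show ?case by (simp add: C.K.linear_sw)
qed

lemma linear_Psi_head:
  assumes "multilinear (uscale H') (Suc n) G" "length vs = n"
  shows "Vector_Spaces.linear (cscale C) (*) (\<lambda>a. G (\<Psi> a u # vs))"
    "Vector_Spaces.linear (uscale H) (*) (\<lambda>u. G (\<Psi> a u # vs))"
  using assms linear_compose_functional[OF _ Psi_linear(1), of "\<lambda>v. G (v # vs)" a]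
   linear_compose_functional[OF _ Psi_linear(2), of "\<lambda>v. G (v # vs)" u]
  by (simp_all add: multilinear_Suc)

lemma multilinear_tail: "multilinear sc (Suc n) G \<Longrightarrow> multilinear sc n (\<lambda>vs. G (x # vs))"
  by (simp add: multilinear_Suc)

lemma mt_linear: "multilinear (uscale H') (length us) G \<Longrightarrow>
    Vector_Spaces.linear (cscale C) (*) (\<lambda>x. mt G x us)"
proof (induction us arbitrary: G)
  case Nil
  show ?case using C.counit_linear by (auto simp: Vector_Spaces.linear_iff algebra_simps)
next
  case (Cons u us)
  have G: "multilinear (uscale H') (Suc (length us)) G" using Cons.prems by simp
  show ?case unfolding mt.simps
    by (intro C.sw_bilinear linear_mt C.vector_space linear_Psi_head(1)[OF G] Cons.IH multilinear_tail[OF G])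
qed

text \<open>\<open>mt\<close> is linear in its function argument, as a finite sum of its values with
  scalar coefficients; a sum over an unrelated tensor passes through it.\<close>

lemma mt_ev: "mt (\<lambda>vs. ev (\<lambda>w. G w vs) X) x us = ev (\<lambda>w. mt (G w) x us) X"
  by (induction us arbitrary: G x) (simp_all add: ev_mult_left C.K.sw_ev)

lemma mt_sw: "mt (\<lambda>vs. H'.U.sw (\<lambda>p q. G p q vs) v) x us = H'.U.sw (\<lambda>p q. mt (G p q) x us) v"
  unfolding H'.U.sw_def by (rule mt_ev)

lemma mt_csw: "mt (\<lambda>vs. C.K.sw (\<lambda>p q. G p q vs) y) x us = C.K.sw (\<lambda>p q. mt (G p q) x us) y"
  unfolding C.K.sw_def by (rule mt_ev)

lemma sw_csw: "H.U.sw (\<lambda>p q. C.K.sw (\<lambda>a b. G p q a b) x) u = C.K.sw (\<lambda>a b. H.U.sw (\<lambda>p q. G p q a b) u) x"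
  unfolding H.U.sw_def C.K.sw_def by (rule ev_swap)

text \<open>The counit that ends the recursion is absorbed by the counit axiom of C.\<close>

lemma mt_single: "multilinear (uscale H') 1 G \<Longrightarrow> mt G x [u] = G [\<Psi> x u]"
  using C.sw_counit_right[OF linear_Psi_head(1)[of 0 G "[]" u]] by simp

text \<open>Coassociativity lets the halves of a single z measure the first two factors, so that a
  measuring law for z applies to them jointly.\<close>

lemma mt_Cons2:
  assumes G: "multilinear (uscale H') (Suc (Suc (length us))) G"
  shows "mt G x (u # v # us) = C.K.sw (\<lambda>z d. C.K.sw (\<lambda>a c. mt (\<lambda>ws. G (\<Psi> a u # \<Psi> c v # ws)) d us) z) x"
  unfolding mt.simps
  by (rule C.sw_trilinear[symmetric])
    (intro linear_mt C.vector_space linear_Psi_head(1)[OF G] linear_Psi_head(1)[OF multilinear_tail[OF G]]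
      mt_linear multilinear_tail[OF multilinear_tail[OF G]]; simp)+

lemma linear_mt_head:
  assumes "multilinear (uscale H') (Suc (length us)) G"
  shows "Vector_Spaces.linear (uscale H') (*) (\<lambda>y. mt (\<lambda>ws. G (y # ws)) x us)"
  using assms H'.U.vs by (intro linear_mt) (auto simp: multilinear_Suc)

lemma bibalanced_mt_head:
  assumes G: "balanced (ubimodule H') (Suc (Suc (length us))) G"
  shows "bibalanced (ubimodule H') (\<lambda>p q. mt (\<lambda>ws. G (p # q # ws)) x us)"
proof (rule bibalancedI)
  have "Vector_Spaces.linear (uscale H') (*) (\<lambda>p. G (p # q # ws))" if "length ws = length us" for q ws
    using balanced_head(1)[OF G, of "q # ws"] that by simp
  then show "Vector_Spaces.linear (bscale (ubimodule H')) (*) (\<lambda>p. mt (\<lambda>ws. G (p # q # ws)) x us)" for q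
    using H'.U.vs by (simp add: linear_mt)
  have "Vector_Spaces.linear (uscale H') (*) (\<lambda>q. G (p # q # ws))" if "length ws = length us" for p ws
    using balanced_head(1)[OF balanced_head(2)[OF G]] that by simp
  then show "Vector_Spaces.linear (bscale (ubimodule H')) (*) (\<lambda>q. mt (\<lambda>ws. G (p # q # ws)) x us)" for p
    using H'.U.vs by (simp add: linear_mt)
  show "mt (\<lambda>ws. G (ract (ubimodule H') b p # q # ws)) x us = mt (\<lambda>ws. G (p # lact (ubimodule H') b q # ws)) x us" for b p q
    by (intro mt_cong balanced_head(3)[OF G]) simp
qed

text \<open>By multiplicativity the left side is t'(x_(1)(b)) x_(2)(u) (x) x_(3)(v), and the base
  element crosses the tensor sign as s'(x_(1)(b)). To recognize x_(2)(s(b)v), the factors of x on b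
  and on u have to change places, which is cocommutativity.\<close>

lemma measuring_balanced:
  assumes g: "bibalanced (ubimodule H') g"
  shows "C.K.sw (\<lambda>p q. g (\<Psi> p (tgt H b * u)) (\<Psi> q v)) x = C.K.sw (\<lambda>p q. g (\<Psi> p u) (\<Psi> q (src H b * v))) x"
proof -
  have lin: "Vector_Spaces.linear (uscale H') (*) (\<lambda>x. g x y)" "Vector_Spaces.linear (uscale H') (*) (\<lambda>y. g x y)" for x y
    using g by (auto simp: bibalanced_def)
  have gb: "g (tgt H' b * x) y = g x (src H' b * y)" for b x y
    using g by (simp add: bibalanced_def)
  let ?N = "\<lambda>f e c. g (\<Psi> f u) (src H' (\<psi> e b) * \<Psi> c v)"
  have src: "Vector_Spaces.linear (cscale C) (uscale H') (\<lambda>e. src H' (\<psi> e b) * w)" for w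
    using Psi_linear(4)[of b] H'.src_linear H'.linear_mult_right[of w] by (auto simp: Vector_Spaces.linear_iff)
  have tri: "Vector_Spaces.linear (cscale C) (*) (\<lambda>f. ?N f e c)"
    "Vector_Spaces.linear (cscale C) (*) (\<lambda>e. ?N f e c)"
    "Vector_Spaces.linear (cscale C) (*) (\<lambda>c. ?N f e c)" for e f c
    using linear_compose_functional[OF lin(1) Psi_linear(2)]
      linear_compose_functional[OF lin(2) src]
      linear_compose_functional[OF linear_compose_functional[OF lin(2) H'.linear_mult_left] Psi_linear(2)]
    by auto
  have "C.K.sw (\<lambda>p q. g (\<Psi> p (tgt H b * u)) (\<Psi> q v)) x =
      C.K.sw (\<lambda>p q. C.K.sw (\<lambda>e f. ?N f e q) p) x"
    by (simp add: Psi_mult[OF lin(1)] Psi_structure gb)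
  also have "\<dots> = C.K.sw (\<lambda>p q. C.K.sw (\<lambda>e f. ?N e f q) p) x"
    by (intro arg_cong[where f = "\<lambda>g. C.K.sw g x"] ext C.sw_commute tri)
  also have "\<dots> = C.K.sw (\<lambda>p q. C.K.sw (\<lambda>e f. ?N p e f) q) x"
    by (intro C.sw_trilinear tri)
  also have "\<dots> = C.K.sw (\<lambda>p q. g (\<Psi> p u) (\<Psi> q (src H b * v))) x"
    by (simp add: Psi_mult[OF lin(2)] Psi_structure)
  finally show ?thesis .
qed

text \<open>This is what lets x act on tensors over the base algebra. The recursion leaves only the
  first tensor sign, where \<open>mt_Cons2\<close> reduces the claim to
  \<open>measuring_balanced\<close>.\<close>

lemma balanced_mt: "balanced (ubimodule H') n G \<Longrightarrow> balanced (ubimodule H) n (\<lambda>us. mt G x us)"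
proof (induction n arbitrary: G x)
  case 0
  then show ?case by simp
next
  case (Suc n)
  note G = Suc.prems
  have m: "multilinear (uscale H') (Suc n) G" using balanced_multilinear[OF G] by simp
  show ?case
  proof (rule balanced_SucI)
    show "Vector_Spaces.linear (bscale (ubimodule H)) (*) (\<lambda>u. mt G x (u # us))" if "length us = n" for us
      unfolding mt.simps bimodule_ubimodule using that H.U.vs
      by (intro C.K.linear_sw linear_mt linear_Psi_head(2)[OF m]) simp_all
    show "balanced (ubimodule H) n (\<lambda>us. mt G x (u # us))" for u
      unfolding mt.simps by (intro C.K.balanced_sw Suc.IH balanced_head(2)[OF G])
    show "mt G x (ract (ubimodule H) b u # v # us) = mt G x (u # lact (ubimodule H) b v # us)"
      if l: "Suc (length us) = n" for b u v us
    proof -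
      have G': "balanced (ubimodule H') (Suc (Suc (length us))) G" using G l by simp
      have m': "multilinear (uscale H') (Suc (Suc (length us))) G" using m l by simp
      show ?thesis unfolding mt_Cons2[OF m'] bimodule_ubimodule
        by (simp add: measuring_balanced[OF bibalanced_mt_head[OF G']])
    qed
  qed
qed

section \<open>Compatibility of the measuring with the cocyclic operators\<close>

lemma mt_one_Cons:
  assumes G: "multilinear (uscale H') (Suc (length us)) G"
  shows "mt G x (1 # us) = mt (\<lambda>vs. G (1 # vs)) x us"
proof -
  have lin: "Vector_Spaces.linear (uscale H') (*) (\<lambda>y. mt (\<lambda>ws. G (y # ws)) b us)" for b
    by (rule linear_mt_head[OF G])
  \<comment> \<open>x_(1)(1) is the counit of x_(1) times 1, so measuring a unit uses up one
    Sweedler factor of x by the counit axiom.\<close>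
  have "mt G x (1 # us) = C.K.sw (\<lambda>a b. ccounit C a * mt (\<lambda>vs. G (1 # vs)) b us) x"
    using lin by (simp add: Psi_structure Vector_Spaces.linear_iff)
  also have "\<dots> = mt (\<lambda>vs. G (1 # vs)) x us"
    by (intro C.sw_counit_left mt_linear multilinear_tail[OF G])
  finally show ?thesis .
qed

lemma mt_snoc_one:
  "multilinear (uscale H') (Suc (length us)) G \<Longrightarrow> mt G x (us @ [1]) = mt (\<lambda>vs. G (vs @ [1])) x us"
proof (induction us arbitrary: G x)
  case Nil
  from mt_one_Cons[of "[]" G x] Nil show ?case by simp
next
  case (Cons u us)
  have "mt (\<lambda>vs. G (\<Psi> a u # vs)) b (us @ [1]) = mt (\<lambda>vs. G (\<Psi> a u # vs @ [1])) b us" for a b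
    using Cons.IH[OF multilinear_tail] Cons.prems by simp
  then show ?case by simp
qed

text \<open>After \<open>mt_Cons2\<close> the two halves of u are measured by the halves of one z,
  and this is the comultiplication of z(u) by the measuring axiom.\<close>

lemma mt_expand:
  "balanced (ubimodule H') (Suc (length us)) G \<Longrightarrow> i < length us \<Longrightarrow>
     H.U.expand i (mt G x) us = mt (H'.U.expand i G) x us"
proof (induction i arbitrary: us G x)
  case 0
  then obtain u bs where us: "us = u # bs" by (cases us) auto
  have G: "balanced (ubimodule H') (Suc (Suc (length bs))) G" using 0 us by simp
  have m: "multilinear (uscale H') (Suc (Suc (length bs))) G" using balanced_multilinear[OF G] by simp
  have "H.U.expand 0 (mt G x) us = H.U.sw (\<lambda>p q. C.K.sw (\<lambda>z d.
      C.K.sw (\<lambda>a c. mt (\<lambda>ws. G (\<Psi> a p # \<Psi> c q # ws)) d bs) z) x) u"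
    by (simp only: us H.U.expand_0 mt_Cons2[OF m])
  also have "\<dots> = C.K.sw (\<lambda>z d. H.U.sw (\<lambda>p q.
      C.K.sw (\<lambda>a c. mt (\<lambda>ws. G (\<Psi> a p # \<Psi> c q # ws)) d bs) z) u) x"
    by (rule sw_csw)
  also have "\<dots> = C.K.sw (\<lambda>z d. H'.U.sw (\<lambda>p q. mt (\<lambda>ws. G (p # q # ws)) d bs) (\<Psi> z u)) x"
    by (simp only: Psi_comult[OF bibalanced_mt_head[OF G]])
  also have "\<dots> = mt (H'.U.expand 0 G) x us"
    by (simp only: us mt.simps H'.U.expand_0 mt_sw)
  finally show ?case .
next
  case (Suc i)
  then obtain u bs where us: "us = u # bs" by (cases us) auto
  have G: "balanced (ubimodule H') (Suc (Suc (length bs))) G" and i: "i < length bs"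
    using Suc.prems us by simp_all
  have "H.U.expand (Suc i) (mt G x) us = C.K.sw (\<lambda>a b. H.U.expand i (mt (\<lambda>vs. G (\<Psi> a u # vs)) b) bs) x"
    by (simp add: us H.U.expand_Suc) (simp only: H.U.expand_def mt.simps sw_csw)
  also have "\<dots> = C.K.sw (\<lambda>a b. mt (H'.U.expand i (\<lambda>vs. G (\<Psi> a u # vs))) b bs) x"
    by (simp only: Suc.IH[OF balanced_head(2)[OF G] i])
  also have "\<dots> = mt (H'.U.expand (Suc i) G) x us"
    by (simp add: us H'.U.expand_Suc)
  finally show ?case .
qed

text \<open>Each step of the iteration splits the first factor, where \<open>mt_expand\<close>
  applies.\<close>

lemma it_Psi:
  "balanced (ubimodule H') (Suc k) G \<Longrightarrow> H'.U.it k G (\<Psi> x w) = H.U.it k (mt G x) w"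
proof (induction k arbitrary: G)
  case 0
  have "balanced (ubimodule H) 1 (mt G x)" "multilinear (uscale H') 1 G"
    using balanced_mt[OF 0] balanced_multilinear[OF 0] by simp_all
  then show ?case using 0 by (simp add: H.U.it_0 H'.U.it_0 mt_single del: mt.simps)
next
  case (Suc k)
  have "H'.U.it (Suc k) G (\<Psi> x w) = H.U.it k (mt (H'.U.expand 0 G) x) w"
    by (simp add: H'.U.it_Suc[OF Suc.prems] Suc.IH[OF H'.U.balanced_expand[OF Suc.prems]])
  also have "\<dots> = H.U.it k (H.U.expand 0 (mt G x)) w"
    using Suc.prems by (intro H.U.it_cong mt_expand[symmetric]) simp_all
  also have "\<dots> = H.U.it (Suc k) (mt G x) w"
    by (simp add: H.U.it_Suc[OF balanced_mt[OF Suc.prems]])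
  finally show ?case .
qed

lemma multilinear_mt:
  assumes "\<And>ps. length ps = length us \<Longrightarrow> multilinear sc n (\<lambda>qs. F qs ps)" "vector_space sc"
  shows "multilinear sc n (\<lambda>qs. mt (F qs) x us)"
  unfolding multilinear_def
proof (intro allI impI)
  fix xs ys :: "'d list" assume l: "length xs + length ys + 1 = n"
  show "Vector_Spaces.linear sc (*) (\<lambda>y. mt (F (xs @ y # ys)) x us)"
    by (intro linear_mt assms(2) multilinearD[OF assms(1) l])
qed

text \<open>Multiplicativity gives x_(1)(v_1) x_(2)(w_1) (x) x_(3)(v_2) x_(4)(w_2) and so on; each
  step of the induction sorts one pair, so that one half of x measures the v's and the other the
  w's. The function is multilinear rather than balanced because the products are of lists, not of
  tensors.\<close>

lemma mt_mult:
  "multilinear (uscale H') n G \<Longrightarrow> length vs = n \<Longrightarrow> length ws = n \<Longrightarrow>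
     mt G x (map2 (*) vs ws) =
       C.K.sw (\<lambda>a b. mt (\<lambda>qs. mt (\<lambda>ps. G (map2 (*) ps qs)) a vs) b ws) x"
proof (induction n arbitrary: G vs ws x)
  case 0
  have "C.K.sw (\<lambda>a b. ccounit C a * (ccounit C b * G [])) x = ccounit C x * G []"
    using C.counit_linear
    by (intro C.sw_counit_left) (auto simp: Vector_Spaces.linear_iff algebra_simps)
  then show ?case using 0 by (simp add: mult.left_commute)
next
  case (Suc n)
  obtain v vs' w ws' where vs: "vs = v # vs'" "length vs' = n" and ws: "ws = w # ws'" "length ws' = n"
    using Suc.prems(2,3) by (cases vs; cases ws) auto
  note G = Suc.prems(1)
  \<comment> \<open>The four arguments are the Sweedler factors of x that act on v, on w, and on the
    rests of the two lists.\<close>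
  define Q where "Q c d e f = mt (\<lambda>qs. mt (\<lambda>ps. G (\<Psi> c v * \<Psi> d w # map2 (*) ps qs)) e vs') f ws'" for c d e f
  have l2: "Vector_Spaces.linear (uscale H') (*) (\<lambda>y. mt (\<lambda>qs. mt (\<lambda>ps. G (y # map2 (*) ps qs)) e vs') f ws')" for e f
    using G vs ws by (intro linear_mt H'.U.vs[simplified]) (simp add: multilinear_Suc)
  have lin: "Vector_Spaces.linear (cscale C) (*) (\<lambda>c. Q c d e f)"
    "Vector_Spaces.linear (cscale C) (*) (\<lambda>d. Q c d e f)"
    "Vector_Spaces.linear (cscale C) (*) (\<lambda>e. Q c d e f)"
    "Vector_Spaces.linear (cscale C) (*) (\<lambda>f. Q c d e f)" for c d e f
  proof -
    show "Vector_Spaces.linear (cscale C) (*) (\<lambda>c. Q c d e f)"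
      unfolding Q_def
      using linear_compose_functional[OF linear_compose_functional[OF l2 H'.linear_mult_right] Psi_linear(2)] .
    show "Vector_Spaces.linear (cscale C) (*) (\<lambda>d. Q c d e f)"
      unfolding Q_def
      using linear_compose_functional[OF linear_compose_functional[OF l2 H'.linear_mult_left] Psi_linear(2)] .
    show "Vector_Spaces.linear (cscale C) (*) (\<lambda>e. Q c d e f)"
      unfolding Q_def using vs ws
      by (intro linear_mt C.vector_space mt_linear H'.multilinear_mult_right)
        (simp_all add: multilinear_tail[OF G])
    show "Vector_Spaces.linear (cscale C) (*) (\<lambda>f. Q c d e f)"
      unfolding Q_def using vs ws
      by (intro mt_linear multilinear_mt H'.U.vs[simplified] H'.multilinear_mult_left)
        (simp_all add: multilinear_tail[OF G])
  qed
  have "mt G x (map2 (*) vs ws) =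
      C.K.sw (\<lambda>a b. mt (\<lambda>rs. G (\<Psi> a (v * w) # rs)) b (map2 (*) vs' ws')) x"
    by (simp add: vs ws)
  also have "\<dots> = C.K.sw (\<lambda>a b. C.K.sw (\<lambda>c d. mt (\<lambda>rs. G (\<Psi> c v * \<Psi> d w # rs)) b (map2 (*) vs' ws')) a) x"
  proof -
    have "Vector_Spaces.linear (uscale H') (*) (\<lambda>y. mt (\<lambda>rs. G (y # rs)) b (map2 (*) vs' ws'))" for b
      using G vs ws by (intro linear_mt_head) simp
    from Psi_mult[OF this] show ?thesis by simp
  qed
  also have "\<dots> = C.K.sw (\<lambda>a b. C.K.sw (\<lambda>c d. C.K.sw (\<lambda>e f. Q c d e f) b) a) x"
    by (simp add: Suc.IH[OF multilinear_tail[OF G] vs(2) ws(2)] Q_def)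
  also have "\<dots> = C.K.sw (\<lambda>a b. C.K.sw (\<lambda>c e. C.K.sw (\<lambda>d f. Q c d e f) b) a) x"
    by (intro C.sw_interchange lin)
  also have "\<dots> = C.K.sw (\<lambda>a b. mt (\<lambda>qs. mt (\<lambda>ps. G (map2 (*) ps qs)) a vs) b ws) x"
    by (simp add: vs ws Q_def mt_csw)
  finally show ?case .
qed

text \<open>The first Sweedler factor of x acts on the antipode of u, and \<open>it_Psi\<close>
  spreads it over the iterated comultiplication, while the others act on the remaining entries.
  \<open>mt_mult\<close> recognizes this as x acting on the factorwise products.\<close>

lemma mt_rotate:
  assumes G: "balanced (ubimodule H') (Suc k) G" and us: "length us = Suc k"
  shows "H.rotate k (mt G x) us = mt (H'.rotate k G) x us"
proof -
  obtain u ws where ws: "us = u # ws" "length ws = k" using us by (cases us) auto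
  have m: "multilinear (uscale H') (Suc k) G" using balanced_multilinear[OF G] by simp
  have "mt (H'.rotate k G) x us =
      C.K.sw (\<lambda>a b. mt (\<lambda>qs. H'.U.it k (\<lambda>vs. G (map2 (*) vs (qs @ [1]))) (\<Psi> a (antipode H u))) b ws) x"
    by (simp add: ws H'.rotate_def Psi_structure)
  also have "\<dots> = C.K.sw (\<lambda>a b. mt (\<lambda>qs. H.U.it k (mt (\<lambda>vs. G (map2 (*) vs (qs @ [1]))) a) (antipode H u)) b ws) x"
  proof -
    have "H'.U.it k (\<lambda>vs. G (map2 (*) vs (qs @ [1]))) (\<Psi> a w) =
        H.U.it k (mt (\<lambda>vs. G (map2 (*) vs (qs @ [1]))) a) w" if "length qs = k" for a qs w
      using that by (intro it_Psi H'.balanced_mult_right[OF G]) simp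
    then show ?thesis using ws(2) by (intro arg_cong[where f = "\<lambda>g. C.K.sw g x"] ext mt_cong) simp
  qed
  also have "\<dots> = H.U.it k (\<lambda>vs. C.K.sw (\<lambda>a b. mt (\<lambda>qs. mt (\<lambda>ps. G (map2 (*) ps (qs @ [1]))) a vs) b ws) x) (antipode H u)"
    by (simp add: H.U.it_def mt_ev C.K.sw_ev)
  also have "\<dots> = H.U.it k (\<lambda>vs. mt G x (map2 (*) vs (ws @ [1]))) (antipode H u)"
  proof (rule H.U.it_cong)
    fix vs :: "'u list" assume vs: "length vs = Suc k"
    \<comment> \<open>The appended unit costs only a counit, so it may be appended before or after
      measuring.\<close>
    have "mt (\<lambda>qs. mt (\<lambda>ps. G (map2 (*) ps qs)) a vs) b (ws @ [1]) =
        mt (\<lambda>qs. mt (\<lambda>ps. G (map2 (*) ps (qs @ [1]))) a vs) b ws" for a b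
      using ws vs
      by (intro mt_snoc_one multilinear_mt H'.U.vs[simplified] H'.multilinear_mult_left) (simp_all add: m)
    then show "C.K.sw (\<lambda>a b. mt (\<lambda>qs. mt (\<lambda>ps. G (map2 (*) ps (qs @ [1]))) a vs) b ws) x =
        mt G x (map2 (*) vs (ws @ [1]))"
      using mt_mult[OF m vs, of "ws @ [1]" x] ws by simp
  qed
  also have "\<dots> = H.rotate k (mt G x) us"
    by (simp add: H.rotate_def ws)
  finally show ?thesis ..
qed

text \<open>Measuring the merged factor by z lets z_(1) act on u under the counit and z_(2) on v,
  the same order as in the tensor, so \<open>mt_Cons2\<close> applies directly.\<close>

lemma mt_contract:
  "balanced (ubimodule H') (Suc n) G \<Longrightarrow> i \<le> n \<Longrightarrow> length us = Suc (Suc n) \<Longrightarrow>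
     H.contract i (mt G x) us = mt (H'.contract i G) x us"
proof (induction i arbitrary: n us G x)
  case 0
  obtain u v bs where us: "us = u # v # bs" "length bs = n"
    using 0(3) by (auto simp: length_Suc_conv)
  have m: "multilinear (uscale H') (Suc (length bs)) G" using balanced_multilinear[OF 0(1)] us by simp
  have "balanced (ubimodule H') (Suc (Suc (length bs))) (H'.contract 0 G)"
    using H'.balanced_contract[OF 0(1,2)] us by simp
  from balanced_multilinear[OF this]
  have m': "multilinear (uscale H') (Suc (Suc (length bs))) (H'.contract 0 G)" by simp
  have "H.contract 0 (mt G x) us =
      C.K.sw (\<lambda>z d. C.K.sw (\<lambda>a c. mt (\<lambda>ws. G (src H' (counit H' (\<Psi> a u)) * \<Psi> c v # ws)) d bs) z) x"
    by (simp add: us H.contract_0 Psi_mult[OF linear_mt_head[OF m]] Psi_structure)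
  also have "\<dots> = mt (H'.contract 0 G) x us"
    unfolding us(1) mt_Cons2[OF m'] by (simp add: H'.contract_0)
  finally show ?case .
next
  case (Suc i)
  obtain m where n: "n = Suc m" "i \<le> m" using Suc.prems(2) by (cases n) auto
  obtain u bs where us: "us = u # bs" "length bs = Suc (Suc m)"
    using Suc.prems(3) n by (cases us) auto
  note G = Suc.prems(1)[unfolded n]
  have "H.contract (Suc i) (mt G x) us = C.K.sw (\<lambda>a b. H.contract i (mt (\<lambda>vs. G (\<Psi> a u # vs)) b) bs) x"
    by (simp add: us H.contract_Suc) (simp only: H.contract_def mt.simps)
  also have "\<dots> = C.K.sw (\<lambda>a b. mt (H'.contract i (\<lambda>vs. G (\<Psi> a u # vs))) b bs) x"
    by (simp only: Suc.IH[OF balanced_head(2)[OF G] n(2) us(2)])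
  also have "\<dots> = mt (H'.contract (Suc i) G) x us"
    by (simp add: us H'.contract_Suc)
  finally show ?case .
qed

text \<open>Here the counit of the later factor v stands to the left of u, so measuring assigns
  x_(1) to v and x_(2) to u, against the order of the tensor; cocommutativity restores it.\<close>

lemma mt_contract_last:
  "balanced (ubimodule H') (Suc n) G \<Longrightarrow> length us = Suc (Suc n) \<Longrightarrow>
     H.contract_last n (mt G x) us = mt (H'.contract_last n G) x us"
proof (induction n arbitrary: us G x)
  case 0
  obtain u v where us: "us = [u, v]" using 0(2) by (auto simp: length_Suc_conv)
  have m: "multilinear (uscale H') 1 G" using balanced_multilinear[OF 0(1)] by simp
  have lin: "Vector_Spaces.linear (uscale H') (*) (\<lambda>y. G [y])"
    using balanced_head(1)[OF 0(1), of "[]"] by simp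
  have m': "multilinear (uscale H') (Suc (Suc 0)) (H'.contract_last 0 G)"
    using balanced_multilinear[OF H'.balanced_contract_last[OF 0(1)]] by simp
  have lin': "Vector_Spaces.linear (cscale C) (*) (\<lambda>p. G [tgt H' (counit H' (\<Psi> p v)) * \<Psi> q u])"
    "Vector_Spaces.linear (cscale C) (*) (\<lambda>q. G [tgt H' (counit H' (\<Psi> p v)) * \<Psi> q u])" for p q
    using linear_compose_functional[OF linear_compose_functional[OF lin H'.linear_counit_src(2)] Psi_linear(2)]
     linear_compose_functional[OF linear_compose_functional[OF lin H'.linear_mult_left] Psi_linear(2)]
    by auto
  have "H.contract_last 0 (mt G x) us = G [\<Psi> x (tgt H (counit H v) * u)]"
    unfolding us H.contract_last_0 by (rule mt_single[OF m])
  also have "\<dots> = C.K.sw (\<lambda>p q. G [tgt H' (counit H' (\<Psi> p v)) * \<Psi> q u]) x"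
    by (simp add: Psi_mult[OF lin] Psi_structure)
  also have "\<dots> = C.K.sw (\<lambda>q p. G [tgt H' (counit H' (\<Psi> p v)) * \<Psi> q u]) x"
    by (intro C.sw_commute lin')
  also have "\<dots> = C.K.sw (\<lambda>q p. H'.contract_last 0 G [\<Psi> q u, \<Psi> p v]) x"
    by (simp add: H'.contract_last_0)
  also have "\<dots> = mt (H'.contract_last 0 G) x us"
    unfolding us mt.simps(2)[of _ _ u] using multilinear_tail[OF m'] by (simp add: mt_single del: mt.simps)
  finally show ?case .
next
  case (Suc m)
  obtain u bs where us: "us = u # bs" "length bs = Suc (Suc m)"
    using Suc.prems(2) by (cases us) auto
  note G = Suc.prems(1)
  have "H.contract_last (Suc m) (mt G x) us = C.K.sw (\<lambda>a b. H.contract_last m (mt (\<lambda>vs. G (\<Psi> a u # vs)) b) bs) x"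
    by (simp add: us H.contract_last_Suc) (simp only: H.contract_last_def mt.simps)
  also have "\<dots> = C.K.sw (\<lambda>a b. mt (H'.contract_last m (\<lambda>vs. G (\<Psi> a u # vs))) b bs) x"
    by (simp only: Suc.IH[OF balanced_head(2)[OF G] us(2)])
  also have "\<dots> = mt (H'.contract_last (Suc m) G) x us"
    by (simp add: us H'.contract_last_Suc)
  finally show ?case .
qed

lemma multilinear_Psi:
  "multilinear (uscale H') (length us) G \<Longrightarrow> multilinear (cscale C) (length us) (\<lambda>xs. G (map2 \<Psi> xs us))"
proof (induction us arbitrary: G)
  case Nil
  then show ?case by (simp add: multilinear_def)
next
  case (Cons u us)
  have G: "multilinear (uscale H') (Suc (length us)) G" using Cons.prems by simp
  have "Vector_Spaces.linear (cscale C) (*) (\<lambda>x. G (map2 \<Psi> (x # vs) (u # us)))" if "length vs = length us" for vs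
    using linear_Psi_head(1)[OF G] that by simp
  moreover have "multilinear (cscale C) (length us) (\<lambda>vs. G (map2 \<Psi> (x # vs) (u # us)))" for x
    using Cons.IH[OF multilinear_tail[OF G]] by simp
  ultimately show ?case by (simp add: multilinear_Suc)
qed

text \<open>Reconciles the recursion of \<open>mt\<close>, which splits off the first Sweedler
  factor of x, with the iterated comultiplication in \<open>measured_tensor\<close>; the bridge is
  \<open>it_Cons\<close>.\<close>

lemma it_map2_Psi:
  "multilinear (uscale H') (Suc k) G \<Longrightarrow> length us = Suc k \<Longrightarrow> C.K.it k (\<lambda>xs. G (map2 \<Psi> xs us)) x = mt G x us"
proof (induction k arbitrary: us G x)
  case 0
  then obtain u where us: "us = [u]" by (auto simp: length_Suc_conv)
  have "balanced (cbimodule C) 1 (\<lambda>xs. G (map2 \<Psi> xs us))"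
    using multilinear_Psi[of us G] 0 us by (simp add: balanced_cbimodule)
  then have "C.K.it 0 (\<lambda>xs. G (map2 \<Psi> xs us)) x = G [\<Psi> x u]" by (simp add: C.K.it_0 us)
  also have "\<dots> = mt G x us" unfolding us using 0 by (intro mt_single[symmetric]) simp
  finally show ?case .
next
  case (Suc k)
  then obtain u ws where us: "us = u # ws" "length ws = Suc k" by (cases us) auto
  have "balanced (cbimodule C) (Suc (Suc k)) (\<lambda>xs. G (map2 \<Psi> xs us))"
    using multilinear_Psi[of us G] Suc.prems by (simp add: balanced_cbimodule)
  from C.K.it_Cons[OF this] show ?case
    using Suc.IH[OF multilinear_tail[OF Suc.prems(1)] us(2)] by (simp add: us)
qed

lemma measured_closed:
  assumes "length us = n" "n \<noteq> 0" shows "measured_tensor C H' \<Psi> x us \<in> carrier (utensor H' n)"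
  unfolding measured_tensor_def assms(1) using assms
  by (intro sweedler_closed[OF kspace_tensor_power C.K.iter_closed] pure_tensor_closed) simp

lemma ev_measured:
  assumes G: "balanced (ubimodule H') n G" and us: "length us = n" "n \<noteq> 0"
  shows "ev G (measured_tensor C H' \<Psi> x us) = mt G x us"
proof -
  obtain k where k: "n = Suc k" using us by (cases n) auto
  have "ev G (measured_tensor C H' \<Psi> x us) =
      ev (\<lambda>xs. ev G (upure H' (map2 \<Psi> xs us))) (iter_comult (cbimodule C) (ccomult C) k x)"
    unfolding measured_tensor_def us(1) using us k
    by (subst ev_sweedler[OF G C.K.iter_closed]) (auto intro!: pure_tensor_closed)
  also have "\<dots> = C.K.it k (\<lambda>xs. G (map2 \<Psi> xs us)) x"
    unfolding C.K.it_def using us k by (intro ev_cong[OF C.K.iter_closed] ev_pure[OF G]) simp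
  also have "\<dots> = mt G x us"
    using balanced_multilinear[OF G] us k by (intro it_map2_Psi) simp_all
  finally show ?thesis .
qed

end

section \<open>The cocyclic module of a Hopf algebroid\<close>

text \<open>A nonzero difference y - z is independent, so some functional takes the value 1 on it.
  In degree 0, where cochains are elements of the base algebra, this takes the part of
  \<open>tensor_eqI\<close>.\<close>

lemma linear_functional_separates:
  fixes s :: "'k::field \<Rightarrow> 'v::ab_group_add \<Rightarrow> 'v"
  assumes s: "vector_space s" and eq: "\<And>\<phi>. Vector_Spaces.linear s (*) \<phi> \<Longrightarrow> \<phi> y = \<phi> z"
  shows "y = z"
proof (rule ccontr)
  assume "y \<noteq> z"
  interpret vector_space_pair s "(*) :: 'k \<Rightarrow> 'k \<Rightarrow> 'k"
    by (intro vector_space_pair.intro s vector_space_times)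
  have "vs1.independent {y - z}"
    using \<open>y \<noteq> z\<close> vs1.independent_insertI[of "y - z" "{}"] by simp
  then obtain \<phi> where \<phi>: "Vector_Spaces.linear s (*) \<phi>" "\<phi> (y - z) = 1"
    using linear_independent_extend[of "{y - z}" "\<lambda>_. 1"] by auto
  interpret l: Vector_Spaces.linear s "(*)" \<phi> by (rule \<phi>(1))
  show False using eq[OF \<phi>(1)] \<phi>(2) by (simp add: l.diff)
qed

lemma hopf_obj_0: "hopf_obj H 0 = image_module Inl projl (vector_module (ascale H))"
  and hopf_obj_Suc: "n \<noteq> 0 \<Longrightarrow> hopf_obj H n = image_module Inr projr (utensor H n)"
  by (simp_all add: hopf_obj_def)

lemma carrier_image_module: "carrier (image_module e r M) = e ` carrier M"
  by (simp add: image_module_def)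

context hopf_algebroid
begin

text \<open>The function under the Sweedler sum in \<open>hopf_coface\<close>, named so that it can
  be matched with its transpose \<open>coface_ev\<close>. The codegeneracies and the cyclic operator
  are split in the same way.\<close>

definition coface_tensor :: "nat \<Rightarrow> nat \<Rightarrow> 'u list \<Rightarrow> ('u list \<Rightarrow>\<^sub>0 'k) set" where
  "coface_tensor n i us = (if i = 0 then upure H (1 # us)
     else if i = Suc n then upure H (us @ [1])
     else comult_at (ubimodule H) (comult H) (i - 1) us)"

definition coface_ev :: "nat \<Rightarrow> nat \<Rightarrow> ('u list \<Rightarrow> 'k) \<Rightarrow> 'u list \<Rightarrow> 'k" where
  "coface_ev n i G us = (if i = 0 then G (1 # us) else if i = Suc n then G (us @ [1])
     else U.expand (i - 1) G us)"

definition codegeneracy_tensor :: "nat \<Rightarrow> nat \<Rightarrow> 'u list \<Rightarrow> ('u list \<Rightarrow>\<^sub>0 'k) set" where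
  "codegeneracy_tensor n i us = (if i < n - 1
     then upure H (take i us @ [src H (counit H (us ! i)) * us ! (i + 1)] @ drop (i + 2) us)
     else upure H (take (n - 2) us @ [tgt H (counit H (us ! (n - 1))) * us ! (n - 2)]))"

definition cyclic_tensor :: "nat \<Rightarrow> 'u list \<Rightarrow> ('u list \<Rightarrow>\<^sub>0 'k) set" where
  "cyclic_tensor n us = sweedler (utensor H n) (\<lambda>vs. upure H (map2 (*) vs (tl us @ [1])))
     (iter_comult (ubimodule H) (comult H) (n - 1) (antipode H (hd us)))"

lemma coface_tensor_closed:
  "length us = n \<Longrightarrow> i \<le> Suc n \<Longrightarrow> coface_tensor n i us \<in> carrier (utensor H (Suc n))"
  by (auto simp: coface_tensor_def intro!: pure_tensor_closed U.comult_at_closed)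

lemma ev_coface_tensor:
  "balanced (ubimodule H) (Suc n) G \<Longrightarrow> length us = n \<Longrightarrow> i \<le> Suc n \<Longrightarrow>
     ev G (coface_tensor n i us) = coface_ev n i G us"
  by (auto simp: coface_tensor_def coface_ev_def ev_pure U.ev_comult_at)

lemma balanced_coface_ev:
  assumes "balanced (ubimodule H) (Suc n) G" "i \<le> Suc n" shows "balanced (ubimodule H) n (coface_ev n i G)"
proof -
  have "coface_ev n i G = (if i = 0 then \<lambda>us. G (1 # us) else if i = Suc n then \<lambda>us. G (us @ [1])
     else U.expand (i - 1) G)" by (auto simp: coface_ev_def)
  then show ?thesis using assms
    by (auto intro!: balanced_head(2)[OF assms(1)] balanced_snoc_one U.balanced_expand)
qed

lemma codegeneracy_tensor_closed:
  assumes "length us = Suc (Suc m)" "i < Suc (Suc m)"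
  shows "codegeneracy_tensor (Suc (Suc m)) i us \<in> carrier (utensor H (Suc m))"
  using assms by (auto simp: codegeneracy_tensor_def intro!: pure_tensor_closed)

text \<open>With n = m + 2 the test i < n - 1 reads i \<le> m, and n - 2 = m is the place on which
  the last counit acts. Degree 1 is separate, as its codegeneracy lands in the base algebra.\<close>

lemma ev_codegeneracy_tensor:
  assumes "balanced (ubimodule H) (Suc m) G" "length us = Suc (Suc m)" "i < Suc (Suc m)"
  shows "ev G (codegeneracy_tensor (Suc (Suc m)) i us) =
    (if i \<le> m then contract i G us else contract_last m G us)"
  using assms by (auto simp: codegeneracy_tensor_def contract_def contract_last_def ev_pure)

lemma cyclic_tensor_closed:
  "length us = Suc k \<Longrightarrow> cyclic_tensor (Suc k) us \<in> carrier (utensor H (Suc k))"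
  unfolding cyclic_tensor_def diff_Suc_1
  by (rule sweedler_closed[OF kspace_tensor_power U.iter_closed]) (simp add: pure_tensor_closed)

lemma ev_cyclic_tensor:
  assumes G: "balanced (ubimodule H) (Suc k) G" and us: "length us = Suc k"
  shows "ev G (cyclic_tensor (Suc k) us) = rotate k G us"
proof -
  have "ev G (cyclic_tensor (Suc k) us) = ev (\<lambda>vs. ev G (upure H (map2 (*) vs (tl us @ [1]))))
     (iter_comult (ubimodule H) (comult H) k (antipode H (hd us)))"
    unfolding cyclic_tensor_def diff_Suc_1 using us
    by (intro ev_sweedler[OF G U.iter_closed] pure_tensor_closed) simp
  also have "\<dots> = rotate k G us"
    unfolding rotate_def U.it_def using us by (intro ev_cong[OF U.iter_closed] ev_pure[OF G]) simp
  finally show ?thesis .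
qed

lemma hopf_coface_Inr: "hopf_coface H n i (Inr X) = Inr (sweedler (utensor H (Suc n)) (coface_tensor n i) X)"
  by (simp add: hopf_coface_def coface_tensor_def[abs_def])

lemma hopf_codegeneracy_Inr:
  "n \<noteq> 1 \<Longrightarrow> hopf_codegeneracy H n i (Inr X) = Inr (sweedler (utensor H (n - 1)) (codegeneracy_tensor n i) X)"
  by (simp add: hopf_codegeneracy_def codegeneracy_tensor_def[abs_def])

lemma hopf_cyclic_Inr: "hopf_cyclic H n (Inr X) = Inr (sweedler (utensor H n) (cyclic_tensor n) X)"
  by (simp add: hopf_cyclic_def cyclic_tensor_def[abs_def])

lemma kspace_A: "kspace (vector_module (ascale H))"
  using k_algebra.axioms(1)[OF algebra_A] by (rule kspace_vector_module)

text \<open>On a one-factor power the balanced functions are the linear ones, so a pure tensor is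
  linear in its entry. Source and target give the two cofaces out of degree 0.\<close>

lemma linear_upure:
  assumes "Vector_Spaces.linear (ascale H) (uscale H) f"
  shows "linear_on (vector_module (ascale H)) (utensor H 1) (\<lambda>a. upure H [f a])"
proof -
  interpret T: kspace "utensor H 1" by (rule kspace_tensor_power)
  have lin: "Vector_Spaces.linear (uscale H) (*) (\<lambda>x. G [x])" if "balanced (ubimodule H) 1 G" for G
    using balanced_head(1)[of "ubimodule H" 0 G "[]"] that by simp
  have cl: "upure H [u] \<in> carrier (utensor H 1)" for u by (simp add: pure_tensor_closed)
  have add: "upure H [u + v] = upure H [u] \<oplus>\<^bsub>utensor H 1\<^esub> upure H [v]" for u v
    using lin by (intro tensor_eqI[OF U.vs, of _ 1] T.a_closed cl)
      (simp add: ev_tensor_add cl ev_pure Vector_Spaces.linear_iff del: One_nat_def)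
  have scale: "upure H [uscale H c u] = c \<odot>\<^bsub>utensor H 1\<^esub> upure H [u]" for c u
    using lin by (intro tensor_eqI[OF U.vs, of _ 1] T.smult_closed cl)
      (simp add: ev_tensor_smult cl ev_pure Vector_Spaces.linear_iff del: One_nat_def)
  show ?thesis using assms
    by (simp add: linear_on_def vector_module_def cl add scale Vector_Spaces.linear_iff del: One_nat_def)
qed

text \<open>A Sweedler map is linear once its family respects the relators, which is the balance of
  the transposes \<open>coface_ev\<close> and \<open>rotate\<close>.\<close>

lemma cocyclic_space_hopf: "cocyclic_space (hopf_cocyclic H)"
proof (rule cocyclic_space.intro, unfold hopf_cocyclic_def cocyclic.simps)
  show obj: "kspace (hopf_obj H n)" for n
    by (cases "n = 0") (auto simp: hopf_obj_def intro!: kspace_image_module kspace_A kspace_tensor_power)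
  show "linear_on (hopf_obj H n) (hopf_obj H (Suc n)) (hopf_coface H n i)" if i: "i \<le> Suc n" for n i
  proof (cases "n = 0")
    case True
    have "linear_on (vector_module (ascale H)) (utensor H 1) (\<lambda>a. upure H [if i = 0 then tgt H a else src H a])"
      using linear_upure[OF tgt_linear] linear_upure[OF src_linear] by (cases "i = 0") simp_all
    then show ?thesis
      unfolding True hopf_obj_0 One_nat_def[symmetric] hopf_obj_Suc[OF one_neq_zero]
      by (intro linear_on_image_module[where f = "\<lambda>a. upure H [if i = 0 then tgt H a else src H a]"] kspace_A)
        (simp_all add: hopf_coface_def)
  next
    case False
    have "linear_on (utensor H n) (utensor H (Suc n)) (sweedler (utensor H (Suc n)) (coface_tensor n i))"
    proof (intro linear_on_sweedler_tensor U.vs coface_tensor_closed i)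
      fix G assume G: "balanced (ubimodule H) (Suc n) G"
      show "balanced (ubimodule H) n (\<lambda>us. ev G (coface_tensor n i us))"
        by (rule balanced_cong[OF balanced_coface_ev[OF G i] ev_coface_tensor[OF G _ i]])
    qed
    then show ?thesis
      unfolding hopf_obj_Suc[OF False] hopf_obj_Suc[OF Suc_not_Zero]
      by (intro linear_on_image_module[where f = "sweedler (utensor H (Suc n)) (coface_tensor n i)"]
          kspace_tensor_power) (simp_all add: hopf_coface_Inr)
  qed
  show "linear_on (hopf_obj H n) (hopf_obj H n) (hopf_cyclic H n)" for n
  proof (cases n)
    case 0
    have "linear_on (vector_module (ascale H)) (vector_module (ascale H)) (\<lambda>a. a)"
      by (simp add: linear_on_def)
    then show ?thesis unfolding 0 hopf_obj_0
      by (rule linear_on_image_module[rotated 2]) (simp_all add: hopf_cyclic_def kspace_A)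
  next
    case (Suc k)
    have "linear_on (utensor H n) (utensor H n) (sweedler (utensor H n) (cyclic_tensor n))"
      unfolding Suc
    proof (intro linear_on_sweedler_tensor U.vs cyclic_tensor_closed)
      fix G assume G: "balanced (ubimodule H) (Suc k) G"
      show "balanced (ubimodule H) (Suc k) (\<lambda>us. ev G (cyclic_tensor (Suc k) us))"
        by (rule balanced_cong[OF balanced_rotate[OF G] ev_cyclic_tensor[OF G]])
    qed
    then show ?thesis using Suc
      by (simp add: hopf_obj_Suc)
        (rule linear_on_image_module[rotated 2], simp_all add: hopf_cyclic_Inr kspace_tensor_power)
  qed
qed

end

section \<open>The measuring map as a morphism of cocyclic modules\<close>

context hopf_algebroid_measuring
begin

abbreviation "measured_map n x X \<equiv> sweedler (utensor H' n) (measured_tensor C H' \<Psi> x) X"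

lemma ev_measured_map:
  assumes "balanced (ubimodule H') n G" "X \<in> carrier (utensor H n)" "n \<noteq> 0"
  shows "ev G (measured_map n x X) = ev (mt G x) X"
proof -
  have "ev G (measured_map n x X) = ev (\<lambda>us. ev G (measured_tensor C H' \<Psi> x us)) X"
    by (intro ev_sweedler[OF assms(1,2)] measured_closed assms(3))
  also have "\<dots> = ev (mt G x) X"
    by (intro ev_cong[OF assms(2)] ev_measured[OF assms(1)] assms(3))
  finally show ?thesis .
qed

lemma measured_map_closed:
  "X \<in> carrier (utensor H n) \<Longrightarrow> n \<noteq> 0 \<Longrightarrow> measured_map n x X \<in> carrier (utensor H' n)"
  by (rule sweedler_closed[OF kspace_tensor_power]) (simp, rule measured_closed)

lemma measured_map_linear:
  assumes "n \<noteq> 0" shows "linear_on (utensor H n) (utensor H' n) (measured_map n x)"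
proof (intro linear_on_sweedler_tensor H'.U.vs measured_closed assms)
  fix G assume G: "balanced (ubimodule H') n G"
  show "balanced (ubimodule H) n (\<lambda>us. ev G (measured_tensor C H' \<Psi> x us))"
    by (rule balanced_cong[OF balanced_mt[OF G] ev_measured[OF G _ assms]])
qed

text \<open>The representative chosen for a pure tensor may be a combination of many words; balance
  of \<open>mt\<close> makes the outcome that of the single word.\<close>

lemma measured_map_pure:
  assumes "us \<noteq> []" shows "measured_map (length us) x (upure H us) = measured_tensor C H' \<Psi> x us"
  using assms
  by (intro tensor_eqI[OF H'.U.vs, of _ "length us"] measured_map_closed measured_closed)
    (simp_all add: ev_measured_map pure_tensor_closed ev_measured ev_pure[OF balanced_mt])

text \<open>\<open>L\<close> and \<open>L'\<close> are the transposes of one operator on the two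
  sides, and \<open>comm\<close> is the identity of functions of lists that remains. It covers every
  operator between positive degrees.\<close>

lemma measured_map_commute:
  assumes n: "n \<noteq> 0" "m \<noteq> 0" and X: "X \<in> carrier (utensor H n)"
    and f: "\<And>us. length us = n \<Longrightarrow> f us \<in> carrier (utensor H m)"
    and f': "\<And>us. length us = n \<Longrightarrow> f' us \<in> carrier (utensor H' m)"
    and L: "\<And>G us. balanced (ubimodule H) m G \<Longrightarrow> length us = n \<Longrightarrow> ev G (f us) = L G us"
    and L': "\<And>G us. balanced (ubimodule H') m G \<Longrightarrow> length us = n \<Longrightarrow> ev G (f' us) = L' G us"
    and bal: "\<And>G. balanced (ubimodule H') m G \<Longrightarrow> balanced (ubimodule H') n (L' G)"
    and comm: "\<And>G us. balanced (ubimodule H') m G \<Longrightarrow> length us = n \<Longrightarrow> L (mt G x) us = mt (L' G) x us"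
  shows "measured_map m x (sweedler (utensor H m) f X) = sweedler (utensor H' m) f' (measured_map n x X)"
proof (rule tensor_eqI[OF H'.U.vs, of _ m])
  have fX: "sweedler (utensor H m) f X \<in> carrier (utensor H m)"
    by (rule sweedler_closed[OF kspace_tensor_power X f])
  show "measured_map m x (sweedler (utensor H m) f X) \<in> carrier (utensor H' m)"
    by (rule measured_map_closed[OF fX n(2)])
  note mX = measured_map_closed[OF X n(1), of x]
  show "sweedler (utensor H' m) f' (measured_map n x X) \<in> carrier (utensor H' m)"
    by (rule sweedler_closed[OF kspace_tensor_power mX f'])
  fix G assume G: "balanced (ubimodule H') m G"
  have "ev G (measured_map m x (sweedler (utensor H m) f X)) = ev (\<lambda>us. ev (mt G x) (f us)) X"
    by (simp add: ev_measured_map[OF G fX n(2)] ev_sweedler[OF balanced_mt[OF G] X f])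
  also have "\<dots> = ev (mt (L' G) x) X"
    by (intro ev_cong[OF X]) (simp add: L[OF balanced_mt[OF G]] comm[OF G])
  also have "\<dots> = ev (L' G) (measured_map n x X)"
    by (simp add: ev_measured_map[OF bal[OF G] X n(1)])
  also have "\<dots> = ev (\<lambda>us. ev G (f' us)) (measured_map n x X)"
    by (intro ev_cong[OF mX]) (simp add: L'[OF G])
  also have "\<dots> = ev G (sweedler (utensor H' m) f' (measured_map n x X))"
    by (rule ev_sweedler[OF G mX f', symmetric])
  finally show "ev G (measured_map m x (sweedler (utensor H m) f X)) =
      ev G (sweedler (utensor H' m) f' (measured_map n x X))" .
qed

lemma mt_coface_ev:
  assumes G: "balanced (ubimodule H') (Suc n) G" and us: "length us = n" and i: "i \<le> Suc n"
  shows "H.coface_ev n i (mt G x) us = mt (H'.coface_ev n i G) x us"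
proof -
  have m: "multilinear (uscale H') (Suc (length us)) G" using balanced_multilinear[OF G] us by simp
  consider "i = 0" | "i = Suc n" | "i \<noteq> 0" "i \<noteq> Suc n" by blast
  then show ?thesis
  proof cases
    case 1
    then show ?thesis using mt_one_Cons[OF m]
      by (simp add: H.coface_ev_def[abs_def] H'.coface_ev_def[abs_def] del: mt.simps)
  next
    case 2
    then show ?thesis using mt_snoc_one[OF m]
      by (simp add: H.coface_ev_def[abs_def] H'.coface_ev_def[abs_def])
  next
    case 3
    then show ?thesis using mt_expand[of us G "i - 1" x] G us i
      by (simp add: H.coface_ev_def[abs_def] H'.coface_ev_def[abs_def])
  qed
qed

text \<open>The target is the base algebra, so equality is tested on its linear functionals;
  composed with the counit, such a functional is a balanced function of one factor, to which
  \<open>mt_single\<close> applies.\<close>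

lemma measuring_codegeneracy_1:
  assumes X: "X \<in> carrier (utensor H 1)"
  shows "\<psi> x (sweedler (vector_module (ascale H)) (\<lambda>us. counit H (us ! 0)) X) =
    sweedler (vector_module (ascale H')) (\<lambda>us. counit H' (us ! 0)) (measured_map 1 x X)"
proof (rule linear_functional_separates)
  show "vector_space (ascale H')" by (rule k_algebra.axioms(1)[OF H'.algebra_A])
  fix \<phi> assume \<phi>: "Vector_Spaces.linear (ascale H') (*) \<phi>"
  have m: "measured_map 1 x X \<in> carrier (utensor H' 1)" using measured_map_closed[OF X] by simp
  have b: "balanced (ubimodule H') 1 (\<lambda>us. \<phi> (counit H' (us ! 0)))"
    using linear_compose_functional[OF \<phi> H'.counit_linear] by (simp add: balanced_Suc)
  have "\<phi> (\<psi> x (sweedler (vector_module (ascale H)) (\<lambda>us. counit H (us ! 0)) X)) =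
      ev (\<lambda>us. \<phi> (\<psi> x (counit H (us ! 0)))) X"
    by (rule linear_sweedler[OF linear_compose_functional[OF \<phi> Psi_linear(3)] X])
  also have "\<dots> = ev (mt (\<lambda>us. \<phi> (counit H' (us ! 0))) x) X"
  proof (rule ev_cong[OF X])
    fix us :: "'u list" assume "length us = 1"
    then obtain u where "us = [u]" by (auto simp: length_Suc_conv)
    then show "\<phi> (\<psi> x (counit H (us ! 0))) = mt (\<lambda>us. \<phi> (counit H' (us ! 0))) x us"
      using mt_single[of "\<lambda>us. \<phi> (counit H' (us ! 0))" x u] balanced_multilinear[OF b]
      by (simp add: Psi_structure del: mt.simps)
  qed
  also have "\<dots> = ev (\<lambda>us. \<phi> (counit H' (us ! 0))) (measured_map 1 x X)"
    by (rule ev_measured_map[OF b X, symmetric]) simp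
  also have "\<dots> = \<phi> (sweedler (vector_module (ascale H')) (\<lambda>us. counit H' (us ! 0)) (measured_map 1 x X))"
    by (rule linear_sweedler[OF \<phi> m, symmetric])
  finally show "\<phi> (\<psi> x (sweedler (vector_module (ascale H)) (\<lambda>us. counit H (us ! 0)) X)) =
    \<phi> (sweedler (vector_module (ascale H')) (\<lambda>us. counit H' (us ! 0)) (measured_map 1 x X))" .
qed

lemma measuring_map_simps: "measuring_map C H' \<Psi> \<psi> x n (Inl a) = Inl (\<psi> x a)"
  "measuring_map C H' \<Psi> \<psi> x n (Inr X) = Inr (measured_map n x X)"
  by (simp_all add: measuring_map_def)

lemma hopf_obj_cases:
  assumes "z \<in> carrier (hopf_obj K n)"
  obtains a where "n = 0" "z = Inl a" | X where "n \<noteq> 0" "X \<in> carrier (utensor K n)" "z = Inr X"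
  using assms by (cases "n = 0") (auto simp: hopf_obj_def carrier_image_module)

lemma cocyclic_morphism_measuring_map:
  "cocyclic_morphism (hopf_cocyclic H) (hopf_cocyclic H') (measuring_map C H' \<Psi> \<psi> x)"
  (is "cocyclic_morphism _ _ ?F")
proof (unfold cocyclic_morphism_def hopf_cocyclic_def cocyclic.simps, intro conjI allI impI ballI)
  fix n
  show "linear_on (hopf_obj H n) (hopf_obj H' n) (?F n)"
  proof (cases "n = 0")
    case True
    have "linear_on (vector_module (ascale H)) (vector_module (ascale H')) (\<psi> x)"
      using Psi_linear(3)[of x] by (simp add: linear_on_def vector_module_def Vector_Spaces.linear_iff)
    then show ?thesis unfolding True hopf_obj_0
      by (rule linear_on_image_module[rotated 2]) (simp_all add: measuring_map_simps H.kspace_A)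
  next
    case False
    show ?thesis unfolding hopf_obj_Suc[OF False]
      by (rule linear_on_image_module[OF _ _ measured_map_linear[OF False]])
        (simp_all add: measuring_map_simps kspace_tensor_power)
  qed
  fix z assume z: "z \<in> carrier (hopf_obj H n)"
  show "?F (Suc n) (hopf_coface H n i z) = hopf_coface H' n i (?F n z)" if i: "i \<le> Suc n" for i
    using z
  proof (cases rule: hopf_obj_cases)
    case (1 a)
    \<comment> \<open>Cofaces out of degree 0 land in the one-factor power, where x acts undivided
      on the single entry.\<close>
    have "measured_map 1 x (upure H [u]) = upure H' [\<Psi> x u]" for u
    proof -
      have u: "upure H [u] \<in> carrier (utensor H 1)" by (simp add: pure_tensor_closed)
      show ?thesis
      proof (rule tensor_eqI[OF H'.U.vs, of _ 1])
        fix G assume G: "balanced (ubimodule H') 1 G"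
        have "ev G (measured_map 1 x (upure H [u])) = mt G x [u]"
          by (simp add: ev_measured_map[OF G u] ev_pure[OF balanced_mt[OF G]] del: mt.simps One_nat_def)
        also have "\<dots> = G [\<Psi> x u]"
          using balanced_multilinear[OF G] by (intro mt_single) simp
        finally show "ev G (measured_map 1 x (upure H [u])) = ev G (upure H' [\<Psi> x u])"
          by (simp add: ev_pure[OF G])
      qed (simp_all add: measured_map_closed[OF u] pure_tensor_closed del: One_nat_def)
    qed
    then show ?thesis using 1 by (simp add: hopf_coface_def measuring_map_simps Psi_structure)
  next
    case (2 X)
    have "measured_map (Suc n) x (sweedler (utensor H (Suc n)) (H.coface_tensor n i) X) =
        sweedler (utensor H' (Suc n)) (H'.coface_tensor n i) (measured_map n x X)"
      using 2 i by (intro measured_map_commute[where L = "H.coface_ev n i" and L' = "H'.coface_ev n i"]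
          H.coface_tensor_closed H'.coface_tensor_closed H.ev_coface_tensor H'.ev_coface_tensor
          H'.balanced_coface_ev mt_coface_ev) simp_all
    then show ?thesis using 2
      by (simp add: measuring_map_simps H.hopf_coface_Inr H'.hopf_coface_Inr)
  qed
  show "?F (n - 1) (hopf_codegeneracy H n i z) = hopf_codegeneracy H' n i (?F n z)" if i: "i < n" for i
    using z
  proof (cases rule: hopf_obj_cases)
    case (2 X)
    show ?thesis
    proof (cases "n = 1")
      case True
      then show ?thesis using 2 measuring_codegeneracy_1[of X x]
        by (simp add: hopf_codegeneracy_def measuring_map_simps)
    next
      case False
      then obtain m where n: "n = Suc (Suc m)" using 2(1) by (metis One_nat_def not0_implies_Suc)
      have "measured_map (Suc m) x (sweedler (utensor H (Suc m)) (H.codegeneracy_tensor n i) X) =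
        sweedler (utensor H' (Suc m)) (H'.codegeneracy_tensor n i) (measured_map n x X)"
        using 2 i unfolding n
        by (intro measured_map_commute[where L = "\<lambda>G us. if i \<le> m then H.contract i G us else H.contract_last m G us"
             and L' = "\<lambda>G. if i \<le> m then H'.contract i G else H'.contract_last m G"])
          (auto simp: H.ev_codegeneracy_tensor H'.ev_codegeneracy_tensor mt_contract mt_contract_last
            intro!: H.codegeneracy_tensor_closed H'.codegeneracy_tensor_closed
            H'.balanced_contract H'.balanced_contract_last)
      then show ?thesis using 2 n
        by (simp add: measuring_map_simps H.hopf_codegeneracy_Inr H'.hopf_codegeneracy_Inr)
    qed
  \<comment> \<open>In degree 0 there is no i < 0, so the \<open>undefined\<close> branch of
    \<open>hopf_codegeneracy\<close> is never reached.\<close>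
  qed (use i in simp)
  show "?F n (hopf_cyclic H n z) = hopf_cyclic H' n (?F n z)"
    using z
  proof (cases rule: hopf_obj_cases)
    case (1 a)
    then show ?thesis by (simp add: hopf_cyclic_def measuring_map_simps)
  next
    case (2 X)
    then obtain k where n: "n = Suc k" by (cases n) auto
    have "measured_map n x (sweedler (utensor H n) (H.cyclic_tensor n) X) =
        sweedler (utensor H' n) (H'.cyclic_tensor n) (measured_map n x X)"
      using 2 unfolding n
      by (intro measured_map_commute[where L = "H.rotate k" and L' = "H'.rotate k"]
          H.cyclic_tensor_closed H'.cyclic_tensor_closed H.ev_cyclic_tensor H'.ev_cyclic_tensor
          H'.balanced_rotate mt_rotate) simp_all
    then show ?thesis using 2
      by (simp add: measuring_map_simps H.hopf_cyclic_Inr H'.hopf_cyclic_Inr)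
  qed
qed

end

text \<open>The formulas in degree 0 and on pure tensors determine the family, because pure tensors
  span; each map on cohomology is determined by its values on classes of cocycles.\<close>

theorem proposition3p1:
  fixes H :: "('k::field, 'u::{ring, monoid_mult}, 'a::{ring, monoid_mult}) hopf_data"
    and H' :: "('k, 'v::{ring, monoid_mult}, 'b::{ring, monoid_mult}) hopf_data"
    and C :: "('k, 'c::ab_group_add) coalgebra_data"
    and \<Psi> :: "'c \<Rightarrow> 'u \<Rightarrow> 'v" and \<psi> :: "'c \<Rightarrow> 'a \<Rightarrow> 'b"
    and x :: 'c
  assumes "hopf_algebroid H" and "hopf_algebroid H'"
    and "cocommutative_coalgebra C"
    and "hopf_measuring C H H' \<Psi> \<psi>"
  shows "let X = hopf_cocyclic H; Y = hopf_cocyclic H'; F = measuring_map C H' \<Psi> \<psi> x in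
    (\<forall>a. F 0 (Inl a) = Inl (\<psi> x a)) \<and>
    (\<forall>us. us \<noteq> [] \<longrightarrow>
       F (length us) (Inr (upure H us)) = Inr (measured_tensor C H' \<Psi> x us)) \<and>
    cocyclic_morphism X Y F \<and>
    (\<forall>n. \<exists>h. linear_on (HH X n) (HH Y n) h \<and>
       (\<forall>z\<in>cocycles (obj X) (hochschild_b X) n.
          F n z \<in> cocycles (obj Y) (hochschild_b Y) n \<and>
          h (cohomology_class (obj X) (hochschild_b X) n z) =
            cohomology_class (obj Y) (hochschild_b Y) n (F n z))) \<and>
    (\<forall>n. \<exists>h. linear_on (HC X n) (HC Y n) h \<and>
       (\<forall>z\<in>cocycles (total_module X) (total_differential X) n.
          total_map F n z \<in> cocycles (total_module Y) (total_differential Y) n \<and>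
          h (cohomology_class (total_module X) (total_differential X) n z) =
            cohomology_class (total_module Y) (total_differential Y) n (total_map F n z)))"
proof -
  interpret hopf_algebroid_measuring H H' C \<Psi> \<psi>
    by (intro hopf_algebroid_measuring.intro hopf_algebroid_measuring_axioms.intro assms)
  interpret M: cocyclic_map "hopf_cocyclic H" "hopf_cocyclic H'" "measuring_map C H' \<Psi> \<psi> x"
    by (intro cocyclic_map.intro cocyclic_map_axioms.intro H.cocyclic_space_hopf H'.cocyclic_space_hopf
        cocyclic_morphism_measuring_map)
  show ?thesis
    unfolding Let_def
    by (intro conjI allI impI cocyclic_morphism_measuring_map M.HH_map M.HC_map)
      (simp_all add: measuring_map_simps measured_map_pure)
qed

end
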